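(* Suppose that (A1) $\min\{d_1,\dots,d_{L-1}\}\ge\min\{d_0,d_L\}$, and (A2) with $\lambda:=\lambda_1\cdots\lambda_L$: if $L=2$, then $\lambda\ne y_i^2$ for all $i\in[r_Y]$; if $L\ge3$, then $$\lambda\ne y_i^{2(L-1)}\left(\Big(\tfrac{L-2}{L}\Big)^{\frac{L}{2(L-1)}}+\Big(\tfrac{L}{L-2}\Big)^{\frac{L-2}{2(L-1)}}\right)^{-2(L-1)}\quad\forall i\in[r_Y].$$ Then there exist constants $\epsilon_1,\kappa_1>0$ such that for all $\bm W$ with $\mathrm{dist}(\bm W,\mathcal W_F)\le\epsilon_1$, $$\mathrm{dist}(\bm W,\mathcal W_F)\le\kappa_1\|\nabla F(\bm W)\|_F.$$
   Context: Let $L\ge2$, $d_0,\dots,d_L$ positive integers, $\bm Y\in\mathbb R^{d_L\times d_0}$ with singular values $y_1\ge\dots\ge y_{d_{\min}}\ge0$, $d_{\min}=\min\{d_0,d_L\}$, and $r_Y=\mathrm{rank}(\bm Y)$. Let $\lambda_1,\dots,\lambda_L>0$. For $\bm W=(\bm W_1,\dots,\bm W_L)$ with $\bm W_l\in\mathbb R^{d_l\times d_{l-1}}$, $F(\bm W)=\|\bm W_L\cdots\bm W_1-\bm Y\|_F^2+\sum_{l}\lambda_l\|\bm W_l\|_F^2$, $\mathcal W_F=\{\bm W:\nabla F(\bm W)=\bm0\}$, and $\mathrm{dist}(\bm W,\mathcal S)=\inf_{\bm V\in\mathcal S}\big(\sum_l\|\bm W_l-\bm V_l\|_F^2\big)^{1/2}$;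 $\|\nabla F(\bm W)\|_F=(\sum_l\|\nabla_{\bm W_l}F(\bm W)\|_F^2)^{1/2}$. *)

theory Defs
  imports "HOL-Analysis.Analysis"
begin

text \<open>Conventions. A weight tuple W = (W_1,...,W_L) is encoded as a function
  W :: nat => nat => nat => real, where W l i j is the (i,j) entry (0-based) of
  the d_l x d_(l-1) matrix W_l, for 1 <= l <= L, i < d l, j < d (l-1).
  Entries outside this index range are required to be 0 (predicate wt_valid),
  so that such functions are in bijection with the tuples of matrices.
  Y :: nat => nat => real is the d_L x d_0 target matrix (entries i < d L, j < d 0).\<close>

definition wt_valid :: "(nat \<Rightarrow> nat) \<Rightarrow> nat \<Rightarrow> (nat \<Rightarrow> nat \<Rightarrow> nat \<Rightarrow> real) \<Rightarrow> bool" where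
  "wt_valid d L W \<longleftrightarrow>
     (\<forall>l i j. (l < 1 \<or> l > L \<or> i \<ge> d l \<or> j \<ge> d (l - 1)) \<longrightarrow> W l i j = 0)"

fun wprod :: "(nat \<Rightarrow> nat) \<Rightarrow> (nat \<Rightarrow> nat \<Rightarrow> nat \<Rightarrow> real) \<Rightarrow> nat \<Rightarrow> nat \<Rightarrow> nat \<Rightarrow> real" where
  "wprod d W 0 i j = (if i = j then 1 else 0)"
| "wprod d W (Suc k) i j = (\<Sum>m<d k. W (Suc k) i m * wprod d W k m j)"

definition layer_sq :: "(nat \<Rightarrow> nat) \<Rightarrow> (nat \<Rightarrow> nat \<Rightarrow> nat \<Rightarrow> real) \<Rightarrow> nat \<Rightarrow> real" where
  "layer_sq d W l = (\<Sum>i<d l. \<Sum>j<d (l - 1). (W l i j)\<^sup>2)"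

definition lossF :: "(nat \<Rightarrow> nat) \<Rightarrow> nat \<Rightarrow> (nat \<Rightarrow> real) \<Rightarrow> (nat \<Rightarrow> nat \<Rightarrow> real)
      \<Rightarrow> (nat \<Rightarrow> nat \<Rightarrow> nat \<Rightarrow> real) \<Rightarrow> real" where
  "lossF d L lam Y W =
     (\<Sum>i<d L. \<Sum>j<d 0. (wprod d W L i j - Y i j)\<^sup>2) + (\<Sum>l=1..L. lam l * layer_sq d W l)"

definition gradF :: "(nat \<Rightarrow> nat) \<Rightarrow> nat \<Rightarrow> (nat \<Rightarrow> real) \<Rightarrow> (nat \<Rightarrow> nat \<Rightarrow> real)
      \<Rightarrow> (nat \<Rightarrow> nat \<Rightarrow> nat \<Rightarrow> real) \<Rightarrow> nat \<Rightarrow> nat \<Rightarrow> nat \<Rightarrow> real" where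
  "gradF d L lam Y W l i j =
     deriv (\<lambda>t. lossF d L lam Y
              (\<lambda>l' i' j'. if (l', i', j') = (l, i, j) then W l i j + t else W l' i' j')) 0"

definition grad_norm :: "(nat \<Rightarrow> nat) \<Rightarrow> nat \<Rightarrow> (nat \<Rightarrow> real) \<Rightarrow> (nat \<Rightarrow> nat \<Rightarrow> real)
      \<Rightarrow> (nat \<Rightarrow> nat \<Rightarrow> nat \<Rightarrow> real) \<Rightarrow> real" where
  "grad_norm d L lam Y W =
     sqrt (\<Sum>l=1..L. \<Sum>i<d l. \<Sum>j<d (l - 1). (gradF d L lam Y W l i j)\<^sup>2)"

definition crit_set :: "(nat \<Rightarrow> nat) \<Rightarrow> nat \<Rightarrow> (nat \<Rightarrow> real) \<Rightarrow> (nat \<Rightarrow> nat \<Rightarrow> real)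
      \<Rightarrow> (nat \<Rightarrow> nat \<Rightarrow> nat \<Rightarrow> real) set" where
  "crit_set d L lam Y =
     {W. wt_valid d L W \<and>
         (\<forall>l\<in>{1..L}. \<forall>i<d l. \<forall>j<d (l - 1). gradF d L lam Y W l i j = 0)}"

definition wdist :: "(nat \<Rightarrow> nat) \<Rightarrow> nat \<Rightarrow> (nat \<Rightarrow> nat \<Rightarrow> nat \<Rightarrow> real)
      \<Rightarrow> (nat \<Rightarrow> nat \<Rightarrow> nat \<Rightarrow> real) \<Rightarrow> real" where
  "wdist d L W V = sqrt (\<Sum>l=1..L. \<Sum>i<d l. \<Sum>j<d (l - 1). (W l i j - V l i j)\<^sup>2)"

definition wsetdist :: "(nat \<Rightarrow> nat) \<Rightarrow> nat \<Rightarrow> (nat \<Rightarrow> nat \<Rightarrow> nat \<Rightarrow> real)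
      \<Rightarrow> (nat \<Rightarrow> nat \<Rightarrow> nat \<Rightarrow> real) set \<Rightarrow> real" where
  "wsetdist d L W S = (INF V\<in>S. wdist d L W V)"

definition pos_singular_value :: "nat \<Rightarrow> nat \<Rightarrow> (nat \<Rightarrow> nat \<Rightarrow> real) \<Rightarrow> real \<Rightarrow> bool" where
  "pos_singular_value m n Y \<sigma> \<longleftrightarrow> \<sigma> > 0 \<and>
     (\<exists>v :: nat \<Rightarrow> real. (\<exists>j<n. v j \<noteq> 0) \<and>
        (\<forall>k<n. (\<Sum>j<n. (\<Sum>i<m. Y i k * Y i j) * v j) = \<sigma>\<^sup>2 * v k))"

end

theory Submission
  imports Defs
begin

text \<open>The error bound is a Morse--Bott property. Suppose it fails along \<open>W_n\<close>, let \<open>V_n\<close> be a critical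
  point nearest to \<open>W_n\<close> for the norm with weights \<open>\<lambda>_l\<close>, and pass to limits \<open>V\<close> of \<open>V_n\<close> (the critical
  set is compact) and \<open>X\<close> of the normalised differences. Then \<open>X\<close> is a unit vector in the kernel of the
  Hessian at \<open>V\<close>, and it is orthogonal to all curves \<open>Q_l V_l Q_(l-1)^T\<close> with \<open>Q_l\<close> orthogonal and
  \<open>Q_L Y = Y Q_0\<close>, because these consist of critical points. With the weighted norm, orthogonality to
  the rotations of the hidden spaces combines with the linearised balance equations into
  \<open>\<lambda>_(l+1) V_(l+1)^T X_(l+1) = \<lambda>_l X_l V_l^T\<close>. Testing the Hessian equations on eigenvectors of
  \<open>V_1^T V_1\<close> then yields scalar 2 by 2 systems. Such a system is nondegenerate unless (A2) fails or its
  kernel is spanned by a rotation preserving \<open>Y\<close>, which is excluded by orthogonality. Hence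
  \<open>X = 0\<close>, a contradiction.\<close>

subsection \<open>Matrices with finite rows and columns\<close>

text \<open>Write \<Lambda> for the product of all \<lambda>_l. By balance, each singular direction
  that V uses runs through all layers with one common parameter s > 0, and the singular value of Y
  belonging to it is sigma(s) = (s^(L/2) + \<Lambda> s^(1 - L/2)) / sqrt \<Lambda>. (A2) removes its
  degenerate values. For L >= 3 the derivative of sigma vanishes exactly where L s^(L-1) = (L - 2)
  \<Lambda>; there two families of critical points merge, and the Hessian acquires a kernel that no
  symmetry explains. For L = 2, sigma has no critical point, but sigma(s) tends to sqrt \<Lambda> as
  s tends to 0, where a direction used by V degenerates into one that V does not use. The remaining
  obstacle is a multiple singular value of Y whose directions carry different parameters, or partly
  none. The Hessian is then truly degenerate along simultaneous rotations of input and output space,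
  and the intertwining condition fixes the relative speed of the two rotations; this is the origin
  of the constants \<gamma>. No singular value decomposition is formed and the critical points are
  never classified: every relation is tested on single eigencolumns.\<close>

text \<open>All layers are embedded, padded by zeros, in one algebra of infinite matrices with finite
  rows and columns. This makes products of layers total and associative, and lets vectors
  be represented by matrices supported in column 0.\<close>

typedef rmat = "{A :: nat \<Rightarrow> nat \<Rightarrow> real. (\<forall>i. finite {j. A i j \<noteq> 0}) \<and> (\<forall>j. finite {i. A i j \<noteq> 0})}"
  morphisms ent Abs_rmat
  by (rule exI[of _ "\<lambda>i j. 0"]) auto

setup_lifting type_definition_rmat

lemma finite_row: "finite {j. ent A i j \<noteq> 0}"
  and finite_col: "finite {i. ent A i j \<noteq> 0}"
  using ent[of A] by auto

lemma rmat_eqI: "(\<And>i j. ent A i j = ent B i j) \<Longrightarrow> A = B"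
  by (metis ent_inverse ext)

instantiation rmat :: real_vector
begin

lift_definition zero_rmat :: rmat is "\<lambda>i j. 0" by auto

lift_definition plus_rmat :: "rmat \<Rightarrow> rmat \<Rightarrow> rmat" is "\<lambda>A B i j. A i j + B i j"
proof -
  fix A B :: "nat \<Rightarrow> nat \<Rightarrow> real"
  assume *: "(\<forall>i. finite {j. A i j \<noteq> 0}) \<and> (\<forall>j. finite {i. A i j \<noteq> 0})"
    "(\<forall>i. finite {j. B i j \<noteq> 0}) \<and> (\<forall>j. finite {i. B i j \<noteq> 0})"
  have "finite {j. A i j + B i j \<noteq> 0}" for i
    by (rule finite_subset[of _ "{j. A i j \<noteq> 0} \<union> {j. B i j \<noteq> 0}"]) (use * in auto)
  moreover have "finite {i. A i j + B i j \<noteq> 0}" for j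
    by (rule finite_subset[of _ "{i. A i j \<noteq> 0} \<union> {i. B i j \<noteq> 0}"]) (use * in auto)
  ultimately show "(\<forall>i. finite {j. A i j + B i j \<noteq> 0}) \<and> (\<forall>j. finite {i. A i j + B i j \<noteq> 0})"
    by blast
qed

lift_definition uminus_rmat :: "rmat \<Rightarrow> rmat" is "\<lambda>A i j. - A i j" by auto

lift_definition scaleR_rmat :: "real \<Rightarrow> rmat \<Rightarrow> rmat" is "\<lambda>c A i j. c * A i j"
  by simp

definition minus_rmat :: "rmat \<Rightarrow> rmat \<Rightarrow> rmat" where "minus_rmat A B = A + - B"

instance
proof
  fix A B C :: rmat and r t :: real
  show "A + B + C = A + (B + C)" "A + B = B + A" "0 + A = A" "- A + A = 0" "A - B = A + - B"
    "r *\<^sub>R (A + B) = r *\<^sub>R A + r *\<^sub>R B" "(r + t) *\<^sub>R A = r *\<^sub>R A + t *\<^sub>R A"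
    "r *\<^sub>R t *\<^sub>R A = (r * t) *\<^sub>R A" "1 *\<^sub>R A = A"
    by (rule rmat_eqI, simp add: minus_rmat_def plus_rmat.rep_eq zero_rmat.rep_eq
      uminus_rmat.rep_eq scaleR_rmat.rep_eq distrib_left distrib_right)+
qed

end

lemmas ent_zero [simp] = zero_rmat.rep_eq
lemmas ent_plus [simp] = plus_rmat.rep_eq
lemmas ent_uminus [simp] = uminus_rmat.rep_eq
lemmas ent_scaleR [simp] = scaleR_rmat.rep_eq

lemma ent_minus [simp]: "ent (A - B) i j = ent A i j - ent B i j"
  by (simp add: minus_rmat_def del: add_uminus_conv_diff)

instantiation rmat :: real_algebra_1
begin

lift_definition one_rmat :: rmat is "\<lambda>i j. if i = j then 1 else 0" by auto

lift_definition times_rmat :: "rmat \<Rightarrow> rmat \<Rightarrow> rmat"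
  is "\<lambda>A B i j. \<Sum>k | A i k \<noteq> 0. A i k * B k j"
proof -
  fix A B :: "nat \<Rightarrow> nat \<Rightarrow> real"
  assume *: "(\<forall>i. finite {j. A i j \<noteq> 0}) \<and> (\<forall>j. finite {i. A i j \<noteq> 0})"
    "(\<forall>i. finite {j. B i j \<noteq> 0}) \<and> (\<forall>j. finite {i. B i j \<noteq> 0})"
  let ?C = "\<lambda>i j. \<Sum>k | A i k \<noteq> 0. A i k * B k j"
  have nz: "\<exists>k. A i k \<noteq> 0 \<and> B k j \<noteq> 0" if "?C i j \<noteq> 0" for i j
  proof (rule ccontr)
    assume "\<not> ?thesis"
    then have "?C i j = 0" by (intro sum.neutral) auto
    with that show False by simp
  qed
  have "finite {j. ?C i j \<noteq> 0}" for i
    by (rule finite_subset[of _ "\<Union>k\<in>{k. A i k \<noteq> 0}. {j. B k j \<noteq> 0}"]) (use nz in blast, use * in simp)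
  moreover have "finite {i. ?C i j \<noteq> 0}" for j
    by (rule finite_subset[of _ "\<Union>k\<in>{k. B k j \<noteq> 0}. {i. A i k \<noteq> 0}"]) (use nz in blast, use * in simp)
  ultimately show "(\<forall>i. finite {j. ?C i j \<noteq> 0}) \<and> (\<forall>j. finite {i. ?C i j \<noteq> 0})"
    by blast
qed

lemma ent_times_left:
  assumes "finite S" "\<And>k. k \<notin> S \<Longrightarrow> ent A i k = 0"
  shows "ent (A * B) i j = (\<Sum>k\<in>S. ent A i k * ent B k j)"
  unfolding times_rmat.rep_eq
  by (rule sum.mono_neutral_left) (use assms in auto)

text \<open>The product is defined through the support of a row of the left factor. Enlarging the
  index set shows that the support of a column of the right factor serves equally well, so dimension
  bounds may come from either side.\<close>

lemma ent_times_right: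
  assumes "finite S" "\<And>k. k \<notin> S \<Longrightarrow> ent B k j = 0"
  shows "ent (A * B) i j = (\<Sum>k\<in>S. ent A i k * ent B k j)"
proof -
  have "ent (A * B) i j = (\<Sum>k\<in>S \<union> {k. ent A i k \<noteq> 0}. ent A i k * ent B k j)"
    by (rule ent_times_left) (use assms finite_row in auto)
  also have "\<dots> = (\<Sum>k\<in>S. ent A i k * ent B k j)"
    by (rule sum.mono_neutral_right) (use assms finite_row in auto)
  finally show ?thesis .
qed

lemma ent_times_col: "ent (A * B) i j = (\<Sum>k | ent B k j \<noteq> 0. ent A i k * ent B k j)"
  by (rule ent_times_right) (simp_all add: finite_col)

instance
proof
  fix A B C :: rmat and r :: real
  show "A * B * C = A * (B * C)"
  proof (rule rmat_eqI)
    fix i j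
    let ?K = "{k. ent A i k \<noteq> 0}" and ?M = "{m. ent C m j \<noteq> 0}"
    have "ent (A * B * C) i j = (\<Sum>m\<in>?M. ent (A * B) i m * ent C m j)"
      by (rule ent_times_right) (auto simp: finite_col)
    also have "\<dots> = (\<Sum>m\<in>?M. \<Sum>k\<in>?K. ent A i k * ent B k m * ent C m j)"
      by (simp add: times_rmat.rep_eq sum_distrib_right)
    also have "\<dots> = (\<Sum>k\<in>?K. ent A i k * (\<Sum>m\<in>?M. ent B k m * ent C m j))"
      by (subst sum.swap) (simp add: sum_distrib_left mult.assoc)
    also have "\<dots> = (\<Sum>k\<in>?K. ent A i k * ent (B * C) k j)"
      by (intro sum.cong refl arg_cong2[of _ _ _ _ "(*)"], subst ent_times_right[of ?M])
        (auto simp: finite_col)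
    also have "\<dots> = ent (A * (B * C)) i j"
      by (simp add: times_rmat.rep_eq)
    finally show "ent (A * B * C) i j = ent (A * (B * C)) i j" .
  qed
  show "1 * A = A"
  proof (rule rmat_eqI)
    fix i j show "ent (1 * A) i j = ent A i j"
      by (subst ent_times_left[of "{i}"]) (simp_all add: one_rmat.rep_eq)
  qed
  show "A * 1 = A"
  proof (rule rmat_eqI)
    fix i j show "ent (A * 1) i j = ent A i j"
      by (subst ent_times_right[of "{j}"]) (simp_all add: one_rmat.rep_eq)
  qed
  show "(A + B) * C = A * C + B * C"
  proof (rule rmat_eqI)
    fix i j
    show "ent ((A + B) * C) i j = ent (A * C + B * C) i j"
      by (simp add: ent_times_col distrib_right sum.distrib)
  qed
  show "A * (B + C) = A * B + A * C"
    by (rule rmat_eqI) (simp add: times_rmat.rep_eq algebra_simps sum.distrib)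
  have "ent 0 0 0 \<noteq> ent 1 0 0" by (simp add: one_rmat.rep_eq)
  then show "(0::rmat) \<noteq> 1" by metis
  show "r *\<^sub>R A * B = r *\<^sub>R (A * B)"
  proof (rule rmat_eqI)
    fix i j
    show "ent (r *\<^sub>R A * B) i j = ent (r *\<^sub>R (A * B)) i j"
      by (simp add: ent_times_col sum_distrib_left mult.assoc)
  qed
  show "A * r *\<^sub>R B = r *\<^sub>R (A * B)"
    by (rule rmat_eqI) (simp add: times_rmat.rep_eq sum_distrib_left algebra_simps)
qed

end

lemma ent_one: "ent 1 i j = (if i = j then 1 else 0)"
  by (simp add: one_rmat.rep_eq)

section \<open>Transposes, inner products, columns and coordinate projections\<close>

lift_definition tp :: "rmat \<Rightarrow> rmat" is "\<lambda>A i j. A j i" by auto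

lemmas ent_tp [simp] = tp.rep_eq

lemma tp_tp [simp]: "tp (tp A) = A"
  and tp_plus [simp]: "tp (A + B) = tp A + tp B"
  and tp_minus [simp]: "tp (A - B) = tp A - tp B"
  and tp_uminus [simp]: "tp (- A) = - tp A"
  and tp_scaleR [simp]: "tp (c *\<^sub>R A) = c *\<^sub>R tp A"
  and tp_zero [simp]: "tp 0 = 0"
  and tp_one [simp]: "tp 1 = 1"
  by (auto intro!: rmat_eqI simp: ent_one)

lemma tp_times [simp]: "tp (A * B) = tp B * tp A"
proof (rule rmat_eqI)
  fix i j
  show "ent (tp (A * B)) i j = ent (tp B * tp A) i j"
    by (simp add: ent_times_col[of "tp B"] times_rmat.rep_eq[of A] mult.commute)
qed

lemma tp_eq_0_iff [simp]: "tp A = 0 \<longleftrightarrow> A = 0"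
  by (metis tp_tp tp_zero)

text \<open>For columns \<open>a\<close>, \<open>b\<close> this is the Euclidean inner product; in general it only
  sees column 0 of its arguments.\<close>

definition ip :: "rmat \<Rightarrow> rmat \<Rightarrow> real" where "ip a b = ent (tp a * b) 0 0"

lemma ip_simps [simp]:
  "ip (a + b) c = ip a c + ip b c" "ip c (a + b) = ip c a + ip c b"
  "ip (a - b) c = ip a c - ip b c" "ip c (a - b) = ip c a - ip c b"
  "ip (- a) c = - ip a c" "ip c (- a) = - ip c a"
  "ip (r *\<^sub>R a) c = r * ip a c" "ip c (r *\<^sub>R a) = r * ip c a"
  "ip 0 c = 0" "ip c 0 = 0"
  by (simp_all add: ip_def algebra_simps)

lemma ip_left: "ip (A * a) b = ip a (tp A * b)"
  by (simp add: ip_def mult.assoc)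

lemma ip_right: "ip a (A * b) = ip (tp A * a) b"
  by (simp add: ip_def mult.assoc)

lemma ip_sum: "finite S \<Longrightarrow> (\<And>k. k \<notin> S \<Longrightarrow> ent a k 0 = 0) \<Longrightarrow> ip a b = (\<Sum>k\<in>S. ent a k 0 * ent b k 0)"
  unfolding ip_def by (subst ent_times_left[of S]) auto

lemma ip_commute: "ip a b = ip b a"
proof -
  have "ent (tp a * b) 0 0 = ent (tp (tp a * b)) 0 0" by (simp only: ent_tp)
  then show ?thesis by (simp add: ip_def)
qed

lemma ip_ge_0: "ip a a \<ge> 0"
  by (subst ip_sum[of "{k. ent a k 0 \<noteq> 0}"]) (auto simp: finite_col intro!: sum_nonneg)

lemma ip_eq_0D: "ip a a = 0 \<Longrightarrow> ent a k 0 = 0"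
proof (rule ccontr)
  assume *: "ip a a = 0" "ent a k 0 \<noteq> 0"
  have "(\<Sum>k | ent a k 0 \<noteq> 0. ent a k 0 * ent a k 0) = 0"
    using *(1) ip_sum[of "{k. ent a k 0 \<noteq> 0}" a a, OF finite_col] by simp
  then have "\<forall>k\<in>{k. ent a k 0 \<noteq> 0}. ent a k 0 * ent a k 0 = 0"
    by (subst (asm) sum_nonneg_eq_0_iff) (auto simp: finite_col)
  with * show False by auto
qed

text \<open>The diagonal of \<open>tp A * A\<close> consists of the squared column norms. Applied to
  \<open>A * z\<close>, this is the standard way below to pass from a vanishing Gram matrix to a
  vanishing image.\<close>

lemma tp_mult_self_eq_0: 
  assumes "tp A * A = 0" shows "A = 0"
proof (rule rmat_eqI)
  fix i j
  have "(\<Sum>k | ent A k j \<noteq> 0. ent A k j * ent A k j) = ent (tp A * A) j j"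
    by (simp add: ent_times_col)
  then have "(\<Sum>k | ent A k j \<noteq> 0. ent A k j * ent A k j) = 0"
    using assms by simp
  then have "\<forall>k\<in>{k. ent A k j \<noteq> 0}. ent A k j * ent A k j = 0"
    by (subst (asm) sum_nonneg_eq_0_iff) (auto simp: finite_col)
  then show "ent A i j = ent 0 i j" by auto
qed

definition is_col :: "rmat \<Rightarrow> bool" where "is_col a \<longleftrightarrow> (\<forall>i j. j \<noteq> 0 \<longrightarrow> ent a i j = 0)"

lemma is_col_mult: "is_col a \<Longrightarrow> is_col (A * a)"
  by (simp add: is_col_def times_rmat.rep_eq)

lemma is_col_scaleR: "is_col a \<Longrightarrow> is_col (r *\<^sub>R a)"
  by (simp add: is_col_def)

lemma col_ip_eq_0: "is_col a \<Longrightarrow> ip a a = 0 \<Longrightarrow> a = 0"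
  by (rule rmat_eqI) (metis ip_eq_0D ent_zero is_col_def)

text \<open>A row times a column is supported at entry (0,0), so multiplying a column by it is a
  scalar multiplication.\<close>

lemma col_tp_mult: "is_col a \<Longrightarrow> is_col b \<Longrightarrow> is_col c \<Longrightarrow> a * (tp b * c) = ip b c *\<^sub>R a"
proof (rule rmat_eqI)
  fix i j assume *: "is_col a" "is_col b" "is_col c"
  show "ent (a * (tp b * c)) i j = ent (ip b c *\<^sub>R a) i j"
  proof (cases "j = 0")
    case True
    then show ?thesis using * by (subst ent_times_left[of "{0}"]) (auto simp: is_col_def ip_def)
  next
    case False
    have "is_col (a * (tp b * c))" using * by (simp add: is_col_mult)
    then show ?thesis using * False by (simp add: is_col_def)
  qed
qed

lift_definition unit_col :: "nat \<Rightarrow> rmat" is "\<lambda>k i j. if i = k \<and> j = 0 then 1 else 0"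
  by simp

lemma is_col_unit_col: "is_col (unit_col k)"
  by (simp add: is_col_def unit_col.rep_eq)

lemma ent_mult_unit_col: "ent (A * unit_col k) i 0 = ent A i k"
  by (subst ent_times_right[of "{k}"]) (auto simp: unit_col.rep_eq)

lemma ip_unit_col: "ip (unit_col i) (A * unit_col j) = ent A i j"
  by (subst ip_sum[of "{i}"]) (auto simp: ent_mult_unit_col unit_col.rep_eq)

lemma rmat_col_eqI: 
  assumes "\<And>c. is_col c \<Longrightarrow> A * c = B * c" shows "A = B"
  by (rule rmat_eqI) (metis assms is_col_unit_col ent_mult_unit_col)

text \<open>Dimensions are tracked by equations: a matrix is m by n exactly if \<open>proj m\<close>
  fixes it from the left and \<open>proj n\<close> from the right. The unit \<open>1\<close> stays
  infinite, and so do the rotations built from it later.\<close>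

lift_definition proj :: "nat \<Rightarrow> rmat" is "\<lambda>n i j. if i = j \<and> i < n then 1 else 0"
  by simp

lemma tp_proj [simp]: "tp (proj n) = proj n"
  by (rule rmat_eqI) (simp add: proj.rep_eq)

lemma ent_proj_mult: "ent (proj n * A) i j = (if i < n then ent A i j else 0)"
  by (subst ent_times_left[of "{i}"]) (auto simp: proj.rep_eq)

lemma proj_mult_iff: "proj n * A = A \<longleftrightarrow> (\<forall>i\<ge>n. \<forall>j. ent A i j = 0)"
proof
  assume *: "proj n * A = A"
  show "\<forall>i\<ge>n. \<forall>j. ent A i j = 0"
  proof (intro allI impI)
    fix i j assume "n \<le> i"
    then show "ent A i j = 0" using ent_proj_mult[of n A i j] * by simp
  qed
next
  assume *: "\<forall>i\<ge>n. \<forall>j. ent A i j = 0"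
  show "proj n * A = A"
    by (rule rmat_eqI) (use * in \<open>auto simp: ent_proj_mult\<close>)
qed

lemma mult_proj_iff: "A * proj n = A \<longleftrightarrow> (\<forall>j\<ge>n. \<forall>i. ent A i j = 0)"
proof -
  have "A * proj n = A \<longleftrightarrow> proj n * tp A = tp A"
    by (metis tp_tp tp_times tp_proj)
  also have "\<dots> \<longleftrightarrow> (\<forall>j\<ge>n. \<forall>i. ent A i j = 0)"
    by (simp add: proj_mult_iff)
  finally show ?thesis .
qed

subsection \<open>Eigencolumns of symmetric matrices\<close>

text \<open>Tychonoff's theorem, as the topology on functions is the product topology. It replaces
  finite-dimensional compactness for vectors and weight tuples that are encoded as
  functions.\<close>

lemma compact_box_fun: "compact {f :: 'a \<Rightarrow> 'b :: topological_space. \<forall>i. f i \<in> S i}" if "\<And>i. compact (S i)"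
proof -
  have "compactin (product_topology (\<lambda>i. euclidean) UNIV) (PiE UNIV S)"
    using that by (simp add: compactin_PiE)
  moreover have "PiE UNIV S = {f. \<forall>i. f i \<in> S i}"
    by (auto simp: PiE_def Pi_def)
  ultimately show ?thesis
    by (simp add: euclidean_product_topology)
qed

text \<open>The feasible set is an intersection of closed conditions, so \<open>E\<close> may be
  infinite; the unit-length condition puts it inside a compact box.\<close>

lemma rayleigh_max_exists:
  fixes B :: "nat \<Rightarrow> nat \<Rightarrow> real" and E :: "(nat \<Rightarrow> real) set"
  assumes K_def: "K = {v. (\<forall>i\<ge>N. v i = 0) \<and> (\<forall>b\<in>E. (\<Sum>i<N. b i * v i) = 0) \<and> (\<Sum>i<N. v i * v i) = 1}"
  assumes "K \<noteq> {}"
  shows "\<exists>v\<in>K. \<forall>w\<in>K. (\<Sum>i<N. w i * (\<Sum>j<N. B i j * w j)) \<le> (\<Sum>i<N. v i * (\<Sum>j<N. B i j * v j))"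
proof (rule continuous_attains_sup)
  let ?box = "{v :: nat \<Rightarrow> real. \<forall>i. v i \<in> (if i < N then {-1..1} else {0})}"
  have "K = ?box \<inter> ({v. \<forall>b\<in>E. (\<Sum>i<N. b i * v i) = 0} \<inter> {v. (\<Sum>i<N. v i * v i) = 1})" (is "_ = ?R")
  proof (intro equalityI subsetI)
    fix v assume v: "v \<in> K"
    have "\<bar>v i\<bar> \<le> 1" if "i < N" for i
    proof -
      have "v i * v i \<le> (\<Sum>i<N. v i * v i)"
        by (rule member_le_sum) (use that in auto)
      then have "(v i)\<^sup>2 \<le> 1" using v by (simp add: K_def power2_eq_square)
      then show ?thesis by (simp add: abs_square_le_1)
    qed
    with v show "v \<in> ?R" by (auto simp: K_def abs_le_iff)
  next
    fix v assume "v \<in> ?R"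
    then show "v \<in> K" unfolding K_def
      by (auto split: if_splits) (metis linorder_not_le)
  qed
  moreover have "compact ?box" by (rule compact_box_fun) auto
  moreover have "closed {v :: nat \<Rightarrow> real. \<forall>b\<in>E. (\<Sum>i<N. b i * v i) = 0}"
    unfolding Ball_def
    by (intro closed_Collect_all closed_Collect_imp closed_Collect_eq open_Collect_const
        continuous_intros continuous_on_product_coordinates)
  moreover have "closed {v :: nat \<Rightarrow> real. (\<Sum>i<N. v i * v i) = 1}"
    by (intro closed_Collect_eq continuous_intros continuous_on_product_coordinates)
  ultimately show "compact K"
    by (simp add: closed_Int compact_Int_closed)
  show "continuous_on K (\<lambda>v. \<Sum>i<N. v i * (\<Sum>j<N. B i j * v j))"
    by (intro continuous_intros continuous_on_subset[OF continuous_on_product_coordinates]) auto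
qed (fact assms)

lemma ip_lessThan: "proj N * a = a \<Longrightarrow> ip a b = (\<Sum>k<N. ent a k 0 * ent b k 0)"
  by (rule ip_sum) (auto simp: proj_mult_iff not_less)

lift_definition cvec :: "nat \<Rightarrow> (nat \<Rightarrow> real) \<Rightarrow> rmat" is "\<lambda>N f i j. if j = 0 \<and> i < N then f i else 0"
  by simp

lemma cvec_col: "is_col (cvec N f)" and cvec_proj: "proj N * cvec N f = cvec N f"
  by (auto simp: is_col_def cvec.rep_eq proj_mult_iff)

lemma ip_mult_lessThan:
  assumes "proj N * a = a"
  shows "ip a (B * a) = (\<Sum>i<N. ent a i 0 * (\<Sum>j<N. ent B i j * ent a j 0))"
  unfolding ip_lessThan[OF assms]
  by (intro sum.cong refl arg_cong2[of _ _ _ _ "(*)"] ent_times_right)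
    (use assms in \<open>auto simp: proj_mult_iff\<close>)

lemma real_quadratic_bound_imp_0:
  fixes \<alpha> \<beta> :: real
  assumes "\<And>t. 2 * t * \<alpha> \<le> t\<^sup>2 * \<beta>"
  shows "\<alpha> = 0"
proof -
  have \<beta>: "\<beta> \<ge> 0" using assms[of 1] assms[of "-1"] by simp
  \<comment> \<open>Testing at t = x gives a multiple of x^2 that is at most 0. The summand 1 avoids
    a division by \<beta> = 0.\<close>
  define x where "x = \<alpha> / (\<beta> + 1)"
  have x: "\<alpha> = x * (\<beta> + 1)" using \<beta> by (simp add: x_def)
  have "2 * x * \<alpha> \<le> x\<^sup>2 * \<beta>" by (rule assms)
  then have "x\<^sup>2 * (\<beta> + 2) \<le> 0" unfolding x by (simp add: power2_eq_square algebra_simps)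
  then show ?thesis using \<beta> by (simp add: x mult_le_0_iff)
qed

text \<open>A substitute for the spectral theorem: the eigencolumns leave no nonzero supported
  column orthogonal to all of them. Otherwise the space \<open>S\<close> of such columns is nonzero
  and invariant under the symmetric \<open>B\<close>, the Rayleigh quotient attains a maximum on its
  unit sphere, and a maximiser is an eigencolumn in \<open>S\<close>, hence orthogonal to
  itself.\<close>

lemma symmetric_eigencolumn_exists:
  assumes sym: "tp B = B" and B: "proj N * B = B"
    and c: "is_col c" "proj N * c = c" "c \<noteq> 0"
  shows "\<exists>b t. is_col b \<and> B * b = t *\<^sub>R b \<and> ip b c \<noteq> 0"
proof (rule ccontr)
  assume no: "\<nexists>b t. is_col b \<and> B * b = t *\<^sub>R b \<and> ip b c \<noteq> 0"
  define Eg where "Eg = {b. is_col b \<and> proj N * b = b \<and> (\<exists>t. B * b = t *\<^sub>R b)}"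
  define S where "S = {v. is_col v \<and> proj N * v = v \<and> (\<forall>b\<in>Eg. ip b v = 0)}"
  define E where "E = (\<lambda>b i. ent b i 0) ` Eg"
  define K where "K = {v. (\<forall>i\<ge>N. v i = (0::real)) \<and> (\<forall>b\<in>E. (\<Sum>i<N. b i * v i) = 0) \<and> (\<Sum>i<N. v i * v i) = 1}"
  have KI: "(\<lambda>i. ent v i 0) \<in> K" if "v \<in> S" "ip v v = 1" for v
  proof -
    have "(\<Sum>i<N. ent b i 0 * ent v i 0) = 0" if "b \<in> Eg" for b
      using that \<open>v \<in> S\<close> ip_lessThan[of N b v] by (auto simp: S_def Eg_def)
    moreover have "(\<Sum>i<N. ent v i 0 * ent v i 0) = 1"
      using that ip_lessThan[of N v v] by (auto simp: S_def)
    ultimately show ?thesis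
      using that by (auto simp: K_def E_def S_def proj_mult_iff)
  qed
  have KD: "cvec N f \<in> S \<and> ip (cvec N f) (cvec N f) = 1" if "f \<in> K" for f
  proof -
    have "ip b (cvec N f) = 0" if "b \<in> Eg" for b
    proof -
      have "ip b (cvec N f) = (\<Sum>i<N. ent b i 0 * f i)"
        using that by (subst ip_lessThan[of N]) (auto simp: Eg_def cvec.rep_eq)
      also have "\<dots> = 0" using that \<open>f \<in> K\<close> by (auto simp: K_def E_def)
      finally show ?thesis .
    qed
    moreover have "ip (cvec N f) (cvec N f) = (\<Sum>i<N. f i * f i)"
      by (subst ip_lessThan[of N]) (auto simp: cvec_proj cvec.rep_eq)
    ultimately show ?thesis
      using \<open>f \<in> K\<close> by (simp add: S_def cvec_col cvec_proj K_def)
  qed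
  have Ssc: "r *\<^sub>R v \<in> S" if "v \<in> S" for r v
    using that by (simp add: S_def is_col_scaleR)
  have Sadd: "v + w \<in> S" if "v \<in> S" "w \<in> S" for v w
    using that by (simp add: S_def is_col_def distrib_left)
  have SB: "B * v \<in> S" if "v \<in> S" for v
  proof -
    have "ip b (B * v) = 0" if b: "b \<in> Eg" for b
    proof -
      obtain t where "B * b = t *\<^sub>R b" using b unfolding Eg_def by blast
      then have "ip b (B * v) = t * ip b v" by (simp add: ip_right sym)
      then show ?thesis using b \<open>v \<in> S\<close> by (simp add: S_def)
    qed
    moreover have "proj N * (B * v) = B * v" by (metis B mult.assoc)
    ultimately show ?thesis using that by (simp add: S_def is_col_mult)
  qed
  have normalise: "ip ((1 / sqrt (ip v v)) *\<^sub>R v) ((1 / sqrt (ip v v)) *\<^sub>R v) = 1"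
    if "is_col v" "v \<noteq> 0" for v
  proof -
    have "ip v v > 0" using that col_ip_eq_0 ip_ge_0[of v] by (metis less_eq_real_def)
    then show ?thesis by (simp add: field_simps)
  qed
  have "c \<in> S" using c no by (auto simp: S_def Eg_def)
  then have "K \<noteq> {}" using KI[OF Ssc normalise] c by blast
  then obtain f where f: "f \<in> K"
    "\<And>w. w \<in> K \<Longrightarrow> (\<Sum>i<N. w i * (\<Sum>j<N. ent B i j * w j)) \<le> (\<Sum>i<N. f i * (\<Sum>j<N. ent B i j * f j))"
    using rayleigh_max_exists[OF K_def, of "ent B"] by blast
  define v where "v = cvec N f"
  have v: "v \<in> S" "ip v v = 1" using KD[OF f(1)] by (auto simp: v_def)
  define m where "m = ip v (B * v)"
  have m: "m = (\<Sum>i<N. f i * (\<Sum>j<N. ent B i j * f j))"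
    unfolding m_def v_def ip_mult_lessThan[OF cvec_proj] by (simp add: cvec.rep_eq)
  have unit: "ip w (B * w) \<le> m" if "w \<in> S" "ip w w = 1" for w
    using f(2)[OF KI[OF that]] that unfolding m by (subst ip_mult_lessThan[of N]) (auto simp: S_def)
  have le: "ip w (B * w) \<le> m * ip w w" if "w \<in> S" for w
  proof (cases "w = 0")
    case False
    have "is_col w" using that by (simp add: S_def)
    then have pos: "ip w w > 0" using False col_ip_eq_0 ip_ge_0[of w] by (metis less_eq_real_def)
    have "ip ((1 / sqrt (ip w w)) *\<^sub>R w) (B * ((1 / sqrt (ip w w)) *\<^sub>R w)) \<le> m"
      by (rule unit[OF Ssc[OF that] normalise]) fact+
    then show ?thesis using pos by (simp add: field_simps)
  qed simp
  have crit: "ip h (B * v) - m * ip h v = 0" if "h \<in> S" for h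
  proof (rule real_quadratic_bound_imp_0)
    fix t :: real
    have "ip (v + t *\<^sub>R h) (B * (v + t *\<^sub>R h)) \<le> m * ip (v + t *\<^sub>R h) (v + t *\<^sub>R h)"
      by (rule le) (use v that Ssc Sadd in auto)
    moreover have "ip v (B * h) = ip h (B * v)" by (metis ip_commute ip_right sym)
    ultimately show "2 * t * (ip h (B * v) - m * ip h v) \<le> t\<^sup>2 * (m * ip h h - ip h (B * h))"
      using v(2) m_def ip_commute[of v h] by (simp add: distrib_left algebra_simps power2_eq_square)
  qed
  \<comment> \<open>The residual of the eigenvalue equation is itself an admissible variation, so
    the first-order condition says that its own norm vanishes.\<close>
  define h where "h = B * v + (- m) *\<^sub>R v"
  have "h \<in> S" unfolding h_def using v SB Ssc Sadd by blast
  moreover have "ip h h = ip h (B * v) - m * ip h v"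
    by (subst (2) h_def) simp
  ultimately have "h = 0" using crit col_ip_eq_0 by (simp add: S_def)
  then have "v \<in> Eg" using v by (auto simp: Eg_def S_def h_def add_eq_0_iff2)
  then have "ip v v = 0" using v by (simp add: S_def)
  with v(2) show False by simp
qed

subsection \<open>Products of layers, the gradient and its derivative\<close>

text \<open>This is W_l ... W_(k+1), with the empty product for l <= k. With this convention the
  factors to the left and to the right of layer l in the full product are \<open>pr W L l\<close>
  and \<open>pr W (l - 1) 0\<close>.\<close>

fun pr :: "(nat \<Rightarrow> rmat) \<Rightarrow> nat \<Rightarrow> nat \<Rightarrow> rmat" where
  "pr W 0 k = 1"
| "pr W (Suc l) k = (if k \<le> l then W (Suc l) * pr W l k else 1)"

text \<open>The derivative of \<open>pr\<close> at V in direction X, by the product rule.\<close>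

fun dpr :: "(nat \<Rightarrow> rmat) \<Rightarrow> (nat \<Rightarrow> rmat) \<Rightarrow> nat \<Rightarrow> nat \<Rightarrow> rmat" where
  "dpr V X 0 k = 0"
| "dpr V X (Suc l) k = (if k \<le> l then X (Suc l) * pr V l k + V (Suc l) * dpr V X l k else 0)"

lemma pr_ge [simp]: "l \<le> k \<Longrightarrow> pr W l k = 1"
  by (cases l) auto

lemma dpr_ge [simp]: "l \<le> k \<Longrightarrow> dpr V X l k = 0"
  by (cases l) auto

lemma pr_low: "k < l \<Longrightarrow> pr W l k = pr W l (Suc k) * W (Suc k)"
proof (induction l)
  case (Suc l)
  then show ?case by (cases "k = l") (auto simp: mult.assoc)
qed simp

lemma dpr_low: "k < l \<Longrightarrow> dpr V X l k = dpr V X l (Suc k) * V (Suc k) + pr V l (Suc k) * X (Suc k)"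
proof (induction l)
  case (Suc l)
  show ?case
  proof (cases "k = l")
    case False
    then have kl: "k < l" "Suc k \<le> l" "k \<le> l" using Suc.prems by auto
    have "dpr V X (Suc l) k = X (Suc l) * (pr V l (Suc k) * V (Suc k))
       + V (Suc l) * (dpr V X l (Suc k) * V (Suc k) + pr V l (Suc k) * X (Suc k))"
      using kl Suc.IH by (simp flip: pr_low)
    then show ?thesis using kl by (simp add: algebra_simps)
  qed simp
qed simp

text \<open>Half the gradient of the loss with respect to layer l, so that no factor 2 is carried
  along. Its derivative in direction X, half the Hessian applied to X, is \<open>dhgrad\<close>
  below.\<close>

definition hgrad :: "(nat \<Rightarrow> real) \<Rightarrow> rmat \<Rightarrow> nat \<Rightarrow> (nat \<Rightarrow> rmat) \<Rightarrow> nat \<Rightarrow> rmat" where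
  "hgrad lam Y L W l = tp (pr W L l) * (pr W L 0 - Y) * tp (pr W (l - 1) 0) + lam l *\<^sub>R W l"

definition dhgrad :: "(nat \<Rightarrow> real) \<Rightarrow> rmat \<Rightarrow> nat \<Rightarrow> (nat \<Rightarrow> rmat) \<Rightarrow> (nat \<Rightarrow> rmat) \<Rightarrow> nat \<Rightarrow> rmat" where
  "dhgrad lam Y L V X l = tp (dpr V X L l) * (pr V L 0 - Y) * tp (pr V (l - 1) 0)
     + tp (pr V L l) * dpr V X L 0 * tp (pr V (l - 1) 0)
     + tp (pr V L l) * (pr V L 0 - Y) * tp (dpr V X (l - 1) 0) + lam l *\<^sub>R X l"

text \<open>Both data terms equal \<open>tp (pr W L l) * (pr W L 0 - Y) * tp (pr W l 0)\<close> and
  cancel. The identity holds at every W, which is what allows it to be differentiated; at a critical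
  point it is the balance of neighbouring layers.\<close>

lemma hgrad_balance:
  assumes "1 \<le> l" "l < L"
  shows "tp (W (Suc l)) * hgrad lam Y L W (Suc l) - hgrad lam Y L W l * tp (W l)
    = lam (Suc l) *\<^sub>R (tp (W (Suc l)) * W (Suc l)) - lam l *\<^sub>R (W l * tp (W l))"
proof -
  obtain j where j: "l = Suc j" using assms by (cases l) auto
  have 1: "tp (pr W L l) = tp (W (Suc l)) * tp (pr W L (Suc l))"
    using assms by (simp add: pr_low)
  have 2: "tp (pr W l 0) = tp (pr W (l - 1) 0) * tp (W l)"
    by (simp add: j)
  have 3: "Suc l - 1 = l" by simp
  show ?thesis
    unfolding hgrad_def 3 1 2
    by (simp add: distrib_left distrib_right mult.assoc)
qed

text \<open>The derivative of \<open>hgrad_balance\<close> in direction X. At a critical point and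
  for X in the kernel of the Hessian the left side vanishes.\<close>

lemma dhgrad_balance:
  assumes "1 \<le> l" "l < L"
  shows "tp (X (Suc l)) * hgrad lam Y L V (Suc l) + tp (V (Suc l)) * dhgrad lam Y L V X (Suc l)
      - dhgrad lam Y L V X l * tp (V l) - hgrad lam Y L V l * tp (X l)
    = lam (Suc l) *\<^sub>R (tp (X (Suc l)) * V (Suc l) + tp (V (Suc l)) * X (Suc l))
      - lam l *\<^sub>R (X l * tp (V l) + V l * tp (X l))"
proof -
  obtain j where j: "l = Suc j" using assms by (cases l) auto
  have 1: "tp (pr V L l) = tp (V (Suc l)) * tp (pr V L (Suc l))"
    using assms by (simp add: pr_low)
  have 2: "tp (pr V l 0) = tp (pr V (l - 1) 0) * tp (V l)"
    by (simp add: j)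
  have 3: "tp (dpr V X L l) = tp (V (Suc l)) * tp (dpr V X L (Suc l)) + tp (X (Suc l)) * tp (pr V L (Suc l))"
    using assms by (simp add: dpr_low)
  have 4: "tp (dpr V X l 0) = tp (pr V (l - 1) 0) * tp (X l) + tp (dpr V X (l - 1) 0) * tp (V l)"
    by (simp add: j)
  have 5: "Suc l - 1 = l" by simp
  show ?thesis
    unfolding hgrad_def dhgrad_def 5 1 2 3 4
    by (simp add: distrib_left distrib_right left_diff_distrib right_diff_distrib scaleR_right_distrib
        scaleR_right_diff_distrib mult.assoc)
qed

lemma scaleR_solve: "r \<noteq> 0 \<Longrightarrow> r *\<^sub>R A = s *\<^sub>R B \<Longrightarrow> A = (s / r) *\<^sub>R (B :: 'a :: real_vector)"
  by (metis (no_types, lifting) divide_inverse mult.commute scaleR_one scaleR_scaleR right_inverse)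

text \<open>The divided difference (s^n - t^n) / (s - t), written as a sum so that s = t is covered.
  It arises when the derivative of a product of layers is tested between eigencolumns with
  parameters s and t.\<close>

definition geo :: "real \<Rightarrow> real \<Rightarrow> nat \<Rightarrow> real" where
  "geo s t n = (\<Sum>k<n. s ^ k * t ^ (n - 1 - k))"

lemma geo_commute: "geo s t n = geo t s n"
  unfolding geo_def
  by (subst sum.nat_diff_reindex[symmetric], intro sum.cong) (auto simp: mult.commute)

lemma geo_0 [simp]: "geo s t 0 = 0" by (simp add: geo_def)

lemma geo_Suc: "geo s t (Suc n) = s ^ n + t * geo s t n"
proof -
  have "(\<Sum>k<n. s ^ k * t ^ (n - k)) = (\<Sum>k<n. t * (s ^ k * t ^ (n - 1 - k)))"
  proof (intro sum.cong refl)
    fix k assume "k \<in> {..<n}"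
    then have "n - k = Suc (n - 1 - k)" by auto
    then show "s ^ k * t ^ (n - k) = t * (s ^ k * t ^ (n - 1 - k))" by simp
  qed
  then show ?thesis by (simp add: geo_def sum_distrib_left)
qed

lemma geo_same: "geo s s n = n * s ^ (n - 1)"
proof -
  have "geo s s n = (\<Sum>k<n. s ^ (n - 1))"
    unfolding geo_def by (intro sum.cong) (auto simp flip: power_add)
  then show ?thesis by simp
qed

lemma geo_diff: "(s - t) * geo s t n = s ^ n - t ^ n"
proof (induction n)
  case (Suc n)
  have "(s - t) * geo s t (Suc n) = (s - t) * s ^ n + t * ((s - t) * geo s t n)"
    by (simp add: geo_Suc algebra_simps)
  then show ?case unfolding Suc.IH by (simp add: algebra_simps)
qed simp

lemma geo_pos: "s > 0 \<Longrightarrow> t > 0 \<Longrightarrow> n \<ge> 1 \<Longrightarrow> geo s t n > 0"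
  unfolding geo_def by (intro sum_pos) (auto simp: lessThan_empty_iff)

lemma geo_gt: assumes "s > 0" "t > 0" "n \<ge> 2" shows "geo s t n > s ^ (n - 1)"
proof -
  obtain m where "n = Suc m" "m \<ge> 1" using assms by (cases n) auto
  then show ?thesis using assms geo_pos[of s t m] by (simp add: geo_Suc)
qed

definition lprod :: "(nat \<Rightarrow> real) \<Rightarrow> nat \<Rightarrow> nat \<Rightarrow> real" where
  "lprod lam k l = (\<Prod>j\<in>{k<..l}. lam j)"

lemma lprod_same [simp]: "lprod lam k k = 1" by (simp add: lprod_def)

lemma lprod_Suc: "k \<le> l \<Longrightarrow> lprod lam k (Suc l) = lam (Suc l) * lprod lam k l"
proof -
  assume "k \<le> l"
  then have "{k<..Suc l} = insert (Suc l) {k<..l}" by auto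
  then show ?thesis by (simp add: lprod_def)
qed

lemma lprod_low: "k < l \<Longrightarrow> lprod lam k l = lam (Suc k) * lprod lam (Suc k) l"
proof -
  assume "k < l"
  then have "{k<..l} = insert (Suc k) {Suc k<..l}" by auto
  then show ?thesis by (simp add: lprod_def)
qed

subsection \<open>The kernel of the Hessian\<close>

lemma eq_if_sym_and_antisym_eq:
  fixes A B C D :: "'a :: real_vector"
  assumes "D + C - (A + B) = 0" "B - D = A - C"
  shows "C = A"
proof -
  have "D = A + B - C" using assms(1) by (simp add: algebra_simps)
  with assms(2) have "(C - A) + (C - A) = 0" by (simp add: algebra_simps)
  then have "2 *\<^sub>R (C - A) = 0" by (simp only: scaleR_2)
  then show ?thesis by simp
qed

text \<open>The facts about a limit direction from which X = 0 follows. \<open>orth_mid\<close> is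
  orthogonality to rotations of one hidden space. \<open>orth_end\<close> is orthogonality to a
  rotation in the plane of a, x in the input space joined with one in the plane of a', w in the
  output space; equal products of squared lengths give both generators the same cubic relation, and
  the last premise makes them intertwine with Y. \<open>nondeg2\<close> and \<open>nondeg3\<close>
  carry (A2); the coefficient in \<open>nondeg3\<close> is the squared singular value
  sigma(s)^2.\<close>

locale kernel_direction =
  fixes L :: nat and lam :: "nat \<Rightarrow> real" and d :: "nat \<Rightarrow> nat"
    and Y :: rmat and V X :: "nat \<Rightarrow> rmat"
  assumes L2: "2 \<le> L"
    and lam_pos: "\<And>l. 1 \<le> l \<Longrightarrow> l \<le> L \<Longrightarrow> lam l > 0"
    and V_left: "\<And>l. 1 \<le> l \<Longrightarrow> l \<le> L \<Longrightarrow> proj (d l) * V l = V l"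
    and V_right: "\<And>l. 1 \<le> l \<Longrightarrow> l \<le> L \<Longrightarrow> V l * proj (d (l - 1)) = V l"
    and X_left: "\<And>l. 1 \<le> l \<Longrightarrow> l \<le> L \<Longrightarrow> proj (d l) * X l = X l"
    and X_right: "\<And>l. 1 \<le> l \<Longrightarrow> l \<le> L \<Longrightarrow> X l * proj (d (l - 1)) = X l"
    and crit: "\<And>l. 1 \<le> l \<Longrightarrow> l \<le> L \<Longrightarrow> hgrad lam Y L V l = 0"
    and lin: "\<And>l. 1 \<le> l \<Longrightarrow> l \<le> L \<Longrightarrow> dhgrad lam Y L V X l = 0"
    and orth_mid: "\<And>l. 1 \<le> l \<Longrightarrow> l < L \<Longrightarrow>
      tp (lam l *\<^sub>R (X l * tp (V l)) - lam (Suc l) *\<^sub>R (tp (V (Suc l)) * X (Suc l)))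
        = lam l *\<^sub>R (X l * tp (V l)) - lam (Suc l) *\<^sub>R (tp (V (Suc l)) * X (Suc l))"
    and orth_end: "\<And>a x a' w. is_col a \<Longrightarrow> is_col x \<Longrightarrow> is_col a' \<Longrightarrow> is_col w \<Longrightarrow>
      proj (d 0) * a = a \<Longrightarrow> proj (d 0) * x = x \<Longrightarrow> proj (d L) * a' = a' \<Longrightarrow> proj (d L) * w = w \<Longrightarrow>
      ip a x = 0 \<Longrightarrow> ip a' w = 0 \<Longrightarrow> ip a a * ip x x = ip a' a' * ip w w \<Longrightarrow>
      (a' * tp w - w * tp a') * Y = Y * (a * tp x - x * tp a) \<Longrightarrow>
      lam L * (ip a' (X L * (tp (V L) * w)) - ip w (X L * (tp (V L) * a')))
        = lam 1 * (ip a (tp (V 1) * (X 1 * x)) - ip x (tp (V 1) * (X 1 * a)))"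
    and nondeg2: "\<And>u. L = 2 \<Longrightarrow> Y * (tp Y * u) = lprod lam 0 L *\<^sub>R u \<Longrightarrow> u = 0"
    and nondeg3: "\<And>a (s :: real). 3 \<le> L \<Longrightarrow> is_col a \<Longrightarrow> s > 0 \<Longrightarrow>
      tp Y * (Y * a) = (s ^ L / lprod lam 0 L * (1 + lprod lam 0 L / s ^ (L - 1))\<^sup>2) *\<^sub>R a \<Longrightarrow>
      lprod lam 0 L + L * s ^ (L - 1) = lprod lam 0 L * (real L - 1) \<Longrightarrow> a = 0"
begin

abbreviation "\<Lambda> \<equiv> lprod lam 0 L"

lemma lprod_pos: "k \<le> l \<Longrightarrow> l \<le> L \<Longrightarrow> lprod lam k l > 0"
  unfolding lprod_def by (intro prod_pos) (use lam_pos in auto)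

lemma balance:
  assumes "1 \<le> l" "l < L"
  shows "tp (V (Suc l)) * V (Suc l) = (lam l / lam (Suc l)) *\<^sub>R (V l * tp (V l))"
  by (rule scaleR_solve)
    (use hgrad_balance[OF assms, of V lam Y] crit[of l] crit[of "Suc l"] assms lam_pos[of "Suc l"] in auto)

text \<open>The linearised balance equates the symmetric parts of \<open>?P\<close> and
  \<open>?Q\<close>, and \<open>orth_mid\<close> equates their antisymmetric parts.\<close>

lemma linear_balance:
  assumes "1 \<le> l" "l < L"
  shows "tp (V (Suc l)) * X (Suc l) = (lam l / lam (Suc l)) *\<^sub>R (X l * tp (V l))"
proof (rule scaleR_solve)
  let ?P = "lam l *\<^sub>R (X l * tp (V l))" and ?Q = "lam (Suc l) *\<^sub>R (tp (V (Suc l)) * X (Suc l))"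
  have "tp ?Q + ?Q - (?P + tp ?P) = 0"
    using dhgrad_balance[OF assms, of X lam Y V] crit[of l] crit[of "Suc l"] lin[of l] lin[of "Suc l"] assms
    by (simp add: scaleR_right_distrib)
  moreover have "tp ?P - tp ?Q = ?P - ?Q"
    using orth_mid[OF assms] by simp
  ultimately show "?Q = ?P" by (rule eq_if_sym_and_antisym_eq)
  show "lam (Suc l) \<noteq> 0" using assms lam_pos[of "Suc l"] by auto
qed

lemma linear_balance_tp:
  assumes "1 \<le> l" "l < L"
  shows "tp (X (Suc l)) * V (Suc l) = (lam l / lam (Suc l)) *\<^sub>R (V l * tp (X l))"
proof -
  have "tp (tp (V (Suc l)) * X (Suc l)) = tp ((lam l / lam (Suc l)) *\<^sub>R (X l * tp (V l)))"
    using linear_balance[OF assms] by simp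
  then show ?thesis by simp
qed

text \<open>Balance makes the Gram matrices of \<open>tp (V l)\<close> and \<open>V (Suc l)\<close>
  proportional, so the two have the same kernel; \<open>ker_down\<close> is the other
  inclusion.\<close>

lemma ker_up:
  assumes "1 \<le> l" "l < L" "tp (V l) * z = 0"
  shows "V (Suc l) * z = 0"
proof (rule tp_mult_self_eq_0)
  have "tp (V (Suc l)) * V (Suc l) * z = 0"
    unfolding balance[OF assms(1,2)] by (simp add: mult.assoc assms(3))
  then show "tp (V (Suc l) * z) * (V (Suc l) * z) = 0"
    by (simp add: mult.assoc)
qed

lemma ker_down:
  assumes "1 \<le> l" "l < L" "V (Suc l) * z = 0"
  shows "tp (V l) * z = 0"
proof (rule tp_mult_self_eq_0)
  have "(lam l / lam (Suc l)) *\<^sub>R (V l * tp (V l) * z) = 0"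
    using arg_cong[OF balance[OF assms(1,2)], of "\<lambda>M. M * z"] assms(3) by (simp add: mult.assoc)
  then have "V l * tp (V l) * z = 0"
    using lam_pos[of l] lam_pos[of "Suc l"] assms by simp
  then show "tp (tp (V l) * z) * (tp (V l) * z) = 0"
    by (simp add: mult.assoc)
qed

lemma X_kernel:
  assumes l: "1 \<le> l" "l < L" and z: "tp (V l) * z = 0"
  shows "tp (X l) * z = 0 \<and> X (Suc l) * z = 0"
proof -
  define u where "u = X (Suc l) * z"
  define v where "v = tp (X l) * z"
  have Vz: "V (Suc l) * z = 0" by (rule ker_up[OF l z])
  have lam: "lam l > 0" "lam (Suc l) > 0" using l lam_pos by auto
  obtain j where j: "l = Suc j" using l by (cases l) auto
  have u: "tp (V (Suc l)) * u = 0"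
    using arg_cong[OF linear_balance[OF l], of "\<lambda>M. M * z"] z by (simp add: u_def mult.assoc)
  have "(lam l / lam (Suc l)) *\<^sub>R (V l * v) = 0"
    using arg_cong[OF linear_balance_tp[OF l], of "\<lambda>M. M * z"] Vz by (simp add: v_def mult.assoc)
  then have v: "V l * v = 0" using lam by simp
  have "tp (dhgrad lam Y L V X l) * z = 0" using lin l by simp
  moreover have "pr V L l * z = 0" using l by (simp add: pr_low mult.assoc Vz)
  moreover have "dpr V X L l * z = pr V L (Suc l) * u"
    using l by (simp add: dpr_low distrib_right mult.assoc Vz u_def)
  ultimately have veq: "lam l *\<^sub>R v = - (pr V (l - 1) 0 * (tp (pr V L 0 - Y) * (pr V L (Suc l) * u)))"
    by (simp add: dhgrad_def distrib_right mult.assoc v_def eq_neg_iff_add_eq_0 add.commute)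
  have "dhgrad lam Y L V X (Suc l) * z = 0" using lin l by simp
  moreover have "tp (pr V l 0) * z = 0" by (simp add: j mult.assoc) (use z j in simp)
  moreover have "tp (dpr V X l 0) * z = tp (pr V (l - 1) 0) * v"
    using z by (simp add: j distrib_right mult.assoc v_def)
  ultimately have ueq: "lam (Suc l) *\<^sub>R u = - (tp (pr V L (Suc l)) * ((pr V L 0 - Y) * (tp (pr V (l - 1) 0) * v)))"
    by (simp add: dhgrad_def distrib_right mult.assoc u_def eq_neg_iff_add_eq_0 add.commute)
  have u0: "u = 0" if "v = 0" using ueq lam that by simp
  have v0: "v = 0" if "u = 0" using veq lam that by simp
  \<comment> \<open>If a layer follows l+1 it kills u, and if one precedes l it kills v. Only
    two-layer networks have neither.\<close>
  consider "Suc l < L" | "l \<ge> 2" | "L = 2" "l = 1" using l by linarith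
  then have "u = 0 \<and> v = 0"
  proof cases
    case 1
    have "V (Suc (Suc l)) * u = 0" using ker_up[OF _ 1 u] by simp
    then have "pr V L (Suc l) * u = 0" using 1 by (simp add: pr_low[of "Suc l"] mult.assoc)
    then have "v = 0" using veq lam by simp
    then show ?thesis using u0 by simp
  next
    case 2
    then have j1: "1 \<le> j" "j < L" using j l by auto
    obtain i where i: "j = Suc i" using j1 by (cases j) auto
    have "tp (V j) * v = 0" using ker_down[OF j1] v j by simp
    then have "tp (pr V (l - 1) 0) * v = 0" by (simp add: j i mult.assoc)
    then have "u = 0" using ueq lam by simp
    then show ?thesis using v0 by simp
  next
    case 3
    have L: "L = Suc (Suc 0)" using 3 by simp
    have pL: "pr V L 0 = V (Suc (Suc 0)) * V (Suc 0)" by (simp add: L)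
    have "tp (pr V L 0) * u = 0" using u by (simp add: pL 3(2) mult.assoc)
    then have 1: "lam l *\<^sub>R v = tp Y * u" using veq by (simp add: 3(2) L left_diff_distrib)
    have "pr V L 0 * v = 0" using v by (simp add: pL 3(2) mult.assoc)
    then have 2: "lam (Suc l) *\<^sub>R u = Y * v" using ueq by (simp add: 3(2) L left_diff_distrib)
    \<comment> \<open>With two layers, u and v may feed each other through Y alone. Then u is an
      eigenvector of Y Y^T with eigenvalue \<Lambda>, which (A2) excludes for L = 2.\<close>
    have "Y * (tp Y * u) = Y * (lam l *\<^sub>R v)" by (simp add: 1)
    also have "\<dots> = lam l *\<^sub>R (lam (Suc l) *\<^sub>R u)" by (simp add: 2)
    also have "\<dots> = \<Lambda> *\<^sub>R u" by (simp add: L 3(2) lprod_Suc mult.commute)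
    finally have "u = 0" using nondeg2 L by simp
    then show ?thesis using v0 by simp
  qed
  then show ?thesis by (simp add: u_def v_def)
qed

section \<open>Eigencolumns of the first layer followed through all layers\<close>

definition eig :: "rmat \<Rightarrow> real \<Rightarrow> bool" where
  "eig a s \<longleftrightarrow> is_col a \<and> s > 0 \<and> lam 1 *\<^sub>R (tp (V 1) * (V 1 * a)) = s *\<^sub>R a"

lemma eig_col: "eig a s \<Longrightarrow> is_col (M * a)" "eig a s \<Longrightarrow> is_col a"
  by (auto simp: eig_def is_col_mult)

lemma eig_supp: "eig a s \<Longrightarrow> proj (d 0) * a = a"
proof -
  assume a: "eig a s"
  have "proj (d 0) * tp (V 1) = tp (V 1)"
    using V_right[of 1] L2 by (metis One_nat_def diff_Suc_1 le_refl le_trans one_le_numeral tp_proj tp_times)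
  then have "proj (d 0) * (tp (V 1) * (V 1 * a)) = tp (V 1) * (V 1 * a)"
    by (simp flip: mult.assoc)
  then have "proj (d 0) * (s *\<^sub>R a) = s *\<^sub>R a"
    using a unfolding eig_def by (metis mult_scaleR_right)
  then show ?thesis using a by (simp add: eig_def)
qed

text \<open>Balance carries eigencolumns upwards: \<open>pr V l 0 * a\<close> is an eigencolumn of
  the Gram matrix of layer l+1. The factor \<open>lam 1\<close> in \<open>eig\<close> makes the
  parameter s the same in every layer.\<close>

lemma eig_step:
  assumes "eig a s" "l < L"
  shows "tp (V (Suc l)) * (pr V (Suc l) 0 * a) = (s / lam (Suc l)) *\<^sub>R (pr V l 0 * a)"
  using assms(2)
proof (induction l)
  case 0
  have "tp (V 1) * (V 1 * a) = (s / lam 1) *\<^sub>R a"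
    by (rule scaleR_solve) (use assms lam_pos[of 1] L2 in \<open>auto simp: eig_def\<close>)
  then show ?case by simp
next
  case (Suc l)
  have "tp (V (Suc (Suc l))) * (pr V (Suc (Suc l)) 0 * a)
      = tp (V (Suc (Suc l))) * V (Suc (Suc l)) * (pr V (Suc l) 0 * a)"
    by (simp add: mult.assoc)
  also have "\<dots> = (lam (Suc l) / lam (Suc (Suc l))) *\<^sub>R (V (Suc l) * (tp (V (Suc l)) * (pr V (Suc l) 0 * a)))"
    using Suc.prems by (subst balance) (auto simp: mult.assoc)
  also have "\<dots> = (s / lam (Suc (Suc l))) *\<^sub>R (pr V (Suc l) 0 * a)"
    using Suc lam_pos[of "Suc l"] by (simp add: mult.assoc)
  finally show ?case .
qed

lemma eig_pr:
  assumes "eig a s" "k \<le> l" "l \<le> L"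
  shows "tp (pr V l k) * (pr V l 0 * a) = (s ^ (l - k) / lprod lam k l) *\<^sub>R (pr V k 0 * a)"
  using assms(2,3)
proof (induction l)
  case (Suc l)
  show ?case
  proof (cases "k = Suc l")
    case False
    then have k: "k \<le> l" using Suc.prems by simp
    have "tp (pr V (Suc l) k) * (pr V (Suc l) 0 * a)
        = tp (pr V l k) * (tp (V (Suc l)) * (pr V (Suc l) 0 * a))"
      using k by (simp add: mult.assoc)
    also have "\<dots> = (s / lam (Suc l)) *\<^sub>R (tp (pr V l k) * (pr V l 0 * a))"
      using Suc.prems by (subst eig_step[OF assms(1)]) auto
    also have "\<dots> = (s ^ (Suc l - k) / lprod lam k (Suc l)) *\<^sub>R (pr V k 0 * a)"
      using Suc k by (simp add: Suc_diff_le lprod_Suc)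
    finally show ?thesis .
  qed simp
qed simp

text \<open>The critical equation of the first layer, transposed and applied to
  \<open>V 1 * a\<close>.\<close>

lemma eig_residual_left:
  assumes "eig a s"
  shows "tp (pr V L 0 - Y) * (pr V L 0 * a) = - (s *\<^sub>R a)"
proof -
  have "tp (hgrad lam Y L V 1) * (V 1 * a) = 0" using crit[of 1] L2 by simp
  moreover have "pr V L 0 = pr V L 1 * V 1" using L2 by (simp add: pr_low)
  ultimately show ?thesis
    using assms by (simp add: hgrad_def distrib_right mult.assoc eig_def eq_neg_iff_add_eq_0)
qed

text \<open>The critical equation of the last layer, applied to \<open>pr V (L - 1) 0 * a\<close>;
  \<open>eig_pr\<close> evaluates the lower product times its transpose there.\<close>

lemma eig_residual_right:
  assumes a: "eig a s"
  shows "(pr V L 0 - Y) * a = - ((\<Lambda> / s ^ (L - 1)) *\<^sub>R (pr V L 0 * a))"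
proof -
  obtain K where L: "L = Suc K" using L2 by (cases L) auto
  let ?R = "pr V L 0 - Y"
  have "hgrad lam Y L V L * (pr V K 0 * a) = 0" using crit[of L] L2 by simp
  then have "?R * (tp (pr V K 0) * (pr V K 0 * a)) + lam L *\<^sub>R (V L * (pr V K 0 * a)) = 0"
    by (simp add: hgrad_def distrib_right mult.assoc L)
  then have "(s ^ K / lprod lam 0 K) *\<^sub>R (?R * a) = - (lam L *\<^sub>R (pr V L 0 * a))"
    using eig_pr[OF a, of 0 K] by (simp add: L mult.assoc eq_neg_iff_add_eq_0)
  then have "(s ^ K / lprod lam 0 K) *\<^sub>R (?R * a) = (- lam L) *\<^sub>R (pr V L 0 * a)"
    by simp
  then have "?R * a = (- lam L / (s ^ K / lprod lam 0 K)) *\<^sub>R (pr V L 0 * a)"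
    using a lprod_pos[of 0 K] L by (intro scaleR_solve) (auto simp: eig_def)
  then show ?thesis by (simp add: L lprod_Suc)
qed

text \<open>With P the full product at V, Y a = mu P a and Y^T P a = nu a. So a is a right singular
  vector of Y whose squared singular value is mu nu = s^L mu^2 / \<Lambda>.\<close>

definition mu :: "real \<Rightarrow> real" where "mu s = 1 + \<Lambda> / s ^ (L - 1)"
definition nu :: "real \<Rightarrow> real" where "nu s = s ^ L / \<Lambda> * mu s"

lemma mu_pos: "s > 0 \<Longrightarrow> mu s > 0"
  using lprod_pos[of 0 L] by (simp add: mu_def add_pos_pos)

lemma s_pow_L: "s ^ L = s * (s :: real) ^ (L - 1)"
  using L2 by (simp flip: power_Suc)

lemma nu_alt: "s > 0 \<Longrightarrow> nu s = s + s ^ L / \<Lambda>"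
  using lprod_pos[of 0 L] by (simp add: nu_def mu_def field_simps s_pow_L)

lemma eig_Y: "eig a s \<Longrightarrow> Y * a = mu s *\<^sub>R (pr V L 0 * a)"
  using eig_residual_right[of a s] by (simp add: mu_def left_diff_distrib algebra_simps)

lemma eig_tp_Y: "eig a s \<Longrightarrow> tp Y * (pr V L 0 * a) = nu s *\<^sub>R a"
  using eig_residual_left[of a s] eig_pr[of a s 0 L]
  by (simp add: nu_alt eig_def left_diff_distrib algebra_simps)

section \<open>The Hessian equations between two eigencolumns\<close>

lemma X_step:
  assumes a: "eig a s" and l: "1 \<le> l" "l < L"
  shows "tp (V (Suc l)) * (X (Suc l) * (pr V l 0 * a))
    = (s / lam (Suc l)) *\<^sub>R (X l * (pr V (l - 1) 0 * a))"
proof -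
  obtain j where j: "l = Suc j" using l by (cases l) auto
  have "tp (V (Suc l)) * (X (Suc l) * (pr V l 0 * a))
     = (lam l / lam (Suc l)) *\<^sub>R (X l * (tp (V l) * (pr V l 0 * a)))"
    using arg_cong[OF linear_balance[OF l], of "\<lambda>M. M * (pr V l 0 * a)"] by (simp add: mult.assoc)
  also have "\<dots> = (s / lam (Suc l)) *\<^sub>R (X l * (pr V (l - 1) 0 * a))"
    using eig_step[OF a, of j] l lam_pos[of l] by (simp add: j)
  finally show ?thesis .
qed

text \<open>By \<open>linear_balance\<close> the pairing in one layer determines the pairing in the
  next, so everything reduces to the scalar of the first layer.\<close>

lemma ip_X:
  assumes a: "eig a s" and b: "eig b t" and l: "1 \<le> l" "l \<le> L"
  shows "ip (pr V l 0 * b) (X l * (pr V (l - 1) 0 * a))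
    = s ^ (l - 1) / lprod lam 1 l * ip (V 1 * b) (X 1 * a)"
  using l
proof (induction l rule: dec_induct)
  case base
  then show ?case by simp
next
  case (step l)
  have "ip (pr V (Suc l) 0 * b) (X (Suc l) * (pr V l 0 * a))
      = ip (pr V l 0 * b) (tp (V (Suc l)) * (X (Suc l) * (pr V l 0 * a)))"
    by (simp add: mult.assoc ip_left)
  also have "\<dots> = s / lam (Suc l) * ip (pr V l 0 * b) (X l * (pr V (l - 1) 0 * a))"
    using step by (subst X_step[OF a]) auto
  also have "\<dots> = s ^ l / lprod lam 1 (Suc l) * ip (V 1 * b) (X 1 * a)"
    using step by (cases l) (auto simp: lprod_Suc)
  finally show ?case by simp
qed

text \<open>Varying one factor leaves powers of s from the layers below it and powers of t from
  those above it. Summing over the varied layer gives \<open>geo\<close>.\<close>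

lemma ip_dpr:
  assumes a: "eig a s" and b: "eig b t" and l: "l \<le> L"
  shows "ip (pr V l 0 * b) (dpr V X l 0 * a) = geo s t l / lprod lam 1 l * ip (V 1 * b) (X 1 * a)"
  using l
proof (induction l)
  case (Suc l)
  have l1: "lprod lam (Suc 0) (Suc l) = (if l = 0 then 1 else lam (Suc l) * lprod lam (Suc 0) l)"
    by (simp add: lprod_Suc)
  have pos: "lam (Suc l) > 0" using lam_pos Suc.prems by auto
  have pos2: "lprod lam (Suc 0) l > 0"
    by (cases l) (use lprod_pos[of 1 l] Suc.prems in \<open>auto simp: lprod_def\<close>)
  have "ip (pr V (Suc l) 0 * b) (dpr V X (Suc l) 0 * a)
     = ip (pr V (Suc l) 0 * b) (X (Suc l) * (pr V l 0 * a))
       + ip (tp (V (Suc l)) * (pr V (Suc l) 0 * b)) (dpr V X l 0 * a)"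
    by (simp add: distrib_right mult.assoc ip_left)
  also have "\<dots> = s ^ l / lprod lam 1 (Suc l) * ip (V 1 * b) (X 1 * a)
      + t / lam (Suc l) * (geo s t l / lprod lam 1 l * ip (V 1 * b) (X 1 * a))"
    using ip_X[OF a b, of "Suc l"] eig_step[OF b, of l] Suc by simp
  also have "\<dots> = geo s t (Suc l) / lprod lam 1 (Suc l) * ip (V 1 * b) (X 1 * a)"
    using pos pos2 by (auto simp: geo_Suc l1 field_simps)
  finally show ?case .
qed simp

lemma Lambda_low: "\<Lambda> = lam 1 * lprod lam 1 L"
  using L2 lprod_low[of 0 L lam] by simp

text \<open>The Hessian equation of the first layer, tested with \<open>V 1 * b\<close> on the left
  and a on the right. Exchanging the pairs (a,s) and (b,t) gives the second equation of a 2 by 2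
  system for x and x'.\<close>

lemma eig_pair_eq:
  assumes a: "eig a s" and b: "eig b t"
  shows "(\<Lambda> + geo s t L) * ip (V 1 * b) (X 1 * a)
    = \<Lambda> * (geo s t L / s ^ (L - 1) - 1) * ip (V 1 * a) (X 1 * b)"
proof -
  define x where "x = ip (V 1 * b) (X 1 * a)"
  define x' where "x' = ip (V 1 * a) (X 1 * b)"
  define m where "m = lprod lam 1 L"
  define p where "p = s ^ (L - 1)"
  define S where "S = geo s t L"
  have m: "m > 0" using lprod_pos[of 1 L] L2 by (simp add: m_def)
  have p: "p > 0" using a by (simp add: p_def eig_def)
  have D: "dpr V X L (Suc 0) * (V (Suc 0) * b) = dpr V X L 0 * b - pr V L (Suc 0) * (X (Suc 0) * b)"
    using L2 by (simp add: dpr_low[of 0] algebra_simps)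
  have P: "pr V L (Suc 0) * (V (Suc 0) * b) = pr V L 0 * b"
    using L2 by (simp add: pr_low[of 0] algebra_simps)
  have "ip (pr V L 0 * a) (pr V L 1 * (X 1 * b)) = p / m * x'"
    using eig_pr[OF a, of 1 L] L2 by (simp add: ip_right m_def p_def x'_def)
  then have 1: "ip (pr V L 0 * a) (dpr V X L 1 * (V 1 * b)) = (S - p) / m * x'"
    using ip_dpr[OF b a, of L] geo_commute[of s t L]
    by (simp add: D S_def m_def x'_def diff_divide_distrib left_diff_distrib)
  have "ip (V 1 * b) (dhgrad lam Y L V X 1 * a) = 0" using lin[of 1] L2 by simp
  then have "ip (dpr V X L 1 * (V 1 * b)) ((pr V L 0 - Y) * a) + ip (pr V L 1 * (V 1 * b)) (dpr V X L 0 * a)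
      + lam 1 * x = 0"
    by (simp add: dhgrad_def distrib_right mult.assoc x_def ip_right)
  then have "- (\<Lambda> / p * ((S - p) / m * x')) + S / m * x + lam 1 * x = 0"
    using 1 ip_dpr[OF a b, of L]
    by (simp add: P eig_residual_right[OF a] ip_commute[of _ "pr V L 0 * a"] S_def m_def x_def p_def mult.commute)
  note E = this
  have "- (\<Lambda> / p * ((S - p) * x')) + S * x + m * lam 1 * x
      = m * (- (\<Lambda> / p * ((S - p) / m * x')) + S / m * x + lam 1 * x)"
    using m p by (simp add: field_simps)
  also have "\<dots> = 0" by (simp only: E mult_zero_right)
  finally have "(\<Lambda> + S) * x = \<Lambda> * (S / p - 1) * x'"
    using p Lambda_low[folded m_def] by (simp add: algebra_simps diff_divide_distrib)
  then show ?thesis by (simp add: x_def x'_def S_def p_def)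
qed

lemma eig_scale: "eig a s \<Longrightarrow> ip (pr V L 0 * a) (pr V L 0 * b) = s ^ L / \<Lambda> * ip a b"
  using eig_pr[of a s 0 L] by (simp add: ip_right)

lemma eig_ip_eq_0:
  assumes a: "eig a s" and b: "eig b t" and "s \<noteq> t"
  shows "ip a b = 0"
proof -
  let ?B = "tp (V 1) * V 1"
  have "s * ip a b = lam 1 * ip (?B * a) b"
    using a by (simp add: eig_def mult.assoc flip: ip_simps(7))
  also have "ip (?B * a) b = ip a (?B * b)" by (subst ip_left) simp
  also have "lam 1 * ip a (?B * b) = t * ip a b"
    using b by (simp add: eig_def mult.assoc flip: ip_simps(8))
  finally show ?thesis using \<open>s \<noteq> t\<close> by simp
qed

lemma V_L_supp: "proj (d L) * (pr V L 0 * a) = pr V L 0 * a"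
proof -
  obtain K where "L = Suc K" using L2 by (cases L) auto
  then show ?thesis using V_left[of L] L2 by (simp flip: mult.assoc)
qed

lemma eig_step_L: "eig a s \<Longrightarrow> tp (V L) * (pr V L 0 * a) = (s / lam L) *\<^sub>R (pr V (L - 1) 0 * a)"
  using eig_step[of a s "L - 1"] L2 by simp

text \<open>If x is nonzero, the 2 by 2 system is singular. For s = t this says that s is the
  critical point of sigma, against (A2). For distinct s, t it says that both belong to the same
  singular value of Y; rotating a into b, with a matching rotation of the outputs, is then a
  symmetry of the problem, and orthogonality to it contradicts the sign in
  \<open>eig_pair_eq\<close>.\<close>

lemma eig_pair_eq_0:
  assumes a: "eig a s" and b: "eig b t"
  shows "ip (V 1 * b) (X 1 * a) = 0"
proof (rule ccontr)
  define x where "x = ip (V 1 * b) (X 1 * a)"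
  define x' where "x' = ip (V 1 * a) (X 1 * b)"
  define S where "S = geo s t L"
  define p where "p = s ^ (L - 1)"
  define q where "q = t ^ (L - 1)"
  \<comment> \<open>The output generator \<gamma> (P a) wedge (P b) intertwines with the input
    generator a wedge b if \<gamma> nu(t) = mu(s) and \<gamma> nu(s) = mu(t). The two conditions are
    compatible exactly when s and t have the same squared singular value mu nu.\<close>
  define \<gamma> where "\<gamma> = mu s / nu t"
  assume "ip (V 1 * b) (X 1 * a) \<noteq> 0"
  then have x: "x \<noteq> 0" by (simp add: x_def)
  have pos: "s > 0" "t > 0" "p > 0" "q > 0" "\<Lambda> > 0" "S > 0"
    using a b lprod_pos[of 0 L] geo_pos[of s t L] L2 by (auto simp: eig_def p_def q_def S_def)
  have e1: "(\<Lambda> + S) * x = \<Lambda> * (S / p - 1) * x'"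
    using eig_pair_eq[OF a b] by (simp add: x_def x'_def S_def p_def)
  have e2: "(\<Lambda> + S) * x' = \<Lambda> * (S / q - 1) * x"
    using eig_pair_eq[OF b a] geo_commute[of s t L] by (simp add: x_def x'_def S_def q_def)
  have "(\<Lambda> + S)\<^sup>2 * x = (\<Lambda> + S) * ((\<Lambda> + S) * x)" by (simp add: power2_eq_square)
  also have "\<dots> = \<Lambda> * (S / p - 1) * ((\<Lambda> + S) * x')" unfolding e1 by simp
  also have "\<dots> = \<Lambda>\<^sup>2 * ((S / p - 1) * (S / q - 1)) * x"
    unfolding e2 by (simp add: power2_eq_square)
  finally have det: "(\<Lambda> + S)\<^sup>2 = \<Lambda>\<^sup>2 * ((S / p - 1) * (S / q - 1))"
    using x by simp
  have mu_pq: "mu s = 1 + \<Lambda> / p" "mu t = 1 + \<Lambda> / q" by (simp_all add: mu_def p_def q_def)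
  have a0: "a \<noteq> 0" using x by (auto simp: x_def)
  show False
  proof (cases "s = t")
    case True
    then have "S = L * p" "p = q" by (auto simp: S_def geo_same p_def q_def)
    then have "(\<Lambda> + L * p)\<^sup>2 = (\<Lambda> * (real L - 1))\<^sup>2"
      using det pos by (simp add: power_mult_distrib power2_eq_square)
    \<comment> \<open>That is, L s^(L-1) = (L - 2) \<Lambda>: impossible for L = 2, and the case
      handled by \<open>nondeg3\<close> for L >= 3.\<close>
    then have eq: "\<Lambda> + L * p = \<Lambda> * (real L - 1)"
      by (rule power2_eq_imp_eq) (use pos L2 in auto)
    have "L \<noteq> 2" using eq pos by auto
    then have L3: "3 \<le> L" using L2 by simp
    have "tp Y * (Y * a) = (s ^ L / \<Lambda> * (1 + \<Lambda> / s ^ (L - 1))\<^sup>2) *\<^sub>R a"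
      unfolding eig_Y[OF a] by (simp add: eig_tp_Y[OF a] nu_def mu_def power2_eq_square)
    then have "a = 0"
      using nondeg3[OF L3 eig_col(2)[OF a] pos(1)] eq by (simp add: p_def)
    with a0 show False by simp
  next
    case False
    \<comment> \<open>Multiplying the singularity condition by s - t turns the geometric sum S into
      a difference of powers. What remains is the equality of the squared singular values, up to the
      common factor 1/\<Lambda>.\<close>
    have eqy: "s ^ L * (mu s)\<^sup>2 = t ^ L * (mu t)\<^sup>2"
    proof -
      have sp: "s ^ L = s * p" "t ^ L = t * q" by (auto simp: p_def q_def s_pow_L)
      have S: "(s - t) * S = s * p - t * q" unfolding S_def geo_diff sp ..
      have "(\<Lambda> + S)\<^sup>2 * (p * q) = \<Lambda>\<^sup>2 * ((S - p) * (S - q))"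
      proof -
        have "(S / p - 1) * p = S - p" "(S / q - 1) * q = S - q" using pos by (simp_all add: field_simps)
        then show ?thesis unfolding det by (metis (no_types, opaque_lifting) mult.assoc mult.commute)
      qed
      then have "S * (2 * \<Lambda> * p * q + S * p * q + \<Lambda>\<^sup>2 * (p + q - S)) = 0"
        by (simp add: power2_eq_square algebra_simps)
      then have "2 * \<Lambda> * p * q + S * p * q + \<Lambda>\<^sup>2 * (p + q - S) = 0"
        using pos by simp
      then have "(s - t) * (2 * \<Lambda> * p * q + S * p * q + \<Lambda>\<^sup>2 * (p + q - S)) = 0" by simp
      then have "(s - t) * 2 * \<Lambda> * p * q + ((s - t) * S) * p * q
          + \<Lambda>\<^sup>2 * ((s - t) * (p + q) - (s - t) * S) = 0"
        by (simp add: algebra_simps)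
      then have "s * (p + \<Lambda>)\<^sup>2 * q = t * (q + \<Lambda>)\<^sup>2 * p"
        unfolding S by (simp add: power2_eq_square algebra_simps)
      moreover have "s * p * (1 + \<Lambda> / p)\<^sup>2 = s * (p + \<Lambda>)\<^sup>2 / p" "t * q * (1 + \<Lambda> / q)\<^sup>2 = t * (q + \<Lambda>)\<^sup>2 / q"
        using pos by (simp_all add: field_simps power2_eq_square)
      ultimately show ?thesis using pos
        unfolding sp mu_pq by (simp add: frac_eq_eq)
    qed
    have mpos: "mu s > 0" "mu t > 0" "s ^ L > 0" "t ^ L > 0" using pos mu_pos by auto
    have npos: "nu s > 0" "nu t > 0" using mpos pos by (auto simp: nu_def)
    have g1: "\<gamma> * nu t = mu s" using npos by (simp add: \<gamma>_def)
    have "\<gamma> * nu s * (t ^ L * mu t) = s ^ L * (mu s)\<^sup>2"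
      using mpos pos by (simp add: \<gamma>_def nu_def power2_eq_square field_simps)
    then have "\<gamma> * nu s * (t ^ L * mu t) = mu t * (t ^ L * mu t)"
      unfolding eqy by (simp add: power2_eq_square)
    moreover have "t ^ L * mu t \<noteq> 0" using mpos(2,4) by (metis less_irrefl mult_pos_pos)
    ultimately have g2: "\<gamma> * nu s = mu t" using mult_right_cancel by blast
    have ab: "ip a b = 0" by (rule eig_ip_eq_0[OF a b False])
    have gg: "\<gamma>\<^sup>2 * (s ^ L / \<Lambda>) * (t ^ L / \<Lambda>) = 1"
    proof -
      have "(\<gamma> * nu t) * (\<gamma> * nu s) = mu s * mu t" by (simp add: g1 g2)
      then show ?thesis using mpos pos by (simp add: nu_def power2_eq_square field_simps)
    qed
    have orth: "lam L * (ip (\<gamma> *\<^sub>R (pr V L 0 * a)) (X L * (tp (V L) * (pr V L 0 * b)))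
        - ip (pr V L 0 * b) (X L * (tp (V L) * (\<gamma> *\<^sub>R (pr V L 0 * a)))))
        = lam 1 * (ip a (tp (V 1) * (X 1 * b)) - ip b (tp (V 1) * (X 1 * a)))"
    proof (rule orth_end)
      show "ip (\<gamma> *\<^sub>R (pr V L 0 * a)) (pr V L 0 * b) = 0"
        using ab by (simp add: eig_scale[OF a])
      have "ip (\<gamma> *\<^sub>R (pr V L 0 * a)) (\<gamma> *\<^sub>R (pr V L 0 * a)) * ip (pr V L 0 * b) (pr V L 0 * b)
         = (\<gamma>\<^sup>2 * (s ^ L / \<Lambda>) * (t ^ L / \<Lambda>)) * (ip a a * ip b b)"
        by (simp add: eig_scale[OF a] eig_scale[OF b] power2_eq_square)
      then show "ip a a * ip b b = ip (\<gamma> *\<^sub>R (pr V L 0 * a)) (\<gamma> *\<^sub>R (pr V L 0 * a)) * ip (pr V L 0 * b) (pr V L 0 * b)"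
        unfolding gg by simp
      let ?a = "pr V L 0 * a" and ?b = "pr V L 0 * b"
      have "(\<gamma> *\<^sub>R ?a * tp ?b - ?b * tp (\<gamma> *\<^sub>R ?a)) * Y
          = \<gamma> *\<^sub>R (?a * tp (tp Y * ?b)) - \<gamma> *\<^sub>R (?b * tp (tp Y * ?a))"
        by (simp add: left_diff_distrib mult.assoc)
      also have "\<dots> = mu s *\<^sub>R (?a * tp b) - mu t *\<^sub>R (?b * tp a)"
        unfolding eig_tp_Y[OF a] eig_tp_Y[OF b] by (simp add: g1 g2)
      also have "\<dots> = (Y * a) * tp b - (Y * b) * tp a"
        unfolding eig_Y[OF a] eig_Y[OF b] by simp
      also have "\<dots> = Y * (a * tp b - b * tp a)"
        by (simp add: right_diff_distrib mult.assoc)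
      finally show "(\<gamma> *\<^sub>R ?a * tp ?b - ?b * tp (\<gamma> *\<^sub>R ?a)) * Y = Y * (a * tp b - b * tp a)" .
    qed (use a b ab V_L_supp eig_supp in \<open>auto simp: is_col_scaleR eig_col\<close>)
    define m where "m = lprod lam 1 L"
    have m: "m > 0" using lprod_pos[of 1 L] L2 by (simp add: m_def)
    have lamL: "lam L > 0" using lam_pos L2 by simp
    have "lam L * (\<gamma> * (t / lam L * (t ^ (L - 1) / m * x')) - \<gamma> * (s / lam L * (s ^ (L - 1) / m * x)))
        = lam 1 * (x' - x)"
      using orth ip_X[OF b a, of L] ip_X[OF a b, of L] L2
      by (simp add: eig_step_L[OF a] eig_step_L[OF b] ip_right[of a] ip_right[of b] x_def x'_def m_def mult_ac)
    then have "\<gamma> * (t ^ L * x' - s ^ L * x) / m = lam 1 * (x' - x)"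
      using lamL m by (simp add: s_pow_L right_diff_distrib diff_divide_distrib)
    then have "\<gamma> * (t ^ L * x' - s ^ L * x) = \<Lambda> * (x' - x)"
      using m Lambda_low by (simp add: m_def field_simps)
    then have o: "(\<gamma> * t ^ L) * x' - (\<gamma> * s ^ L) * x = \<Lambda> * x' - \<Lambda> * x"
      by (simp add: algebra_simps)
    have "\<gamma> * t ^ L = \<Lambda> * mu s / mu t"
      using g1 mpos pos by (simp add: nu_def field_simps)
    moreover have "\<gamma> * s ^ L = \<Lambda> * mu t / mu s"
      using g2 mpos pos by (simp add: nu_def field_simps)
    ultimately have "\<Lambda> * mu s / mu t * x' - \<Lambda> * mu t / mu s * x = \<Lambda> * x' - \<Lambda> * x"
      using o by simp
    then have "\<Lambda> * (mu s / mu t * x' - mu t / mu s * x) = \<Lambda> * (x' - x)"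
      by (simp add: right_diff_distrib)
    then have "mu s / mu t * x' - mu t / mu s * x = x' - x" using pos by simp
    then have "(mu s - mu t) * (mu s * x' + mu t * x) = 0"
      using mpos by (simp add: field_simps)
    moreover have "mu s \<noteq> mu t"
    proof
      assume "mu s = mu t"
      then have "p = q" using pos by (simp add: mu_pq)
      then have "s = t" using pos L2 by (auto simp: p_def q_def power_eq_iff_eq_base)
      with False show False by simp
    qed
    ultimately have "mu s * x' = - (mu t * x)" by (simp add: add_eq_0_iff)
    then have xx: "x' = - (mu t / mu s * x)" using mpos by (simp add: field_simps)
    \<comment> \<open>By \<open>xx\<close>, x and x' have opposite signs. As S > p, both
      coefficients in \<open>e1\<close> are positive, so x and x' would have to agree in
      sign.\<close>
    have "S > p" using geo_gt[of s t L] pos L2 by (simp add: S_def p_def)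
    then have c: "\<Lambda> * (S / p - 1) * (mu t / mu s) > 0" using pos mpos by simp
    have "(\<Lambda> + S + \<Lambda> * (S / p - 1) * (mu t / mu s)) * x = 0"
      using e1 unfolding xx by (simp add: algebra_simps)
    moreover have "\<Lambda> + S + \<Lambda> * (S / p - 1) * (mu t / mu s) > 0" using c pos by linarith
    ultimately show False using x by simp
  qed
qed

text \<open>The eigencolumns with positive parameter exhaust everything that \<open>V 1\<close>
  sees. If c were orthogonal to them without \<open>V 1\<close> killing it,
  \<open>symmetric_eigencolumn_exists\<close> applied to the Gram matrix would give an eigencolumn
  with nonzero, hence positive, eigenvalue that is not orthogonal to c.\<close>

lemma V1_eq_0_if_orth_eig:
  assumes "\<And>b t. eig b t \<Longrightarrow> tp b * c = 0"
  shows "V 1 * c = 0"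
proof (rule rmat_col_eqI)
  fix e assume e: "is_col e"
  define B where "B = lam 1 *\<^sub>R (tp (V 1) * V 1)"
  define w where "w = c * e"
  have l1: "lam 1 > 0" using lam_pos L2 by simp
  have w: "is_col w" "\<And>b t. eig b t \<Longrightarrow> ip b w = 0"
    using assms e by (auto simp: w_def is_col_mult ip_def simp flip: mult.assoc)
  have BV: "B * b = lam 1 *\<^sub>R (tp (V 1) * (V 1 * b))" for b by (simp add: B_def mult.assoc)
  have sym: "tp B = B" by (simp add: B_def)
  have "B * w = 0"
  proof (rule ccontr)
    assume nz: "B * w \<noteq> 0"
    have "proj (d 0) * tp (V 1) = tp (V 1)"
      using V_right[of 1] L2 by (metis One_nat_def diff_Suc_1 le_refl le_trans one_le_numeral tp_proj tp_times)
    then have pB: "proj (d 0) * B = B" by (simp add: B_def flip: mult.assoc)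
    then have "proj (d 0) * (B * w) = B * w" by (metis mult.assoc)
    then obtain b t where b: "is_col b" "B * b = t *\<^sub>R b" "ip b (B * w) \<noteq> 0"
      using symmetric_eigencolumn_exists[OF sym pB is_col_mult[OF w(1)]] nz by blast
    have "ip b (B * w) = ip (B * b) w" by (subst ip_right) (simp add: sym)
    also have "\<dots> = t * ip b w" by (simp add: b(2))
    finally have t: "t \<noteq> 0" "ip b w \<noteq> 0" using b(3) by auto
    have "t * ip b b = ip b (B * b)" by (simp add: b(2))
    also have "\<dots> = lam 1 * ip (V 1 * b) (V 1 * b)" by (simp add: BV ip_left)
    also have "\<dots> \<ge> 0" using ip_ge_0 l1 by simp
    finally have "t * ip b b \<ge> 0" .
    moreover have "ip b b > 0" using t(2) col_ip_eq_0[OF b(1)] ip_ge_0[of b] by (metis ip_simps(9) less_eq_real_def)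
    ultimately have "t > 0" using t(1) by (simp add: zero_le_mult_iff)
    then have "eig b t" using b by (simp add: eig_def BV)
    then show False using w(2) t(2) by blast
  qed
  then have "tp (V 1) * (V 1 * w) = 0" using l1 by (simp add: BV)
  then have "tp (V 1 * w) * (V 1 * w) = 0" by (metis mult.assoc mult_zero_right tp_times)
  then have "V 1 * w = 0" by (rule tp_mult_self_eq_0)
  then show "V 1 * c * e = 0 * e" by (simp add: w_def mult.assoc)
qed

end

lemma tp_mult_col_eq_0: "is_col b \<Longrightarrow> is_col c \<Longrightarrow> ip b c = 0 \<Longrightarrow> tp b * c = 0"
proof (rule rmat_eqI)
  fix i j assume *: "is_col b" "is_col c" "ip b c = 0"
  show "ent (tp b * c) i j = ent 0 i j"
  proof (cases "i = 0 \<and> j = 0")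
    case False
    then show ?thesis using * by (auto simp: times_rmat.rep_eq is_col_def)
  qed (use * in \<open>simp add: ip_def\<close>)
qed

section \<open>Components of the direction that leave the span of the eigencolumns\<close>

context kernel_direction
begin

text \<open>The vanishing pairings put \<open>X 1 * a\<close> into the kernel of
  \<open>tp (V 1)\<close>. \<open>X_kernel\<close> says that \<open>tp (X 1)\<close> kills this
  kernel, so \<open>X 1 * a\<close> has norm zero.\<close>

lemma X1_eig:
  assumes a: "eig a s"
  shows "X 1 * a = 0"
proof -
  have "V 1 * (tp (V 1) * (X 1 * a)) = 0"
  proof (rule V1_eq_0_if_orth_eig)
    fix b t assume b: "eig b t"
    show "tp b * (tp (V 1) * (X 1 * a)) = 0"
      by (rule tp_mult_col_eq_0) (use a b eig_pair_eq_0[OF a b] in \<open>auto simp: eig_col ip_right intro!: is_col_mult\<close>)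
  qed
  then have "tp (tp (V 1) * (X 1 * a)) * (tp (V 1) * (X 1 * a)) = 0" by (simp add: mult.assoc)
  then have "tp (V 1) * (X 1 * a) = 0" by (rule tp_mult_self_eq_0)
  then have "tp (X 1) * (X 1 * a) = 0" using X_kernel[of 1 "X 1 * a"] L2 by simp
  then have "tp (X 1 * a) * (X 1 * a) = 0" by (simp add: mult.assoc)
  then show ?thesis by (rule tp_mult_self_eq_0)
qed

lemma X_eig:
  assumes a: "eig a s" and l: "1 \<le> l" "l < L"
  shows "X l * (pr V (l - 1) 0 * a) = 0"
  using l
proof (induction l rule: dec_induct)
  case base
  then show ?case using X1_eig[OF a] by simp
next
  case (step l)
  let ?z = "X (Suc l) * (pr V l 0 * a)"
  have "tp (V (Suc l)) * ?z = 0"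
    using X_step[OF a, of l] step by simp
  then have "tp (X (Suc l)) * ?z = 0" using X_kernel[of "Suc l" ?z] step by simp
  then have "tp ?z * ?z = 0" by (simp add: mult.assoc)
  from tp_mult_self_eq_0[OF this] show ?case by simp
qed

lemma V_L_X_L_eig:
  assumes a: "eig a s"
  shows "tp (V L) * (X L * (pr V (L - 1) 0 * a)) = 0"
proof -
  obtain K where K: "L = Suc K" "1 \<le> K" using L2 by (cases L) auto
  then show ?thesis using X_step[OF a, of K] X_eig[OF a, of K] by simp
qed

lemma V1_X1_eig:
  assumes a: "eig a s"
  shows "V 1 * (tp (X 1) * (V 1 * a)) = 0"
proof (rule V1_eq_0_if_orth_eig)
  fix b t assume b: "eig b t"
  have "tp b * tp (X 1) = 0" using X1_eig[OF b] by (metis tp_times tp_zero)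
  then show "tp b * (tp (X 1) * (V 1 * a)) = 0" by (metis mult.assoc mult_zero_left)
qed

lemma tp_X_eig:
  assumes a: "eig a s" and l: "1 \<le> l" "l < L"
  shows "tp (X (Suc l)) * (pr V (Suc l) 0 * a) = 0"
  using l
proof (induction l rule: dec_induct)
  case base
  have "tp (X 2) * (V 2 * (V 1 * a)) = (lam 1 / lam 2) *\<^sub>R (V 1 * (tp (X 1) * (V 1 * a)))"
    using arg_cong[OF linear_balance_tp[of 1], of "\<lambda>M. M * (V 1 * a)"] L2
    by (simp add: mult.assoc numeral_2_eq_2)
  then show ?case using V1_X1_eig[OF a] by (simp add: mult.assoc numeral_2_eq_2)
next
  case (step l)
  have "tp (X (Suc (Suc l))) * (V (Suc (Suc l)) * (pr V (Suc l) 0 * a))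
     = (lam (Suc l) / lam (Suc (Suc l))) *\<^sub>R (V (Suc l) * (tp (X (Suc l)) * (pr V (Suc l) 0 * a)))"
    using arg_cong[OF linear_balance_tp[of "Suc l"], of "\<lambda>M. M * (pr V (Suc l) 0 * a)"] step
    by (simp add: mult.assoc)
  also have "\<dots> = 0" using step by simp
  finally show ?case by (simp add: mult.assoc)
qed

lemma dpr_eig:
  assumes a: "eig a s"
  shows "l < L \<Longrightarrow> dpr V X l 0 * a = 0"
proof (induction l)
  case (Suc l)
  then show ?case using X_eig[OF a, of "Suc l"] by (simp add: distrib_right mult.assoc)
qed simp

lemma dpr_L_eig:
  assumes a: "eig a s"
  shows "dpr V X L 0 * a = X L * (pr V (L - 1) 0 * a)"
proof -
  obtain K where K: "L = Suc K" using L2 by (cases L) auto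
  then show ?thesis using dpr_eig[OF a, of K] by (simp add: distrib_right mult.assoc)
qed

lemma tp_dpr_eig:
  assumes a: "eig a s" and l: "1 \<le> l" "l \<le> L"
  shows "tp (dpr V X l 0) * (pr V l 0 * a) = (s ^ (l - 1) / lprod lam 1 l) *\<^sub>R (tp (X 1) * (V 1 * a))"
  using l
proof (induction l rule: dec_induct)
  case base
  then show ?case by simp
next
  case (step l)
  have "tp (dpr V X (Suc l) 0) * (pr V (Suc l) 0 * a)
     = tp (pr V l 0) * (tp (X (Suc l)) * (pr V (Suc l) 0 * a))
      + tp (dpr V X l 0) * (tp (V (Suc l)) * (pr V (Suc l) 0 * a))"
    by (simp add: distrib_right mult.assoc)
  also have "\<dots> = (s / lam (Suc l)) *\<^sub>R (tp (dpr V X l 0) * (pr V l 0 * a))"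
    using tp_X_eig[OF a, of l] eig_step[OF a, of l] step by simp
  also have "\<dots> = (s ^ (Suc l - 1) / lprod lam 1 (Suc l)) *\<^sub>R (tp (X 1) * (V 1 * a))"
    using step by (cases l) (auto simp: lprod_Suc)
  finally show ?case .
qed

text \<open>The first-layer Hessian equation, transposed and applied to \<open>V 1 * a\<close>. As
  V_L^T w = 0, the residual acts on w through Y alone.\<close>

lemma left_eq:
  assumes a: "eig a s"
  defines "x \<equiv> tp (X 1) * (V 1 * a)" and "w \<equiv> X L * (pr V (L - 1) 0 * a)"
  shows "(\<Lambda> + s ^ (L - 1)) *\<^sub>R x = lprod lam 1 L *\<^sub>R (tp Y * w)"
proof -
  define m where "m = lprod lam 1 L"
  define p where "p = s ^ (L - 1)"
  obtain K where K: "L = Suc K" using L2 by (cases L) auto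
  have m: "m > 0" using lprod_pos[of 1 L] L2 by (simp add: m_def)
  have D: "dpr V X L (Suc 0) * (V (Suc 0) * a) = w"
    using dpr_low[of 0 L V X] L2 X1_eig[OF a] dpr_L_eig[OF a]
    by (simp add: w_def distrib_right mult.assoc)
  have P: "pr V L (Suc 0) * (V (Suc 0) * a) = pr V L 0 * a"
    using L2 by (simp add: pr_low[of 0] mult.assoc)
  have "tp (dhgrad lam Y L V X 1) * (V 1 * a) = 0" using lin[of 1] L2 by simp
  then have "tp (pr V L 0 - Y) * w + tp (dpr V X L 0) * (pr V L 0 * a) + lam 1 *\<^sub>R x = 0"
    by (simp add: dhgrad_def distrib_right mult.assoc x_def D P)
  moreover have "tp (pr V L 0) * w = 0"
    using V_L_X_L_eig[OF a] by (simp add: K w_def mult.assoc)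
  moreover have "tp (dpr V X L 0) * (pr V L 0 * a) = (p / m) *\<^sub>R x"
    using tp_dpr_eig[OF a, of L] L2 by (simp add: p_def m_def x_def)
  ultimately have "tp Y * w = (p / m + lam 1) *\<^sub>R x"
    by (simp add: left_diff_distrib scaleR_left_distrib algebra_simps)
  then have "m *\<^sub>R (tp Y * w) = (m * (p / m + lam 1)) *\<^sub>R x" by simp
  also have "m * (p / m + lam 1) = \<Lambda> + p"
    using m Lambda_low by (simp add: m_def field_simps)
  finally show ?thesis by (simp add: m_def p_def)
qed

text \<open>The last-layer Hessian equation applied to \<open>pr V (L - 1) 0 * a\<close>. As V_1 x =
  0, the residual acts on x through Y alone.\<close>

lemma right_eq:
  assumes a: "eig a s"
  defines "x \<equiv> tp (X 1) * (V 1 * a)" and "w \<equiv> X L * (pr V (L - 1) 0 * a)"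
  shows "(\<Lambda> + s ^ (L - 1)) *\<^sub>R w = (lam 1 * s ^ (L - 2)) *\<^sub>R (Y * x)"
proof -
  obtain J where J: "L = Suc (Suc J)" using L2 by (metis add_2_eq_Suc le_Suc_ex)
  define c where "c = lprod lam 0 (Suc J)"
  have c: "c > 0" "c = lam 1 * lprod lam 1 (Suc J)" "\<Lambda> = lam L * c"
    using lprod_pos[of 0 "Suc J"] lprod_low[of 0 "Suc J" lam] J by (auto simp: c_def lprod_Suc)
  have l1: "lprod lam 1 (Suc J) > 0" using lprod_pos[of 1 "Suc J"] J by simp
  have "dhgrad lam Y L V X L * (pr V (Suc J) 0 * a) = 0" using lin[of L] L2 by simp
  then have "dpr V X L 0 * (tp (pr V (Suc J) 0) * (pr V (Suc J) 0 * a))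
     + (pr V L 0 - Y) * (tp (dpr V X (Suc J) 0) * (pr V (Suc J) 0 * a)) + lam L *\<^sub>R w = 0"
    by (simp del: pr.simps dpr.simps add: dhgrad_def distrib_right mult.assoc w_def J)
  moreover have "tp (pr V (Suc J) 0) * (pr V (Suc J) 0 * a) = (s ^ Suc J / c) *\<^sub>R a"
    using eig_pr[OF a, of 0 "Suc J"] J by (simp add: c_def)
  moreover have "tp (dpr V X (Suc J) 0) * (pr V (Suc J) 0 * a) = (s ^ J / lprod lam 1 (Suc J)) *\<^sub>R x"
    using tp_dpr_eig[OF a, of "Suc J"] J by (simp add: x_def)
  moreover have "pr V L 0 * x = 0"
  proof -
    have "pr V L 0 = pr V L 1 * V 1" using L2 by (simp add: pr_low)
    then show ?thesis using V1_X1_eig[OF a] by (simp add: x_def mult.assoc)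
  qed
  ultimately have "(s ^ Suc J / c) *\<^sub>R w + lam L *\<^sub>R w = (s ^ J / lprod lam 1 (Suc J)) *\<^sub>R (Y * x)"
    using dpr_L_eig[OF a] by (simp del: pr.simps dpr.simps add: left_diff_distrib w_def algebra_simps)
  then have "c *\<^sub>R ((s ^ Suc J / c + lam L) *\<^sub>R w) = c *\<^sub>R ((s ^ J / lprod lam 1 (Suc J)) *\<^sub>R (Y * x))"
    by (simp add: scaleR_left_distrib)
  moreover have "c * (s ^ Suc J / c + lam L) = \<Lambda> + s ^ (L - 1)"
    using c(1,3) by (simp add: distrib_left J mult.commute)
  moreover have "c * (s ^ J / lprod lam 1 (Suc J)) = lam 1 * s ^ (L - 2)"
    using l1 by (simp add: c(2) J)
  ultimately show ?thesis by (simp only: scaleR_scaleR)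
qed

text \<open>By \<open>left_eq\<close> and \<open>right_eq\<close>, x and w form a singular pair of Y
  for the same singular value as a, but V does not use it. Rotating a into x in the input space, and
  correspondingly P a into w in the output space, is a symmetry; orthogonality to it leaves a sum of
  two nonnegative terms equal to zero.\<close>

lemma outer_eig_eq_0:
  assumes a: "eig a s"
  shows "tp (X 1) * (V 1 * a) = 0 \<and> X L * (pr V (L - 1) 0 * a) = 0"
proof (cases "a = 0")
  case False
  define x where "x = tp (X 1) * (V 1 * a)"
  define w where "w = X L * (pr V (L - 1) 0 * a)"
  define m where "m = lprod lam 1 L"
  define p where "p = s ^ (L - 1)"
  define e where "e = lam 1 * s ^ (L - 2)"
  \<comment> \<open>Chosen so that \<gamma> Y^T w = mu(s) x (from \<open>g1\<close>) and \<gamma>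
    nu(s) a^T matches Y x = ((\<Lambda> + p)/e) w (from \<open>g2\<close>): the two halves of the
    intertwining with Y.\<close>
  define \<gamma> where "\<gamma> = m / p"
  let ?a = "pr V L 0 * a"
  have L1: "lam 1 > 0" "lam L > 0" using lam_pos L2 by auto
  have pos: "s > 0" "p > 0" "m > 0" "e > 0" "\<Lambda> > 0" "\<gamma> > 0"
    using a lprod_pos[of 1 L] lprod_pos[of 0 L] L2 L1 by (auto simp: eig_def p_def m_def e_def \<gamma>_def)
  have cols: "is_col x" "is_col w" "is_col ?a" "is_col a"
    using a by (auto simp: x_def w_def is_col_mult eig_col)
  have xeq: "(\<Lambda> + p) *\<^sub>R x = m *\<^sub>R (tp Y * w)" and weq: "(\<Lambda> + p) *\<^sub>R w = e *\<^sub>R (Y * x)"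
    using left_eq[OF a] right_eq[OF a] by (auto simp: x_def w_def m_def p_def e_def)
  have tpYw: "tp Y * w = ((\<Lambda> + p) / m) *\<^sub>R x" by (rule scaleR_solve) (use xeq pos in auto)
  have Yx: "Y * x = ((\<Lambda> + p) / e) *\<^sub>R w" by (rule scaleR_solve) (use weq pos in auto)
  have Vw: "tp (V L) * w = 0" using V_L_X_L_eig[OF a] by (simp add: w_def)
  have Xa: "X 1 * a = 0" by (rule X1_eig[OF a])
  have ep: "e * s = lam 1 * p"
  proof -
    have "s ^ (L - 2) * s = s ^ (L - 1)"
      using L2 by (metis Suc_diff_le diff_Suc_Suc numeral_2_eq_2 One_nat_def power_Suc2)
    then show ?thesis by (simp add: e_def p_def)
  qed
  have Lm: "\<Lambda> = lam 1 * m" using Lambda_low by (simp add: m_def)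
  have mu: "mu s = (\<Lambda> + p) / p" using pos by (simp add: mu_def flip: p_def) (simp add: mu_def p_def field_simps)
  have nu: "nu s = s * (\<Lambda> + p) / \<Lambda>"
    unfolding nu_def mu using pos by (simp add: s_pow_L p_def)
  have g1: "\<gamma> * ((\<Lambda> + p) / m) = mu s" using pos by (simp add: \<gamma>_def mu)
  have g2: "\<gamma> * nu s = (\<Lambda> + p) / e"
  proof -
    have "\<gamma> * nu s = (\<Lambda> + p) * (m * s) / (p * \<Lambda>)" by (simp add: \<gamma>_def nu)
    also have "m * s * e = m * lam 1 * p" using ep by (metis mult.assoc mult.commute)
    then have "m * s = p * \<Lambda> / e" using pos Lm by (simp add: field_simps)
    finally show ?thesis using pos by simp
  qed
  have ipxw: "(\<Lambda> + p) * ip x x = m * ip (Y * x) w" "(\<Lambda> + p) * ip w w = e * ip (Y * x) w"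
    using arg_cong[OF xeq, of "ip x"] arg_cong[OF weq, of "\<lambda>z. ip z w"]
    by (simp_all add: ip_left)
  have "(\<Lambda> + p) * (e * ip x x) = (\<Lambda> + p) * (m * ip w w)"
    using arg_cong[OF ipxw(1), of "\<lambda>z. e * z"] arg_cong[OF ipxw(2), of "\<lambda>z. m * z"]
    by (simp add: algebra_simps)
  then have exm: "e * ip x x = m * ip w w" using pos by simp
  have g3: "\<gamma>\<^sup>2 * (s ^ L / \<Lambda>) = m / e"
  proof -
    have "\<gamma>\<^sup>2 * (s ^ L / \<Lambda>) = m * (m * s) / (p * \<Lambda>)"
      using pos by (simp add: \<gamma>_def s_pow_L power2_eq_square flip: p_def) (simp add: p_def field_simps)
    also have "m * s * e = m * lam 1 * p" using ep by (metis mult.assoc mult.commute)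
    then have "m * s = p * \<Lambda> / e" using pos Lm by (simp add: field_simps)
    finally show ?thesis using pos by simp
  qed
  have "lam L * (ip (\<gamma> *\<^sub>R ?a) (X L * (tp (V L) * w)) - ip w (X L * (tp (V L) * (\<gamma> *\<^sub>R ?a))))
        = lam 1 * (ip a (tp (V 1) * (X 1 * x)) - ip x (tp (V 1) * (X 1 * a)))"
  proof (rule orth_end)
    show "ip a x = 0" using Xa by (simp add: x_def ip_right)
    show "ip (\<gamma> *\<^sub>R ?a) w = 0"
    proof -
      have "ip ?a w = ip (pr V (L - 1) 0 * a) (tp (V L) * w)"
        using L2 by (cases L) (auto simp: mult.assoc ip_left)
      then show ?thesis by (simp add: Vw)
    qed
    have "ip (\<gamma> *\<^sub>R ?a) (\<gamma> *\<^sub>R ?a) * ip w w = (\<gamma>\<^sup>2 * (s ^ L / \<Lambda>)) * ip a a * ip w w"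
      by (simp add: eig_scale[OF a] power2_eq_square)
    also have "\<dots> = ip a a * ip x x" unfolding g3 using exm pos by (simp add: field_simps)
    finally show "ip a a * ip x x = ip (\<gamma> *\<^sub>R ?a) (\<gamma> *\<^sub>R ?a) * ip w w" ..
    have "(\<gamma> *\<^sub>R ?a * tp w - w * tp (\<gamma> *\<^sub>R ?a)) * Y
        = \<gamma> *\<^sub>R (?a * tp (tp Y * w)) - \<gamma> *\<^sub>R (w * tp (tp Y * ?a))"
      by (simp add: left_diff_distrib mult.assoc)
    also have "\<dots> = mu s *\<^sub>R (?a * tp x) - ((\<Lambda> + p) / e) *\<^sub>R (w * tp a)"
      unfolding tpYw eig_tp_Y[OF a] tp_scaleR mult_scaleR_right scaleR_scaleR g1 g2 ..
    also have "\<dots> = (Y * a) * tp x - (Y * x) * tp a"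
      unfolding Yx eig_Y[OF a] by simp
    also have "\<dots> = Y * (a * tp x - x * tp a)"
      by (simp add: right_diff_distrib mult.assoc)
    finally show "(\<gamma> *\<^sub>R ?a * tp w - w * tp (\<gamma> *\<^sub>R ?a)) * Y = Y * (a * tp x - x * tp a)" .
    have "proj (d 0) * tp (X 1) = tp (X 1)"
      using X_right[of 1] L2 by (metis One_nat_def diff_Suc_1 le_refl le_trans one_le_numeral tp_proj tp_times)
    then show "proj (d 0) * x = x" by (simp add: x_def flip: mult.assoc)
    show "proj (d L) * w = w" using X_left[of L] L2 by (simp add: w_def flip: mult.assoc)
  qed (use cols a V_L_supp eig_supp in \<open>auto simp: is_col_scaleR\<close>)
  moreover have "ip w (X L * (tp (V L) * (\<gamma> *\<^sub>R ?a))) = \<gamma> * (s / lam L) * ip w w"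
    by (simp add: eig_step_L[OF a] w_def)
  moreover have "ip a (tp (V 1) * (X 1 * x)) = ip x x"
    by (simp add: ip_right[of a] ip_right[of "V (Suc 0) * a"]) (simp add: x_def)
  \<comment> \<open>The cross terms vanish because V_L^T w = 0 and X_1 a = 0; the surviving squares
    stand on opposite sides with opposite signs.\<close>
  ultimately have "- (\<gamma> * s * ip w w) = lam 1 * ip x x"
    using L1 by (simp add: Vw Xa[unfolded One_nat_def])
  moreover have "\<gamma> * s * ip w w \<ge> 0" "lam 1 * ip x x \<ge> 0"
    using pos L1 ip_ge_0 by auto
  ultimately have "\<gamma> * s * ip w w = 0" "lam 1 * ip x x = 0" by linarith+
  then have "ip w w = 0" "ip x x = 0" using pos L1 by auto
  then show ?thesis unfolding x_def[symmetric] w_def[symmetric] using col_ip_eq_0 cols by blast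
qed simp

text \<open>Each layer is brought into the kernel treated by \<open>X_kernel\<close>: the first by
  the eigencolumn results, the hidden ones inductively by \<open>linear_balance\<close>, and the
  last from its other side, through its transpose.\<close>

lemma X_eq_0:
  assumes l: "1 \<le> l" "l \<le> L"
  shows "X l = 0"
proof -
  have X1: "X 1 = 0"
  proof -
    have "V 1 * (tp (V 1) * X 1) = 0"
    proof (rule V1_eq_0_if_orth_eig)
      fix b t assume b: "eig b t"
      have "tp (tp (X 1) * (V 1 * b)) = 0" using outer_eig_eq_0[OF b] by simp
      then show "tp b * (tp (V 1) * X 1) = 0" by (simp add: mult.assoc)
    qed
    then have "tp (tp (V 1) * X 1) * (tp (V 1) * X 1) = 0" by (simp add: mult.assoc)
    then have "tp (V 1) * X 1 = 0" by (rule tp_mult_self_eq_0)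
    then have "tp (X 1) * X 1 = 0" using X_kernel[of 1 "X 1"] L2 by simp
    then show ?thesis by (rule tp_mult_self_eq_0)
  qed
  have mid: "X l = 0" if "1 \<le> l" "l < L" for l
    using that
  proof (induction l rule: dec_induct)
    case base
    show ?case by (fact X1)
  next
    case (step l)
    then have "tp (V (Suc l)) * X (Suc l) = 0" using linear_balance[of l] by simp
    then have "tp (X (Suc l)) * X (Suc l) = 0" using X_kernel[of "Suc l" "X (Suc l)"] step by simp
    then show ?case by (rule tp_mult_self_eq_0)
  qed
  have "X L = 0"
  proof -
    have "V 1 * (tp (pr V (L - 1) 0) * tp (X L)) = 0"
    proof (rule V1_eq_0_if_orth_eig)
      fix b t assume b: "eig b t"
      have "tp (X L * (pr V (L - 1) 0 * b)) = 0" using outer_eig_eq_0[OF b] by simp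
      then show "tp b * (tp (pr V (L - 1) 0) * tp (X L)) = 0" by (simp add: mult.assoc)
    qed
    \<comment> \<open>Strips the product one layer at a time: the induction hypothesis applies to
      V_(l+1)^T z, \<open>ker_up\<close> moves it into the kernel of V_(l+1), and the Gram argument
      finishes.\<close>
    moreover have "tp (V l) * z = 0" if "1 \<le> l" "l < L" "V 1 * (tp (pr V l 0) * z) = 0" for l z
      using that
    proof (induction l arbitrary: z rule: dec_induct)
      case base
      then have "tp (tp (V 1) * z) * (tp (V 1) * z) = 0" by (simp add: mult.assoc)
      then show ?case by (rule tp_mult_self_eq_0)
    next
      case (step l)
      have "tp (V l) * (tp (V (Suc l)) * z) = 0"
        by (rule step.IH) (use step in \<open>auto simp: mult.assoc\<close>)
      then have "V (Suc l) * (tp (V (Suc l)) * z) = 0" using ker_up[of l] step by simp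
      then have "tp (tp (V (Suc l)) * z) * (tp (V (Suc l)) * z) = 0" by (simp add: mult.assoc)
      then show ?case by (rule tp_mult_self_eq_0)
    qed
    ultimately have "tp (V (L - 1)) * tp (X L) = 0" using L2 by simp
    then have "X L * tp (X L) = 0" using X_kernel[of "L - 1" "tp (X L)"] L2 by simp
    then have "tp (tp (X L)) * tp (X L) = 0" by simp
    then have "tp (X L) = 0" by (rule tp_mult_self_eq_0)
    then show ?thesis by simp
  qed
  with mid l show ?thesis by (cases "l = L") auto
qed

end

subsection \<open>Rotations\<close>

definition rot :: "real \<Rightarrow> real \<Rightarrow> rmat \<Rightarrow> rmat" where
  "rot k u A = 1 + (2 * u / (1 + k * u\<^sup>2)) *\<^sub>R A + (2 * u\<^sup>2 / (1 + k * u\<^sup>2)) *\<^sub>R (A * A)"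

text \<open>For a skew matrix with minimal polynomial dividing \<open>A^3 + k A\<close> this is the Cayley
  transform of \<open>u A\<close>.\<close>

lemma tp_rot: "tp A = - A \<Longrightarrow> tp (rot k u A) = rot k (- u) A"
  by (simp add: rot_def)

text \<open>Since A^3 = -k A, the product reduces to 1 plus a multiple of A^2, and the denominators
  1 + k u^2 make that multiple vanish.\<close>

lemma rot_orthogonal:
  assumes A: "A * (A * A) = - (k *\<^sub>R A)" and k: "k \<ge> 0"
  shows "rot k u A * rot k (- u) A = 1"
proof -
  define s where "s = 1 + k * u\<^sup>2"
  define \<alpha> where "\<alpha> = 2 * u / s"
  define \<beta> where "\<beta> = 2 * u\<^sup>2 / s"
  have s: "s > 0" using k by (simp add: s_def add_pos_nonneg)
  have A4: "A * (A * (A * A)) = - (k *\<^sub>R (A * A))" using A by simp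
  have "\<beta> + \<beta> - \<alpha>\<^sup>2 - k * \<beta>\<^sup>2 = 4 * u\<^sup>2 * (s - 1 - k * u\<^sup>2) / s\<^sup>2"
    using s by (simp add: \<alpha>_def \<beta>_def field_simps power2_eq_square)
  then have c: "\<beta> + \<beta> - \<alpha>\<^sup>2 - k * \<beta>\<^sup>2 = 0" by (simp add: s_def)
  have dbl: "(r * 2) *\<^sub>R M = r *\<^sub>R M + r *\<^sub>R M" for r and M :: rmat
    by (metis mult_2_right scaleR_left_distrib)
  have "rot k u A * rot k (- u) A = (1 + \<alpha> *\<^sub>R A + \<beta> *\<^sub>R (A * A)) * (1 - \<alpha> *\<^sub>R A + \<beta> *\<^sub>R (A * A))"
    by (simp add: rot_def \<alpha>_def \<beta>_def s_def)
  also have "\<dots> = 1 + (\<beta> + \<beta> - \<alpha>\<^sup>2 - k * \<beta>\<^sup>2) *\<^sub>R (A * A)"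
    by (simp add: algebra_simps A A4 power2_eq_square dbl)
  finally show ?thesis unfolding c by simp
qed

lemma rot_commute_intertwine:
  assumes "A * Y = Y * B"
  shows "rot k u A * Y = Y * rot k u B"
proof -
  have "A * (A * Y) = Y * (B * B)" using assms by (metis mult.assoc)
  then show ?thesis using assms by (simp add: rot_def distrib_left distrib_right mult.assoc)
qed

text \<open>Both one-sided conditions are required because the matrices are infinite: a shift
  satisfies only one of them.\<close>

locale orthogonal_family =
  fixes Q :: "nat \<Rightarrow> rmat"
  assumes tpQ_Q: "\<And>l. tp (Q l) * Q l = 1" and Q_tpQ: "\<And>l. Q l * tp (Q l) = 1"
begin

definition act :: "(nat \<Rightarrow> rmat) \<Rightarrow> nat \<Rightarrow> rmat" where
  "act V l = Q l * V l * tp (Q (l - 1))"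

lemma Q_cancel: "tp (Q l) * (Q l * M) = M" "Q l * (tp (Q l) * M) = M"
  by (simp_all add: tpQ_Q Q_tpQ flip: mult.assoc)

lemma pr_act: "k \<le> l \<Longrightarrow> pr (act V) l k = Q l * pr V l k * tp (Q k)"
proof (induction l)
  case (Suc l)
  show ?case
  proof (cases "k = Suc l")
    case False
    then have "k \<le> l" using Suc.prems by simp
    then show ?thesis using Suc.IH by (simp add: act_def mult.assoc Q_cancel)
  qed (simp add: Q_tpQ)
qed (simp add: Q_tpQ)

text \<open>The gradient is equivariant: the hidden rotations cancel between neighbouring layers,
  and intertwining with Y pulls the outer ones out of the residual. Hence orbits of critical points
  consist of critical points.\<close>

lemma hgrad_act:
  assumes Y: "Q L * Y = Y * Q 0" and l: "1 \<le> l" "l \<le> L"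
  shows "hgrad lam Y L (act V) l = Q l * hgrad lam Y L V l * tp (Q (l - 1))"
proof -
  have "Y = Q L * (Y * tp (Q 0))"
    by (metis Q_tpQ Y mult.assoc mult.right_neutral)
  then have "pr (act V) L 0 - Y = Q L * ((pr V L 0 - Y) * tp (Q 0))"
    by (simp add: pr_act mult.assoc left_diff_distrib right_diff_distrib)
  then show ?thesis
    using l by (simp add: hgrad_def pr_act mult.assoc Q_cancel distrib_left distrib_right) (simp add: act_def mult.assoc)
qed

end

section \<open>Weight tuples as matrices and the formula for the gradient\<close>

lift_definition matof :: "nat \<Rightarrow> nat \<Rightarrow> (nat \<Rightarrow> nat \<Rightarrow> real) \<Rightarrow> rmat"
  is "\<lambda>m n A i j. if i < m \<and> j < n then A i j else 0" by simp

lemma ent_matof: "ent (matof m n A) i j = (if i < m \<and> j < n then A i j else 0)"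
  by (simp add: matof.rep_eq)

lemma proj_matof [simp]: "proj m * matof m n A = matof m n A" "matof m n A * proj n = matof m n A"
  by (auto simp: proj_mult_iff mult_proj_iff ent_matof)

definition layers :: "(nat \<Rightarrow> nat) \<Rightarrow> (nat \<Rightarrow> nat \<Rightarrow> nat \<Rightarrow> real) \<Rightarrow> nat \<Rightarrow> rmat" where
  "layers d W l = matof (d l) (d (l - 1)) (W l)"

lemma ent_layers: "ent (layers d W l) i j = (if i < d l \<and> j < d (l - 1) then W l i j else 0)"
  by (simp add: layers_def ent_matof)

lemma proj_layers: "proj (d l) * layers d W l = layers d W l" "layers d W l * proj (d (l - 1)) = layers d W l"
  by (simp_all add: layers_def)

lemma wprod_eq_pr: "i < d k \<Longrightarrow> wprod d W k i j = ent (pr (layers d W) k 0) i j"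
proof (induction k arbitrary: i)
  case (Suc k)
  have "ent (pr (layers d W) (Suc k) 0) i j = (\<Sum>m<d k. ent (layers d W (Suc k)) i m * ent (pr (layers d W) k 0) m j)"
    by (simp, rule ent_times_left) (auto simp: ent_layers)
  then show ?case using Suc by (simp add: ent_layers)
qed (simp add: ent_one)

text \<open>A product is affine in each single layer, so moving one entry changes the output exactly
  linearly and the loss is quadratic along that line.\<close>

lemma pr_upd:
  assumes "1 \<le> l"
  shows "pr (W(l := W l + H)) k j = pr W k j + (if j < l \<and> l \<le> k then pr W k l * H * pr W (l - 1) j else 0)"
proof (induction k)
  case (Suc k)
  consider "Suc k < l" | "Suc k = l" | "l \<le> k" by linarith
  then show ?case
  proof cases
    case 3
    then show ?thesis using Suc by (auto simp: distrib_left mult.assoc)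
  qed (use Suc in \<open>auto simp: distrib_right\<close>)
qed (use assms in simp)

lemma ent_outer: "is_col a \<Longrightarrow> ent (a * tp c) i j = ent a i 0 * ent c j 0"
  by (subst ent_times_left[of "{0}"]) (auto simp: is_col_def)

lemma ent_mult_unit_outer:
  "ent (A * (unit_col i * tp (unit_col j)) * C) a b = ent A a i * ent C j b"
proof -
  have "A * (unit_col i * tp (unit_col j)) * C = (A * unit_col i) * tp (tp C * unit_col j)"
    by (simp add: mult.assoc)
  then have "ent (A * (unit_col i * tp (unit_col j)) * C) a b
      = ent (A * unit_col i) a 0 * ent (tp C * unit_col j) b 0"
    by (simp only: ent_outer is_col_mult is_col_unit_col)
  then show ?thesis by (simp add: ent_mult_unit_col)
qed

lemma proj_pr:
  assumes "k < l"
  shows "proj (d l) * pr (layers d W) l k = pr (layers d W) l k"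
    "pr (layers d W) l k * proj (d k) = pr (layers d W) l k"
proof -
  obtain j where "l = Suc j" "k \<le> j" using assms by (cases l) auto
  then show "proj (d l) * pr (layers d W) l k = pr (layers d W) l k"
    by (simp add: proj_layers flip: mult.assoc)
  show "pr (layers d W) l k * proj (d k) = pr (layers d W) l k"
    using proj_layers(2)[of d W "Suc k"] assms by (simp add: pr_low mult.assoc)
qed

lemma gradF_eq:
  assumes l: "1 \<le> l" "l \<le> L" and i: "i < d l" and j: "j < d (l - 1)"
  shows "gradF d L lam Y W l i j = 2 * ent (hgrad lam (matof (d L) (d 0) Y) L (layers d W) l) i j"
proof -
  let ?W = "\<lambda>t l' i' j'. if (l', i', j') = (l, i, j) then W l i j + t else W l' i' j'"
  let ?M = "layers d W" and ?E = "unit_col i * tp (unit_col j)" and ?Y = "matof (d L) (d 0) Y"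
  let ?A = "pr ?M L l" and ?C = "pr ?M (l - 1) 0" and ?P = "pr ?M L 0"
  define U where "U t = ?W t" for t
  have M: "layers d (U t) = ?M(l := ?M l + t *\<^sub>R ?E)" for t
  proof (rule ext, rule rmat_eqI)
    fix l' a b
    have "ent ?E a b = (if a = i \<and> b = j then 1 else 0)"
      by (simp add: ent_outer is_col_unit_col unit_col.rep_eq)
    then show "ent (layers d (U t) l') a b = ent ((?M(l := ?M l + t *\<^sub>R ?E)) l') a b"
      using i j by (auto simp: ent_layers U_def)
  qed
  have P: "wprod d (U t) L a b = ent ?P a b + t * (ent ?A a i * ent ?C j b)" if "a < d L" for a b t
  proof -
    have "pr (layers d (U t)) L 0 = ?P + t *\<^sub>R (?A * ?E * ?C)"
      unfolding M using l by (subst pr_upd) auto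
    then show ?thesis using that by (simp add: wprod_eq_pr ent_mult_unit_outer)
  qed
  have Wt: "U t l' a b = W l' a b + t * (if (l', a, b) = (l, i, j) then 1 else 0)" for t l' a b
    by (auto simp: U_def)
  have loss: "lossF d L lam Y (U t) =
      (\<Sum>a<d L. \<Sum>b<d 0. (ent ?P a b + t * (ent ?A a i * ent ?C j b) - Y a b)\<^sup>2)
      + (\<Sum>l'=1..L. lam l' * (\<Sum>a<d l'. \<Sum>b<d (l' - 1). (W l' a b + t * (if (l', a, b) = (l, i, j) then 1 else 0))\<^sup>2))" for t
    by (simp add: lossF_def layer_sq_def P Wt)
  have "((\<lambda>t. lossF d L lam Y (U t)) has_field_derivative
      (\<Sum>a<d L. \<Sum>b<d 0. 2 * (ent ?P a b - Y a b) * (ent ?A a i * ent ?C j b))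
      + (\<Sum>l'=1..L. lam l' * (\<Sum>a<d l'. \<Sum>b<d (l' - 1). 2 * W l' a b * (if (l', a, b) = (l, i, j) then 1 else 0)))) (at 0)"
    by (simp only: loss) (rule derivative_eq_intros refl | simp add: algebra_simps)+
  then have "gradF d L lam Y W l i j =
      (\<Sum>a<d L. \<Sum>b<d 0. 2 * (ent ?P a b - Y a b) * (ent ?A a i * ent ?C j b))
      + (\<Sum>l'=1..L. lam l' * (\<Sum>a<d l'. \<Sum>b<d (l' - 1). 2 * W l' a b * (if (l', a, b) = (l, i, j) then 1 else 0)))"
    unfolding gradF_def U_def by (rule DERIV_imp_deriv)
  also have "(\<Sum>l'=1..L. lam l' * (\<Sum>a<d l'. \<Sum>b<d (l' - 1). 2 * W l' a b * (if (l', a, b) = (l, i, j) then 1 else 0)))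
      = (\<Sum>l'=1..L. if l' = l then 2 * (lam l * W l i j) else 0)"
  proof (intro sum.cong refl)
    fix l' assume "l' \<in> {1..L}"
    have "(\<Sum>a<d l. \<Sum>b<d (l - 1). 2 * W l a b * (if (l, a, b) = (l, i, j) then 1 else 0))
        = (\<Sum>a<d l. \<Sum>b<d (l - 1). if b = j then if a = i then 2 * W l a b else 0 else 0)"
      by (intro sum.cong refl) auto
    also have "\<dots> = (\<Sum>a<d l. if a = i then 2 * W l a j else 0)"
      using j by (simp only: sum.delta finite_lessThan lessThan_iff if_True)
    also have "\<dots> = 2 * W l i j"
      using i by (simp only: sum.delta finite_lessThan lessThan_iff if_True)
    finally show "lam l' * (\<Sum>a<d l'. \<Sum>b<d (l' - 1). 2 * W l' a b * (if (l', a, b) = (l, i, j) then 1 else 0))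
        = (if l' = l then 2 * (lam l * W l i j) else 0)"
      by auto
  qed
  also have "\<dots> = 2 * (lam l * W l i j)" using l by simp
  also have "(\<Sum>a<d L. \<Sum>b<d 0. 2 * (ent ?P a b - Y a b) * (ent ?A a i * ent ?C j b))
      = 2 * ent (tp ?A * (?P - ?Y) * tp ?C) i j"
  proof -
    have PY: "proj (d L) * (?P - ?Y) = ?P - ?Y" "(?P - ?Y) * proj (d 0) = ?P - ?Y"
      using l by (simp_all add: left_diff_distrib right_diff_distrib proj_pr)
    have "ent (tp ?A * (?P - ?Y) * tp ?C) i j = (\<Sum>b<d 0. ent (tp ?A * (?P - ?Y)) i b * ent ?C j b)"
    proof -
      have "(tp ?A * (?P - ?Y)) * proj (d 0) = tp ?A * (?P - ?Y)" by (simp add: mult.assoc PY)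
      then have "ent (tp ?A * (?P - ?Y)) i b = 0" if "b \<notin> {..<d 0}" for b
        using that unfolding mult_proj_iff by simp
      then show ?thesis by (subst ent_times_left[of "{..<d 0}"]) simp_all
    qed
    also have "\<dots> = (\<Sum>b<d 0. \<Sum>a<d L. ent ?A a i * ent (?P - ?Y) a b * ent ?C j b)"
    proof (intro sum.cong refl)
      fix b
      show "ent (tp ?A * (?P - ?Y)) i b * ent ?C j b = (\<Sum>a<d L. ent ?A a i * ent (?P - ?Y) a b * ent ?C j b)"
        by (subst ent_times_right[of "{..<d L}"])
          (use PY(1)[unfolded proj_mult_iff] in \<open>simp_all add: sum_distrib_right\<close>)
    qed
    also have "\<dots> = (\<Sum>a<d L. \<Sum>b<d 0. ent ?A a i * ent (?P - ?Y) a b * ent ?C j b)"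
      by (rule sum.swap)
    finally have "2 * ent (tp ?A * (?P - ?Y) * tp ?C) i j
        = 2 * (\<Sum>a<d L. \<Sum>b<d 0. ent ?A a i * ent (?P - ?Y) a b * ent ?C j b)"
      by simp
    also have "\<dots> = (\<Sum>a<d L. \<Sum>b<d 0. 2 * (ent ?P a b - Y a b) * (ent ?A a i * ent ?C j b))"
      unfolding sum_distrib_left by (intro sum.cong refl) (simp add: ent_matof)
    finally show ?thesis ..
  qed
  finally show ?thesis
    using i j by (simp add: hgrad_def ent_layers)
qed

text \<open>The gradient of the loss only records entries inside the layer; that the matrix formula
  vanishes outside is what turns criticality into the equation \<open>hgrad = 0\<close> in
  \<open>crit_iff\<close>.\<close>

lemma proj_hgrad:
  assumes l: "1 \<le> l" "l \<le> L"
    and G_def: "G = hgrad lam (matof (d L) (d 0) Y) L (layers d W) l"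
  shows "proj (d l) * G = G" "G * proj (d (l - 1)) = G"
proof -
  let ?M = "layers d W" and ?Y = "matof (d L) (d 0) Y"
  let ?A = "pr ?M L l" and ?C = "pr ?M (l - 1) 0" and ?P = "pr ?M L 0"
  have PY: "proj (d L) * (?P - ?Y) = ?P - ?Y" "(?P - ?Y) * proj (d 0) = ?P - ?Y"
    using l by (simp_all add: left_diff_distrib right_diff_distrib proj_pr)
  have A: "proj (d l) * (tp ?A * (?P - ?Y)) = tp ?A * (?P - ?Y)"
  proof (cases "l = L")
    case False
    then have "proj (d l) * tp ?A = tp ?A"
      using l proj_pr(2)[of l L d W] by (metis le_neq_implies_less tp_proj tp_times)
    then show ?thesis by (simp flip: mult.assoc)
  qed (simp add: PY)
  have C: "((?P - ?Y) * tp ?C) * proj (d (l - 1)) = (?P - ?Y) * tp ?C"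
  proof (cases "l - 1 = 0")
    case False
    then have "tp ?C * proj (d (l - 1)) = tp ?C"
      using proj_pr(1)[of 0 "l - 1" d W] by (metis neq0_conv tp_proj tp_times)
    then show ?thesis by (simp add: mult.assoc)
  qed (simp add: PY)
  show "proj (d l) * G = G"
    using A by (simp add: G_def hgrad_def distrib_left proj_layers) (metis mult.assoc)
  show "G * proj (d (l - 1)) = G"
    using C proj_layers(2)[of d W l] by (simp add: G_def hgrad_def distrib_right mult.assoc)
qed

subsection \<open>Critical points\<close>

lemma pr_cong: "(\<And>j. k < j \<Longrightarrow> j \<le> l \<Longrightarrow> V j = W j) \<Longrightarrow> pr V l k = pr W l k"
  by (induction l) auto

lemma hgrad_cong:
  assumes "\<And>j. 1 \<le> j \<Longrightarrow> j \<le> L \<Longrightarrow> V j = W j" and l: "1 \<le> l" "l \<le> L"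
  shows "hgrad lam Y L V l = hgrad lam Y L W l"
proof -
  have "pr V L l = pr W L l" "pr V L 0 = pr W L 0" "pr V (l - 1) 0 = pr W (l - 1) 0"
    by (rule pr_cong; use assms in simp)+
  then show ?thesis using assms by (simp add: hgrad_def)
qed

locale mf_problem =
  fixes L :: nat and d :: "nat \<Rightarrow> nat" and lam :: "nat \<Rightarrow> real" and Y :: "nat \<Rightarrow> nat \<Rightarrow> real"
  assumes L2: "L \<ge> 2" and lampos: "\<And>l. 1 \<le> l \<Longrightarrow> l \<le> L \<Longrightarrow> lam l > 0"
begin

abbreviation "Ym \<equiv> matof (d L) (d 0) Y"
abbreviation "crit \<equiv> crit_set d L lam Y"

definition wsq :: "(nat \<Rightarrow> nat \<Rightarrow> nat \<Rightarrow> real) \<Rightarrow> (nat \<Rightarrow> nat \<Rightarrow> nat \<Rightarrow> real) \<Rightarrow> real" where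
  "wsq W V = (\<Sum>l=1..L. lam l * (\<Sum>i<d l. \<Sum>j<d (l - 1). (W l i j - V l i j)\<^sup>2))"

lemma crit_iff: "W \<in> crit \<longleftrightarrow> wt_valid d L W \<and> (\<forall>l\<in>{1..L}. hgrad lam Ym L (layers d W) l = 0)"
proof -
  have "(\<forall>i<d l. \<forall>j<d (l - 1). gradF d L lam Y W l i j = 0) \<longleftrightarrow> hgrad lam Ym L (layers d W) l = 0"
    if l: "1 \<le> l" "l \<le> L" for l
  proof
    assume *: "\<forall>i<d l. \<forall>j<d (l - 1). gradF d L lam Y W l i j = 0"
    show "hgrad lam Ym L (layers d W) l = 0"
    proof (rule rmat_eqI)
      fix i j
      let ?G = "hgrad lam Ym L (layers d W) l"
      show "ent ?G i j = ent 0 i j"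
      proof (cases "i < d l \<and> j < d (l - 1)")
        case True
        then show ?thesis using * gradF_eq[OF l] by force
      next
        case False
        then show ?thesis using proj_hgrad[OF l refl, where lam = lam and d = d and Y = Y and W = W]
          by (auto simp: proj_mult_iff mult_proj_iff not_less)
      qed
    qed
  qed (use gradF_eq[OF l] in simp)
  then show ?thesis unfolding crit_set_def by auto
qed

definition unlayers :: "(nat \<Rightarrow> rmat) \<Rightarrow> nat \<Rightarrow> nat \<Rightarrow> nat \<Rightarrow> real" where
  "unlayers V l i j = (if 1 \<le> l \<and> l \<le> L then ent (V l) i j else 0)"

lemma layers_unlayers:
  assumes "1 \<le> l" "l \<le> L" "proj (d l) * V l = V l" "V l * proj (d (l - 1)) = V l"
  shows "layers d (unlayers V) l = V l"
  by (rule rmat_eqI) (use assms in \<open>auto simp: ent_layers unlayers_def proj_mult_iff mult_proj_iff not_less\<close>)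

lemma unlayers_crit:
  assumes "\<And>l. 1 \<le> l \<Longrightarrow> l \<le> L \<Longrightarrow> proj (d l) * V l = V l \<and> V l * proj (d (l - 1)) = V l"
    and "\<And>l. 1 \<le> l \<Longrightarrow> l \<le> L \<Longrightarrow> hgrad lam Ym L V l = 0"
  shows "unlayers V \<in> crit"
proof -
  have "hgrad lam Ym L (layers d (unlayers V)) l = hgrad lam Ym L V l" if "1 \<le> l" "l \<le> L" for l
    by (rule hgrad_cong) (use that assms layers_unlayers in auto)
  moreover have "wt_valid d L (unlayers V)"
    using assms(1) by (auto simp: wt_valid_def unlayers_def proj_mult_iff mult_proj_iff not_less)
  ultimately show ?thesis using assms by (simp add: crit_iff)
qed

lemma crit_layers:
  assumes "W \<in> crit" "1 \<le> l" "l \<le> L"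
  shows "hgrad lam Ym L (layers d W) l = 0"
  using assms by (simp add: crit_iff)

text \<open>At u = 0 the linear coefficient of \<open>rot\<close> has derivative 2 and the quadratic
  one 0, so the velocity is twice the infinitesimal action.\<close>

lemma DERIV_rot_act_entry:
  "((\<lambda>u. ent (rot k u A * M * tp (rot k u B)) i j) has_field_derivative
     2 * ent (A * M + M * tp B) i j) (at 0)"
proof -
  let ?a = "\<lambda>u. 2 * u / (1 + k * u\<^sup>2)" and ?b = "\<lambda>u. 2 * u\<^sup>2 / (1 + k * u\<^sup>2)"
  have "ent (rot k u A * M * tp (rot k u B)) i j = ent M i j + ?a u * ent (A * M + M * tp B) i j
      + ?b u * ent (A * A * M + M * tp (B * B)) i j + (?a u * ?a u) * ent (A * M * tp B) i j
      + (?a u * ?b u) * ent (A * M * tp (B * B) + A * A * M * tp B) i j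
      + (?b u * ?b u) * ent (A * A * M * tp (B * B)) i j" for u
    by (simp add: rot_def distrib_left distrib_right mult.assoc mult.commute[of "?a u" "?b u"])
  moreover have "(?a has_field_derivative 2) (at 0)" "(?b has_field_derivative 0) (at 0)"
    by (auto intro!: derivative_eq_intros)
  ultimately show ?thesis
    by (simp only:) (rule derivative_eq_intros | simp)+
qed

text \<open>The rotated points \<open>Z u\<close> are critical and pass through V at u = 0, so the
  weighted distance to W has a minimum there. One k serves all layers because
  \<open>rot_commute_intertwine\<close> needs the same coefficients at both ends.\<close>

lemma nearest_orthogonal:
  assumes V: "V \<in> crit" and nearest: "\<And>V'. V' \<in> crit \<Longrightarrow> wsq W V \<le> wsq W V'"
    and skew: "\<And>l. tp (A l) = - A l" and cube: "\<And>l. A l * (A l * A l) = - (k *\<^sub>R A l)" and k: "k \<ge> 0"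
    and supp: "\<And>l. proj (d l) * A l = A l" and AY: "A L * Ym = Ym * A 0"
  shows "(\<Sum>l=1..L. lam l * (\<Sum>i<d l. \<Sum>j<d (l - 1). (W l i j - V l i j)
     * ent (A l * layers d V l - layers d V l * A (l - 1)) i j)) = 0"
proof -
  let ?V = "layers d V"
  have suppr: "A l * proj (d l) = A l" for l
    using arg_cong[OF supp[of l], of tp] by (simp add: skew)
  have orth: "orthogonal_family (\<lambda>l. rot k u (A l))" for u
    using rot_orthogonal[OF cube k, where u = u] rot_orthogonal[OF cube k, where u = "- u"]
    by unfold_locales (simp_all add: tp_rot skew)
  define Z where "Z u = unlayers (\<lambda>l. rot k u (A l) * ?V l * tp (rot k u (A (l - 1))))" for u
  have Zcrit: "Z u \<in> crit" for u
  proof -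
    interpret orthogonal_family "\<lambda>l. rot k u (A l)" by (rule orth)
    have "unlayers (act ?V) \<in> crit"
    proof (rule unlayers_crit)
      fix l assume l: "1 \<le> l" "l \<le> L"
      have "proj (d l) * (rot k u (A l) * ?V l) = rot k u (A l) * ?V l"
        using supp[of l] proj_layers(1)[of d l V]
        by (simp add: rot_def distrib_left distrib_right) (simp flip: mult.assoc)
      moreover have "(?V l * tp (rot k u (A (l - 1)))) * proj (d (l - 1)) = ?V l * tp (rot k u (A (l - 1)))"
        using suppr[of "l - 1"] proj_layers(2)[of d V l]
        by (simp add: rot_def skew distrib_left distrib_right left_diff_distrib right_diff_distrib mult.assoc)
      ultimately show "proj (d l) * act ?V l = act ?V l \<and> act ?V l * proj (d (l - 1)) = act ?V l"
        unfolding act_def by (metis mult.assoc)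
      have "rot k u (A L) * Ym = Ym * rot k u (A 0)"
        by (rule rot_commute_intertwine[OF AY])
      then show "hgrad lam Ym L (act ?V) l = 0"
        by (subst hgrad_act) (use l crit_layers[OF V l] in auto)
    qed
    then show ?thesis by (simp add: Z_def act_def[abs_def])
  qed
  have Z0: "Z 0 l i j = V l i j" if "1 \<le> l" "l \<le> L" "i < d l" "j < d (l - 1)" for l i j
    using that by (simp add: Z_def unlayers_def rot_def ent_layers)
  have "wsq W (Z 0) = wsq W V" using Z0 unfolding wsq_def by (intro sum.cong refl arg_cong2[of _ _ _ _ "(*)"]) auto
  then have min: "wsq W (Z 0) \<le> wsq W (Z u)" for u using nearest[OF Zcrit[of u]] by simp
  define D where "D l i j = 2 * ent (A l * ?V l + ?V l * tp (A (l - 1))) i j" for l i j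
  have dZ: "((\<lambda>u. Z u l i j) has_field_derivative D l i j) (at 0)" if "1 \<le> l" "l \<le> L" for l i j
    using DERIV_rot_act_entry[of k "A l" "?V l" "A (l - 1)" i j] that by (simp add: Z_def unlayers_def D_def)
  have "((\<lambda>u. wsq W (Z u)) has_field_derivative
     (\<Sum>l=1..L. lam l * (\<Sum>i<d l. \<Sum>j<d (l - 1). 2 * (W l i j - Z 0 l i j) * (- D l i j)))) (at 0)"
    unfolding wsq_def
    by (intro DERIV_sum DERIV_cmult) (auto intro!: derivative_eq_intros dZ)
  then have "(\<Sum>l=1..L. lam l * (\<Sum>i<d l. \<Sum>j<d (l - 1). 2 * (W l i j - Z 0 l i j) * (- D l i j))) = 0"
    by (rule DERIV_local_min[of _ _ _ 1]) (use min in auto)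
  moreover have "(\<Sum>l=1..L. lam l * (\<Sum>i<d l. \<Sum>j<d (l - 1). 2 * (W l i j - Z 0 l i j) * (- D l i j)))
     = (\<Sum>l=1..L. lam l * (\<Sum>i<d l. \<Sum>j<d (l - 1). - 4 * ((W l i j - V l i j)
     * ent (A l * ?V l - ?V l * A (l - 1)) i j)))"
  proof (rule sum.cong[OF refl])
    fix l assume l: "l \<in> {1..L}"
    have term_eq: "2 * (W l i j - Z 0 l i j) * (- D l i j)
        = - 4 * ((W l i j - V l i j) * ent (A l * ?V l - ?V l * A (l - 1)) i j)"
      if *: "i \<in> {..<d l}" "j \<in> {..<d (l - 1)}" for i j
    proof -
      define e where "e = ent (A l * ?V l - ?V l * A (l - 1)) i j"
      have "D l i j = 2 * e" by (simp add: D_def e_def skew)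
      moreover have "Z 0 l i j = V l i j" by (rule Z0) (use l * in auto)
      ultimately show ?thesis
        unfolding e_def[symmetric] by (simp add: algebra_simps)
    qed
    have "(\<Sum>i<d l. \<Sum>j<d (l - 1). 2 * (W l i j - Z 0 l i j) * (- D l i j))
      = (\<Sum>i<d l. \<Sum>j<d (l - 1). - 4 * ((W l i j - V l i j) * ent (A l * ?V l - ?V l * A (l - 1)) i j))"
      by (intro sum.cong refl term_eq)
    then show "lam l * (\<Sum>i<d l. \<Sum>j<d (l - 1). 2 * (W l i j - Z 0 l i j) * (- D l i j))
      = lam l * (\<Sum>i<d l. \<Sum>j<d (l - 1). - 4 * ((W l i j - V l i j) * ent (A l * ?V l - ?V l * A (l - 1)) i j))"
      by simp
  qed
  moreover have "\<dots> = - 4 * (\<Sum>l=1..L. lam l * (\<Sum>i<d l. \<Sum>j<d (l - 1). (W l i j - V l i j)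
     * ent (A l * ?V l - ?V l * A (l - 1)) i j))"
    by (simp only: sum_distrib_left mult_ac)
  ultimately show ?thesis by simp
qed

end

subsection \<open>Limits of matrices\<close>

definition mconv :: "(nat \<Rightarrow> rmat) \<Rightarrow> rmat \<Rightarrow> bool" where
  "mconv f A \<longleftrightarrow> (\<forall>i j. (\<lambda>n. ent (f n) i j) \<longlonglongrightarrow> ent A i j)"

lemma mconvD: "mconv f A \<Longrightarrow> (\<lambda>n. ent (f n) i j) \<longlonglongrightarrow> ent A i j"
  by (simp add: mconv_def)

lemma mconv_const: "mconv (\<lambda>n. A) A"
  by (simp add: mconv_def)

lemma mconv_add: "mconv f A \<Longrightarrow> mconv g B \<Longrightarrow> mconv (\<lambda>n. f n + g n) (A + B)"
  by (simp add: mconv_def tendsto_add)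

lemma mconv_diff: "mconv f A \<Longrightarrow> mconv g B \<Longrightarrow> mconv (\<lambda>n. f n - g n) (A - B)"
  by (simp add: mconv_def tendsto_diff)

lemma mconv_scaleR: "c \<longlonglongrightarrow> r \<Longrightarrow> mconv f A \<Longrightarrow> mconv (\<lambda>n. c n *\<^sub>R f n) (r *\<^sub>R A)"
  by (simp add: mconv_def tendsto_mult)

lemma mconv_tp: "mconv f A \<Longrightarrow> mconv (\<lambda>n. tp (f n)) (tp A)"
  by (simp add: mconv_def)

lemma mconv_unique: "mconv f A \<Longrightarrow> mconv f B \<Longrightarrow> A = B"
  by (rule rmat_eqI) (metis mconvD LIMSEQ_unique)

lemma ent_times_proj_left: "A * proj N = A \<Longrightarrow> ent (A * B) i j = (\<Sum>k<N. ent A i k * ent B k j)"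
  by (rule ent_times_left) (auto simp: mult_proj_iff not_less)

lemma ent_times_proj_right: "proj N * B = B \<Longrightarrow> ent (A * B) i j = (\<Sum>k<N. ent A i k * ent B k j)"
  by (rule ent_times_right) (auto simp: proj_mult_iff not_less)

lemma mconv_closed:
  assumes "mconv f A"
  shows "(\<And>n. proj N * f n = f n) \<Longrightarrow> proj N * A = A" "(\<And>n. f n * proj N = f n) \<Longrightarrow> A * proj N = A"
proof -
  assume *: "\<And>n. proj N * f n = f n"
  show "proj N * A = A" unfolding proj_mult_iff
  proof (intro allI impI)
    fix i j assume "N \<le> i"
    then have "(\<lambda>n. ent (f n) i j) = (\<lambda>n. 0)" using * by (auto simp: proj_mult_iff)
    with mconvD[OF assms, of i j] show "ent A i j = 0" by (simp add: LIMSEQ_const_iff)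
  qed
next
  assume *: "\<And>n. f n * proj N = f n"
  show "A * proj N = A" unfolding mult_proj_iff
  proof (intro allI impI)
    fix i j assume "N \<le> j"
    then have "(\<lambda>n. ent (f n) i j) = (\<lambda>n. 0)" using * by (auto simp: mult_proj_iff)
    with mconvD[OF assms, of i j] show "ent A i j = 0" by (simp add: LIMSEQ_const_iff)
  qed
qed

text \<open>For infinite matrices entrywise convergence is not preserved by products. A support
  bound N common to the whole sequence reduces every entry to a finite sum of fixed length.\<close>

lemma mconv_mult_left:
  assumes "mconv f A" "mconv g B" "\<And>n. f n * proj N = f n"
  shows "mconv (\<lambda>n. f n * g n) (A * B)"
  unfolding mconv_def
  by (simp add: ent_times_proj_left[OF assms(3)] ent_times_proj_left[OF mconv_closed(2)[OF assms(1,3)]])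
    (intro allI tendsto_sum tendsto_mult mconvD assms)

lemma mconv_mult_right:
  assumes "mconv f A" "mconv g B" "\<And>n. proj N * g n = g n"
  shows "mconv (\<lambda>n. f n * g n) (A * B)"
  unfolding mconv_def
  by (simp add: ent_times_proj_right[OF assms(3)] ent_times_proj_right[OF mconv_closed(1)[OF assms(2,3)]])
    (intro allI tendsto_sum tendsto_mult mconvD assms)

text \<open>The difference quotient of \<open>pr\<close> between V and V + eX, written without
  division. It telescopes over the layers, with perturbed factors below the varied one, and equals
  \<open>dpr\<close> at e = 0.\<close>

fun qpr :: "(nat \<Rightarrow> rmat) \<Rightarrow> (nat \<Rightarrow> rmat) \<Rightarrow> real \<Rightarrow> nat \<Rightarrow> nat \<Rightarrow> rmat" where
  "qpr V X e 0 k = 0"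
| "qpr V X e (Suc l) k =
     (if k \<le> l then X (Suc l) * pr (\<lambda>j. V j + e *\<^sub>R X j) l k + V (Suc l) * qpr V X e l k else 0)"

lemma pr_add: "pr (\<lambda>j. V j + e *\<^sub>R X j) l k = pr V l k + e *\<^sub>R qpr V X e l k"
proof (induction l)
  case (Suc l)
  show ?case
  proof (cases "k \<le> l")
    case True
    let ?W = "pr (\<lambda>j. V j + e *\<^sub>R X j) l k"
    have "pr (\<lambda>j. V j + e *\<^sub>R X j) (Suc l) k = V (Suc l) * ?W + e *\<^sub>R (X (Suc l) * ?W)"
      using True by (simp add: distrib_right)
    also have "V (Suc l) * ?W = V (Suc l) * pr V l k + e *\<^sub>R (V (Suc l) * qpr V X e l k)"
      unfolding Suc.IH by (simp add: distrib_left)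
    finally show ?thesis using True by (simp add: scaleR_right_distrib)
  qed simp
qed simp

text \<open>An exact first-order expansion: the three factors of the data term are replaced one
  after the other, so the quotient mixes factors at V and at W but has no remainder.\<close>

lemma hgrad_add:
  fixes V X :: "nat \<Rightarrow> rmat" and e :: real
  defines "W \<equiv> \<lambda>j. V j + e *\<^sub>R X j"
  shows "hgrad lam Y L W l = hgrad lam Y L V l + e *\<^sub>R
    (tp (qpr V X e L l) * ((pr W L 0 - Y) * tp (pr W (l - 1) 0))
     + tp (pr V L l) * (qpr V X e L 0 * tp (pr W (l - 1) 0))
     + tp (pr V L l) * ((pr V L 0 - Y) * tp (qpr V X e (l - 1) 0)) + lam l *\<^sub>R X l)"
proof -
  have W: "pr W i k = pr V i k + e *\<^sub>R qpr V X e i k" for i k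
    unfolding W_def by (rule pr_add)
  have 1: "tp (pr W L l) * ((pr W L 0 - Y) * tp (pr W (l - 1) 0))
    = tp (pr V L l) * ((pr W L 0 - Y) * tp (pr W (l - 1) 0))
      + e *\<^sub>R (tp (qpr V X e L l) * ((pr W L 0 - Y) * tp (pr W (l - 1) 0)))"
    by (subst (1) W) (simp add: distrib_right)
  have 2: "(pr W L 0 - Y) * tp (pr W (l - 1) 0)
    = (pr V L 0 - Y) * tp (pr W (l - 1) 0) + e *\<^sub>R (qpr V X e L 0 * tp (pr W (l - 1) 0))"
    by (subst (1) W) (simp add: distrib_right left_diff_distrib)
  have 3: "(pr V L 0 - Y) * tp (pr W (l - 1) 0)
    = (pr V L 0 - Y) * tp (pr V (l - 1) 0) + e *\<^sub>R ((pr V L 0 - Y) * tp (qpr V X e (l - 1) 0))"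
    by (subst (1) W) (simp add: distrib_left)
  have "tp (pr W L l) * ((pr W L 0 - Y) * tp (pr W (l - 1) 0))
    = tp (pr V L l) * ((pr V L 0 - Y) * tp (pr V (l - 1) 0))
      + e *\<^sub>R (tp (pr V L l) * ((pr V L 0 - Y) * tp (qpr V X e (l - 1) 0)))
      + e *\<^sub>R (tp (pr V L l) * (qpr V X e L 0 * tp (pr W (l - 1) 0)))
      + e *\<^sub>R (tp (qpr V X e L l) * ((pr W L 0 - Y) * tp (pr W (l - 1) 0)))"
    unfolding 1 by (subst 2, subst 3) (simp only: distrib_left mult_scaleR_right add.assoc)
  then show ?thesis
    by (simp add: hgrad_def mult.assoc scaleR_right_distrib) (simp add: W_def scaleR_right_distrib algebra_simps)
qed

locale supported_sequence =
  fixes L :: nat and d :: "nat \<Rightarrow> nat" and U :: "nat \<Rightarrow> nat \<Rightarrow> rmat" and V :: "nat \<Rightarrow> rmat"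
  assumes U_left: "\<And>n l. 1 \<le> l \<Longrightarrow> l \<le> L \<Longrightarrow> proj (d l) * U n l = U n l"
    and U_right: "\<And>n l. 1 \<le> l \<Longrightarrow> l \<le> L \<Longrightarrow> U n l * proj (d (l - 1)) = U n l"
    and U_conv: "\<And>l. 1 \<le> l \<Longrightarrow> l \<le> L \<Longrightarrow> mconv (\<lambda>n. U n l) (V l)"
begin

lemma mconv_pr: "l \<le> L \<Longrightarrow> mconv (\<lambda>n. pr (U n) l k) (pr V l k)"
proof (induction l)
  case (Suc l)
  then show ?case
    using mconv_mult_left[OF U_conv[of "Suc l"] _ U_right[of "Suc l"], of "\<lambda>n. pr (U n) l k" "pr V l k"]
    by (auto simp: mconv_const)
qed (simp add: mconv_const)

lemma pr_left: "k < l \<Longrightarrow> l \<le> L \<Longrightarrow> proj (d l) * pr (U n) l k = pr (U n) l k"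
  using U_left[of l n] by (cases l) (simp_all flip: mult.assoc)

lemma pr_right: "k < l \<Longrightarrow> l \<le> L \<Longrightarrow> pr (U n) l k * proj (d k) = pr (U n) l k"
  using U_right[of "Suc k" n] by (simp add: pr_low mult.assoc)

lemma mconv_hgrad:
  assumes l: "1 \<le> l" "l \<le> L" and Y: "proj (d L) * Y = Y" "Y * proj (d 0) = Y"
  shows "mconv (\<lambda>n. hgrad lam Y L (U n) l) (hgrad lam Y L V l)"
proof -
  have P: "proj (d L) * (pr (U n) L 0 - Y) = pr (U n) L 0 - Y" "(pr (U n) L 0 - Y) * proj (d 0) = pr (U n) L 0 - Y" for n
    using l Y by (simp_all add: left_diff_distrib right_diff_distrib pr_left pr_right)
  have 1: "mconv (\<lambda>n. tp (pr (U n) L l) * (pr (U n) L 0 - Y)) (tp (pr V L l) * (pr V L 0 - Y))"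
    by (rule mconv_mult_right[OF _ _ P(1)]) (auto intro!: mconv_tp mconv_diff mconv_pr mconv_const)
  have "mconv (\<lambda>n. tp (pr (U n) L l) * (pr (U n) L 0 - Y) * tp (pr (U n) (l - 1) 0))
      (tp (pr V L l) * (pr V L 0 - Y) * tp (pr V (l - 1) 0))"
    by (rule mconv_mult_left[OF 1, where N = "d 0"]) (use l in \<open>auto simp: mult.assoc P intro!: mconv_tp mconv_pr\<close>)
  then show ?thesis
    unfolding hgrad_def using l by (intro mconv_add mconv_scaleR tendsto_const U_conv)
qed

end

text \<open>As \<open>hgrad\<close> vanishes at \<open>U n\<close>, the scaled gradient is exactly
  the quotient of \<open>hgrad_add\<close>. All its mixed factors converge to those at V and X,
  which gives the linearised equation in the limit.\<close>

lemma dhgrad_limit: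
  assumes "supported_sequence L d U V" and "supported_sequence L d Z X"
    and e: "e \<longlonglongrightarrow> 0" "\<And>n. e n \<noteq> 0"
    and l: "1 \<le> l" "l \<le> L" and Y: "proj (d L) * Y = Y" "Y * proj (d 0) = Y"
    and crit: "\<And>n. hgrad lam Y L (U n) l = 0"
    and lim: "mconv (\<lambda>n. (1 / e n) *\<^sub>R hgrad lam Y L (\<lambda>j. U n j + e n *\<^sub>R Z n j) l) 0"
  shows "dhgrad lam Y L V X l = 0"
proof -
  interpret U: supported_sequence L d U V by fact
  interpret Z: supported_sequence L d Z X by fact
  define W where "W n = (\<lambda>j. U n j + e n *\<^sub>R Z n j)" for n
  interpret W: supported_sequence L d W V
  proof
    fix l assume l: "1 \<le> l" "l \<le> L"
    show "proj (d l) * W n l = W n l" "W n l * proj (d (l - 1)) = W n l" for n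
      using l U.U_left Z.U_left U.U_right Z.U_right by (simp_all add: W_def distrib_left distrib_right)
    have "mconv (\<lambda>n. W n l) (V l + 0 *\<^sub>R X l)"
      unfolding W_def by (intro mconv_add mconv_scaleR e U.U_conv Z.U_conv l)
    then show "mconv (\<lambda>n. W n l) (V l)" by simp
  qed
  have q: "mconv (\<lambda>n. qpr (U n) (Z n) (e n) j k) (dpr V X j k)" if "j \<le> L" for j k
    using that
  proof (induction j)
    case (Suc j)
    show ?case
    proof (cases "k \<le> j")
      case True
      have "mconv (\<lambda>n. Z n (Suc j) * pr (W n) j k) (X (Suc j) * pr V j k)"
        by (rule mconv_mult_left[OF Z.U_conv W.mconv_pr Z.U_right]) (use Suc in auto)
      moreover have "mconv (\<lambda>n. U n (Suc j) * qpr (U n) (Z n) (e n) j k) (V (Suc j) * dpr V X j k)"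
        by (rule mconv_mult_left[OF U.U_conv _ U.U_right]) (use Suc in auto)
      ultimately show ?thesis using True by (auto simp: W_def intro!: mconv_add)
    qed (simp add: mconv_const)
  qed (simp add: mconv_const)
  have ql: "proj (d j) * qpr (U n) (Z n) (e n) j 0 = qpr (U n) (Z n) (e n) j 0" if "1 \<le> j" "j \<le> L" for j n
    using that Z.U_left[of j n] U.U_left[of j n] by (cases j) (simp_all add: distrib_left flip: mult.assoc)
  have qr: "qpr (U n) (Z n) (e n) j 0 * proj (d 0) = qpr (U n) (Z n) (e n) j 0" if "j \<le> L" for j n
    using that
  proof (induction j)
    case (Suc j)
    have "Z n (Suc j) * pr (W n) j 0 * proj (d 0) = Z n (Suc j) * pr (W n) j 0"
    proof (cases "j = 0")
      case True
      then show ?thesis using Z.U_right[of 1 n] Suc.prems by simp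
    qed (use W.pr_right[of 0 j n] Suc.prems in \<open>simp add: mult.assoc\<close>)
    then show ?case using Suc by (simp add: W_def distrib_right mult.assoc)
  qed simp
  have P: "proj (d L) * (pr (W n) L 0 - Y) = pr (W n) L 0 - Y" "(pr (W n) L 0 - Y) * proj (d 0) = pr (W n) L 0 - Y"
    "proj (d L) * (pr (U n) L 0 - Y) = pr (U n) L 0 - Y" "(pr (U n) L 0 - Y) * proj (d 0) = pr (U n) L 0 - Y" for n
    using l Y by (simp_all add: left_diff_distrib right_diff_distrib W.pr_left W.pr_right U.pr_left U.pr_right)
  have prod3: "mconv (\<lambda>n. a n * (b n * c n)) (A * (B * C))"
    if "mconv a A" "mconv b B" "mconv c C" "\<And>n. proj (d L) * b n = b n" "\<And>n. b n * proj (d 0) = b n" for a b c A B C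
    by (rule mconv_mult_right[OF that(1) mconv_mult_left[OF that(2,3,5)], where N = "d L"])
      (simp add: that(4) flip: mult.assoc)
  let ?q = "\<lambda>n. tp (qpr (U n) (Z n) (e n) L l) * ((pr (W n) L 0 - Y) * tp (pr (W n) (l - 1) 0))
     + tp (pr (U n) L l) * (qpr (U n) (Z n) (e n) L 0 * tp (pr (W n) (l - 1) 0))
     + tp (pr (U n) L l) * ((pr (U n) L 0 - Y) * tp (qpr (U n) (Z n) (e n) (l - 1) 0)) + lam l *\<^sub>R Z n l"
  have "mconv ?q (tp (dpr V X L l) * ((pr V L 0 - Y) * tp (pr V (l - 1) 0))
     + tp (pr V L l) * (dpr V X L 0 * tp (pr V (l - 1) 0))
     + tp (pr V L l) * ((pr V L 0 - Y) * tp (dpr V X (l - 1) 0)) + lam l *\<^sub>R X l)"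
    by (intro mconv_add prod3 mconv_tp q mconv_diff W.mconv_pr U.mconv_pr mconv_const mconv_scaleR tendsto_const
        Z.U_conv P ql qr) (use l in auto)
  moreover have "(1 / e n) *\<^sub>R hgrad lam Y L (\<lambda>j. U n j + e n *\<^sub>R Z n j) l = ?q n" for n
    using e(2)[of n] unfolding hgrad_add crit W_def by simp
  ultimately show ?thesis
    using lim mconv_unique by (simp add: dhgrad_def mult.assoc)
qed

subsection \<open>Limits of directions from nearest critical points\<close>

definition wedge :: "rmat \<Rightarrow> rmat \<Rightarrow> rmat" where "wedge a c = a * tp c - c * tp a"

lemma wedge_0 [simp]: "wedge 0 0 = 0" by (simp add: wedge_def)

lemma tp_wedge: "tp (wedge a c) = - wedge a c"
  by (simp add: wedge_def)

text \<open>For orthogonal a, c the matrix is a scaled quarter turn of their plane and zero on its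
  complement, so it qualifies as a generator for \<open>rot\<close> with k = |a|^2 |c|^2.\<close>

lemma wedge_cube:
  assumes "is_col a" "is_col c" "ip a c = 0"
  shows "wedge a c * (wedge a c * wedge a c) = - ((ip a a * ip c c) *\<^sub>R wedge a c)"
proof -
  have a: "wedge a c * a = - (ip a a *\<^sub>R c)"
    using assms ip_commute[of c a] by (simp add: wedge_def left_diff_distrib mult.assoc col_tp_mult)
  have c: "wedge a c * c = ip c c *\<^sub>R a"
    using assms by (simp add: wedge_def left_diff_distrib mult.assoc col_tp_mult)
  have "wedge a c * wedge a c = wedge a c * a * tp c - wedge a c * c * tp a"
    by (simp add: wedge_def[of a c] right_diff_distrib mult.assoc)
  also have "\<dots> = - (ip a a *\<^sub>R (c * tp c)) - ip c c *\<^sub>R (a * tp a)"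
    by (simp add: a c)
  finally have sq: "wedge a c * wedge a c = - (ip a a *\<^sub>R (c * tp c)) - ip c c *\<^sub>R (a * tp a)" .
  have "wedge a c * (wedge a c * wedge a c)
      = - (ip a a *\<^sub>R (wedge a c * c * tp c)) - ip c c *\<^sub>R (wedge a c * a * tp a)"
    unfolding sq by (simp add: right_diff_distrib mult.assoc)
  also have "\<dots> = - ((ip a a * ip c c) *\<^sub>R (a * tp c)) + (ip a a * ip c c) *\<^sub>R (c * tp a)"
    by (simp add: a c mult.commute)
  finally show ?thesis by (simp add: wedge_def scaleR_diff_right)
qed

lemma frobenius_outer:
  assumes "is_col a" "is_col u" and X: "proj m * X = X" "X * proj n = X"
  shows "(\<Sum>i<m. \<Sum>j<n. ent X i j * ent (a * tp u) i j) = ip a (X * u)"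
proof -
  have "ip a (X * u) = ip (X * u) a" by (rule ip_commute)
  also have "\<dots> = (\<Sum>i<m. ent (X * u) i 0 * ent a i 0)"
    by (rule ip_lessThan) (simp add: X flip: mult.assoc)
  also have "\<dots> = (\<Sum>i<m. \<Sum>j<n. ent X i j * ent (a * tp u) i j)"
    by (simp add: ent_times_proj_left[OF X(2)] ent_outer assms(1) sum_distrib_right sum_distrib_left mult_ac)
  finally show ?thesis ..
qed

context mf_problem
begin

text \<open>Supplies the hypotheses of \<open>kernel_direction\<close>. Orthogonality holds for the
  exact differences from \<open>W n\<close> to \<open>Vn n\<close>; it is linear in the difference,
  survives division by \<open>e n\<close>, and passes to the limit.\<close>

lemma limit_direction_zero:
  fixes Vn W :: "nat \<Rightarrow> nat \<Rightarrow> nat \<Rightarrow> nat \<Rightarrow> real" and e :: "nat \<Rightarrow> real" and V X :: "nat \<Rightarrow> rmat"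
  assumes Vn: "\<And>n. Vn n \<in> crit"
    and nearest: "\<And>n V'. V' \<in> crit \<Longrightarrow> wsq (W n) (Vn n) \<le> wsq (W n) V'"
    and e: "\<And>n. e n > 0" "e \<longlonglongrightarrow> 0"
    and V: "\<And>l. 1 \<le> l \<Longrightarrow> l \<le> L \<Longrightarrow> mconv (\<lambda>n. layers d (Vn n) l) (V l)"
    and X: "\<And>l. 1 \<le> l \<Longrightarrow> l \<le> L \<Longrightarrow>
      mconv (\<lambda>n. (1 / e n) *\<^sub>R (layers d (W n) l - layers d (Vn n) l)) (X l)"
    and grad: "\<And>l. 1 \<le> l \<Longrightarrow> l \<le> L \<Longrightarrow>
      mconv (\<lambda>n. (1 / e n) *\<^sub>R hgrad lam Ym L (layers d (W n)) l) 0"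
    and nondeg2: "\<And>u. L = 2 \<Longrightarrow> Ym * (tp Ym * u) = lprod lam 0 L *\<^sub>R u \<Longrightarrow> u = 0"
    and nondeg3: "\<And>a (s :: real). 3 \<le> L \<Longrightarrow> is_col a \<Longrightarrow> s > 0 \<Longrightarrow>
      tp Ym * (Ym * a) = (s ^ L / lprod lam 0 L * (1 + lprod lam 0 L / s ^ (L - 1))\<^sup>2) *\<^sub>R a \<Longrightarrow>
      lprod lam 0 L + L * s ^ (L - 1) = lprod lam 0 L * (real L - 1) \<Longrightarrow> a = 0"
    and l: "1 \<le> l" "l \<le> L"
  shows "X l = 0"
proof -
  define U where "U n l = layers d (Vn n) l" for n l
  define Z where "Z n l = (1 / e n) *\<^sub>R (layers d (W n) l - layers d (Vn n) l)" for n l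
  interpret U: supported_sequence L d U V
    by unfold_locales (use V in \<open>auto simp: U_def proj_layers[unfolded One_nat_def]\<close>)
  interpret Z: supported_sequence L d Z X
    by unfold_locales (use X in \<open>auto simp: Z_def proj_layers[unfolded One_nat_def] left_diff_distrib right_diff_distrib\<close>)
  have V_supp: "proj (d l) * V l = V l" "V l * proj (d (l - 1)) = V l" if "1 \<le> l" "l \<le> L" for l
    using mconv_closed[OF U.U_conv[OF that]] U.U_left[OF that] U.U_right[OF that] by auto
  have X_supp: "proj (d l) * X l = X l" "X l * proj (d (l - 1)) = X l" if "1 \<le> l" "l \<le> L" for l
    using mconv_closed[OF Z.U_conv[OF that]] Z.U_left[OF that] Z.U_right[OF that] by auto
  have crit0: "hgrad lam Ym L V l = 0" if l: "1 \<le> l" "l \<le> L" for l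
  proof -
    have "mconv (\<lambda>n. hgrad lam Ym L (U n) l) (hgrad lam Ym L V l)"
      by (rule U.mconv_hgrad) (use l in auto)
    moreover have "hgrad lam Ym L (U n) l = 0" for n
      using crit_layers[OF Vn l] by (simp add: U_def[abs_def])
    ultimately have "mconv (\<lambda>n. 0) (hgrad lam Ym L V l)" by simp
    from mconv_unique[OF mconv_const this] show ?thesis by simp
  qed
  have lin0: "dhgrad lam Ym L V X l = 0" if l: "1 \<le> l" "l \<le> L" for l
  proof (rule dhgrad_limit[OF U.supported_sequence_axioms Z.supported_sequence_axioms e(2) _ l])
    show "e n \<noteq> 0" for n using e(1)[of n] by simp
    show "hgrad lam Ym L (U n) l = 0" for n
      using crit_layers[OF Vn l] by (simp add: U_def[abs_def])
    have "(\<lambda>j. U n j + e n *\<^sub>R Z n j) = layers d (W n)" for n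
      using e(1)[of n] by (auto simp: U_def Z_def)
    then show "mconv (\<lambda>n. (1 / e n) *\<^sub>R hgrad lam Ym L (\<lambda>j. U n j + e n *\<^sub>R Z n j) l) 0"
      using grad[OF l] by simp
  qed auto
  \<comment> \<open>Each layer is given a plane rotation or none; all nontrivial ones share the same
    k. The orthogonality relation is then expanded into inner products.\<close>
  have orth: "(\<Sum>l=1..L. lam l * (ip (a l) (X l * (tp (V l) * c l)) - ip (c l) (X l * (tp (V l) * a l))
        - ip (V l * a (l - 1)) (X l * c (l - 1)) + ip (V l * c (l - 1)) (X l * a (l - 1)))) = 0"
    if col: "\<And>l. is_col (a l)" "\<And>l. is_col (c l)" and perp: "\<And>l. ip (a l) (c l) = 0"
      and k: "k \<ge> 0" "\<And>l. a l = 0 \<and> c l = 0 \<or> ip (a l) (a l) * ip (c l) (c l) = k"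
      and supp: "\<And>l. proj (d l) * a l = a l" "\<And>l. proj (d l) * c l = c l"
      and AY: "wedge (a L) (c L) * Ym = Ym * wedge (a 0) (c 0)"
    for a c k
  proof -
    let ?A = "\<lambda>l. wedge (a l) (c l)"
    have suppA: "proj (d l) * ?A l = ?A l" "?A l * proj (d l) = ?A l" for l
    proof -
      show *: "proj (d l) * ?A l = ?A l"
        using supp[of l] by (simp add: wedge_def right_diff_distrib flip: mult.assoc)
      show "?A l * proj (d l) = ?A l"
        using arg_cong[OF *, of tp] by (simp add: tp_wedge)
    qed
    have cube: "?A l * (?A l * ?A l) = - (k *\<^sub>R ?A l)" for l
      using k(2)[of l] wedge_cube[OF col(1) col(2) perp, of l] by auto
    have *: "(\<Sum>l=1..L. lam l * (\<Sum>i<d l. \<Sum>j<d (l - 1). ent (Z n l) i j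
       * ent (?A l * U n l - U n l * ?A (l - 1)) i j)) = 0" for n
    proof -
      have "(\<Sum>l=1..L. lam l * (\<Sum>i<d l. \<Sum>j<d (l - 1). (W n l i j - Vn n l i j)
         * ent (?A l * layers d (Vn n) l - layers d (Vn n) l * ?A (l - 1)) i j)) = 0"
        by (rule nearest_orthogonal[where k = k, OF Vn nearest tp_wedge cube k(1) suppA(1) AY])
      then have "0 = (1 / e n) * (\<Sum>l=1..L. lam l * (\<Sum>i<d l. \<Sum>j<d (l - 1). (W n l i j - Vn n l i j)
         * ent (?A l * layers d (Vn n) l - layers d (Vn n) l * ?A (l - 1)) i j))" by simp
      also have "\<dots> = (\<Sum>l=1..L. lam l * (\<Sum>i<d l. \<Sum>j<d (l - 1). ((1 / e n) * (W n l i j - Vn n l i j))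
         * ent (?A l * layers d (Vn n) l - layers d (Vn n) l * ?A (l - 1)) i j))"
        by (simp only: sum_distrib_left mult_ac)
      also have "\<dots> = (\<Sum>l=1..L. lam l * (\<Sum>i<d l. \<Sum>j<d (l - 1). ent (Z n l) i j
         * ent (?A l * U n l - U n l * ?A (l - 1)) i j))"
        by (intro sum.cong refl arg_cong2[of _ _ _ _ "(*)"]) (auto simp: Z_def U_def ent_layers)
      finally show ?thesis ..
    qed
    have "(\<lambda>n. \<Sum>l=1..L. lam l * (\<Sum>i<d l. \<Sum>j<d (l - 1). ent (Z n l) i j
         * ent (?A l * U n l - U n l * ?A (l - 1)) i j))
       \<longlonglongrightarrow> (\<Sum>l=1..L. lam l * (\<Sum>i<d l. \<Sum>j<d (l - 1). ent (X l) i j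
         * ent (?A l * V l - V l * ?A (l - 1)) i j))"
    proof (intro tendsto_sum tendsto_mult tendsto_const mconvD)
      fix l assume l: "l \<in> {1..L}"
      show "mconv (\<lambda>n. Z n l) (X l)" using l by (auto intro: Z.U_conv)
      show "mconv (\<lambda>n. ?A l * U n l - U n l * ?A (l - 1)) (?A l * V l - V l * ?A (l - 1))"
        by (intro mconv_diff mconv_mult_left[OF mconv_const _ suppA(2)]
          mconv_mult_right[OF _ mconv_const suppA(1)] U.U_conv) (use l in auto)
    qed
    then have "(\<Sum>l=1..L. lam l * (\<Sum>i<d l. \<Sum>j<d (l - 1). ent (X l) i j
         * ent (?A l * V l - V l * ?A (l - 1)) i j)) = 0"
      unfolding * by (simp add: LIMSEQ_const_iff)
    also have "(\<Sum>l=1..L. lam l * (\<Sum>i<d l. \<Sum>j<d (l - 1). ent (X l) i j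
         * ent (?A l * V l - V l * ?A (l - 1)) i j))
      = (\<Sum>l=1..L. lam l * (ip (a l) (X l * (tp (V l) * c l)) - ip (c l) (X l * (tp (V l) * a l))
        - ip (V l * a (l - 1)) (X l * c (l - 1)) + ip (V l * c (l - 1)) (X l * a (l - 1))))"
    proof (rule sum.cong[OF refl])
      fix l assume l: "l \<in> {1..L}"
      then have Xl: "proj (d l) * X l = X l" "X l * proj (d (l - 1)) = X l" using X_supp by auto
      have eq: "?A l * V l - V l * ?A (l - 1) = a l * tp (tp (V l) * c l) - c l * tp (tp (V l) * a l)
          - (V l * a (l - 1)) * tp (c (l - 1)) + (V l * c (l - 1)) * tp (a (l - 1))"
        by (simp add: wedge_def left_diff_distrib right_diff_distrib mult.assoc)
      show "lam l * (\<Sum>i<d l. \<Sum>j<d (l - 1). ent (X l) i j * ent (?A l * V l - V l * ?A (l - 1)) i j)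
        = lam l * (ip (a l) (X l * (tp (V l) * c l)) - ip (c l) (X l * (tp (V l) * a l))
        - ip (V l * a (l - 1)) (X l * c (l - 1)) + ip (V l * c (l - 1)) (X l * a (l - 1)))"
        unfolding eq ent_plus ent_minus distrib_left right_diff_distrib sum.distrib sum_subtractf
        by (subst frobenius_outer[OF _ _ Xl], (intro is_col_mult col)+)+ simp
    qed
    finally show ?thesis .
  qed
  interpret kernel_direction L lam d Ym V X
  proof
    show "2 \<le> L" by (rule L2)
    show "lam l > 0" if "1 \<le> l" "l \<le> L" for l using lampos that .
    show "tp (lam m *\<^sub>R (X m * tp (V m)) - lam (Suc m) *\<^sub>R (tp (V (Suc m)) * X (Suc m)))
        = lam m *\<^sub>R (X m * tp (V m)) - lam (Suc m) *\<^sub>R (tp (V (Suc m)) * X (Suc m))"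
      if m: "1 \<le> m" "m < L" for m
    proof -
      let ?K = "lam m *\<^sub>R (X m * tp (V m)) - lam (Suc m) *\<^sub>R (tp (V (Suc m)) * X (Suc m))"
      have K: "proj (d m) * ?K = ?K" "?K * proj (d m) = ?K"
      proof -
        have "proj (d m) * X m = X m" "V m = proj (d m) * V m"
          "X (Suc m) = X (Suc m) * proj (d m)" "V (Suc m) * proj (d m) = V (Suc m)"
          using m V_supp[of m] X_supp[of m] V_supp[of "Suc m"] X_supp[of "Suc m"] by simp_all
        then have "proj (d m) * X m = X m" "tp (V m) * proj (d m) = tp (V m)"
          "X (Suc m) * proj (d m) = X (Suc m)" "proj (d m) * tp (V (Suc m)) = tp (V (Suc m))"
          by (metis tp_proj tp_times)+
        then show "proj (d m) * ?K = ?K" "?K * proj (d m) = ?K"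
          by (simp_all add: left_diff_distrib right_diff_distrib mult.assoc flip: mult.assoc[of "proj (d m)"])
      qed
      have "ent ?K i j = ent ?K j i" if ij: "i < d m" "j < d m" "i \<noteq> j" for i j
      proof -
        \<comment> \<open>A generator in the hidden space m alone, in the coordinate plane of i and
          j: it extracts the (i,j) entry of the antisymmetric part of \<open>?K\<close>.\<close>
        let ?a = "\<lambda>l. if l = m then unit_col i else 0" and ?c = "\<lambda>l. if l = m then unit_col j else 0"
        let ?f = "\<lambda>l. lam l * (ip (?a l) (X l * (tp (V l) * ?c l)) - ip (?c l) (X l * (tp (V l) * ?a l))
          - ip (V l * ?a (l - 1)) (X l * ?c (l - 1)) + ip (V l * ?c (l - 1)) (X l * ?a (l - 1)))"
        have unit: "ip (unit_col i) (unit_col j) = (if i = j then 1 else 0)" for i j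
          using ip_unit_col[of i 1 j] by (simp add: ent_one)
        have "(\<Sum>l=1..L. ?f l) = 0"
        proof (rule orth[where k = 1])
          show "is_col (?a l)" "is_col (?c l)" for l by (simp_all add: is_col_unit_col) (simp_all add: is_col_def)
          show "ip (?a l) (?c l) = 0" for l using ij by (simp add: unit)
          show "?a l = 0 \<and> ?c l = 0 \<or> ip (?a l) (?a l) * ip (?c l) (?c l) = 1" for l by (simp add: unit)
          show "proj (d l) * ?a l = ?a l" "proj (d l) * ?c l = ?c l" for l
            using ij by (auto simp: proj_mult_iff unit_col.rep_eq)
          show "wedge (?a L) (?c L) * Ym = Ym * wedge (?a 0) (?c 0)" using m by simp
        qed simp
        moreover have "(\<Sum>l=1..L. ?f l) = (\<Sum>l\<in>{m, Suc m}. ?f l)"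
          by (rule sum.mono_neutral_right) (use m in auto)
        ultimately have "?f m + ?f (Suc m) = 0" by simp
        moreover have "?f m = lam m * (ent (X m * tp (V m)) i j - ent (X m * tp (V m)) j i)"
        proof -
          have "m - 1 \<noteq> m" using m by simp
          then show ?thesis by (simp add: ip_unit_col flip: mult.assoc)
        qed
        moreover have "?f (Suc m) = lam (Suc m) * (ent (tp (V (Suc m)) * X (Suc m)) j i - ent (tp (V (Suc m)) * X (Suc m)) i j)"
          using m by (simp add: ip_left ip_unit_col flip: mult.assoc)
        ultimately show ?thesis by (simp add: algebra_simps)
      qed
      then show ?thesis
        using K unfolding proj_mult_iff mult_proj_iff
        by (intro rmat_eqI) (metis (no_types, lifting) ent_tp linorder_not_less)
    qed
    show "lam L * (ip a' (X L * (tp (V L) * w)) - ip w (X L * (tp (V L) * a')))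
        = lam 1 * (ip a (tp (V 1) * (X 1 * x)) - ip x (tp (V 1) * (X 1 * a)))"
      if h: "is_col a" "is_col x" "is_col a'" "is_col w" "proj (d 0) * a = a" "proj (d 0) * x = x"
        "proj (d L) * a' = a'" "proj (d L) * w = w" "ip a x = 0" "ip a' w = 0"
        "ip a a * ip x x = ip a' a' * ip w w"
        "(a' * tp w - w * tp a') * Ym = Ym * (a * tp x - x * tp a)" for a x a' w
    proof -
      \<comment> \<open>Generators only at the input and output ends. As L >= 2, these are distinct
        layers, and only the summands for l = 1 and l = L survive.\<close>
      let ?a = "\<lambda>l. if l = 0 then a else if l = L then a' else 0"
        and ?c = "\<lambda>l. if l = 0 then x else if l = L then w else 0"
      let ?f = "\<lambda>l. lam l * (ip (?a l) (X l * (tp (V l) * ?c l)) - ip (?c l) (X l * (tp (V l) * ?a l))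
          - ip (V l * ?a (l - 1)) (X l * ?c (l - 1)) + ip (V l * ?c (l - 1)) (X l * ?a (l - 1)))"
      have "(\<Sum>l=1..L. ?f l) = 0"
      proof (rule orth[where k = "ip a a * ip x x"])
        show "is_col (?a l)" "is_col (?c l)" for l using h by (auto simp: is_col_def)
        show "wedge (?a L) (?c L) * Ym = Ym * wedge (?a 0) (?c 0)"
          using h L2 by (simp add: wedge_def)
      qed (use h L2 in \<open>auto simp: ip_ge_0\<close>)
      moreover have "(\<Sum>l=1..L. ?f l) = (\<Sum>l\<in>{1, L}. ?f l)"
        by (rule sum.mono_neutral_right) (use L2 in auto)
      ultimately have "?f 1 + ?f L = 0" using L2 by simp
      moreover have "L - 1 \<noteq> L" "L \<noteq> 1" "L \<noteq> 0" "L - 1 \<noteq> 0" using L2 by auto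
      ultimately show ?thesis by (simp add: ip_left algebra_simps)
    qed
  qed (use V_supp X_supp crit0 lin0 nondeg2 nondeg3 in auto)
  show ?thesis by (rule X_eq_0[OF l])
qed

end

subsection \<open>Compactness of the critical set\<close>

lemma lprod_0: "lprod lam 0 L = (\<Prod>l=1..L. lam l)"
  unfolding lprod_def by (intro prod.cong) auto

text \<open>M may have several columns; any column with a nonzero entry is an eigenvector. Since
  \<sigma> > 0, the equation itself forces M to be supported in the first n rows.\<close>

lemma pos_singular_valueI:
  assumes eq: "tp (matof m n Y) * (matof m n Y * M) = \<sigma>\<^sup>2 *\<^sub>R M" and "\<sigma> > 0" "M \<noteq> 0"
  shows "pos_singular_value m n Y \<sigma>"
proof -
  let ?Y = "matof m n Y"
  have pY: "proj n * tp ?Y = tp ?Y" by (metis proj_matof(2) tp_proj tp_times)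
  then have "proj n * (\<sigma>\<^sup>2 *\<^sub>R M) = \<sigma>\<^sup>2 *\<^sub>R M" unfolding eq[symmetric] by (simp flip: mult.assoc)
  then have M: "proj n * M = M" using \<open>\<sigma> > 0\<close> by simp
  obtain i b where ib: "ent M i b \<noteq> 0" using \<open>M \<noteq> 0\<close> rmat_eqI[of M 0] by auto
  have i: "i < n" using M ib unfolding proj_mult_iff by (meson not_less)
  have "(\<Sum>j<n. (\<Sum>i<m. Y i k * Y i j) * ent M j b) = \<sigma>\<^sup>2 * ent M k b" if k: "k < n" for k
  proof -
    have "\<sigma>\<^sup>2 * ent M k b = ent (tp ?Y * ?Y * M) k b" using eq by (simp add: mult.assoc)
    also have "\<dots> = (\<Sum>j<n. ent (tp ?Y * ?Y) k j * ent M j b)" by (rule ent_times_proj_right[OF M])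
    also have "\<dots> = (\<Sum>j<n. (\<Sum>i<m. Y i k * Y i j) * ent M j b)"
      using k by (intro sum.cong refl) (simp add: ent_times_proj_right[of m ?Y] ent_matof)
    finally show ?thesis ..
  qed
  then show ?thesis
    unfolding pos_singular_value_def using ib i \<open>\<sigma> > 0\<close> by (intro conjI exI[of _ "\<lambda>j. ent M j b"]) auto
qed

text \<open>Put \<rho> = (L - 2)/L and h = L/(2(L - 1)). The hypothesis says s^(L-1) = \<Lambda>
  \<rho>, and the bracket equals \<rho>^h (1 + 1/\<rho>). Its power 2(L - 1) is \<rho>^L (1 +
  1/\<rho>)^(2(L-1)), which is \<sigma>^(2(L-1)) / \<Lambda>.\<close>

lemma threshold_eq:
  fixes s \<Lambda> :: real
  assumes L: "L \<ge> 3" and pos: "s > 0" "\<Lambda> > 0" and eq: "\<Lambda> + L * s ^ (L - 1) = \<Lambda> * (real L - 1)"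
  defines "\<sigma> \<equiv> sqrt (s ^ L / \<Lambda>) * (1 + \<Lambda> / s ^ (L - 1))"
  shows "\<Lambda> = \<sigma> ^ (2 * (L - 1)) *
           ((real (L - 2) / real L) powr (real L / (2 * (real L - 1)))
            + (real L / real (L - 2)) powr ((real L - 2) / (2 * (real L - 1))))
           powr (- (2 * (real L - 1)))"
proof -
  define \<rho> where "\<rho> = real (L - 2) / real L"
  define p where "p = s ^ (L - 1)"
  define h where "h = real L / (2 * (real L - 1))"
  define c where "c = 1 + 1 / \<rho>"
  have \<rho>: "\<rho> > 0" "\<rho> = (real L - 2) / real L" "real L / real (L - 2) = 1 / \<rho>"
    using L by (auto simp: \<rho>_def of_nat_diff)
  have L1: "real L - 1 > 0" "2 * (real L - 1) = real (2 * (L - 1))" using L by (auto simp: of_nat_diff)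
  have p: "p > 0" "p = \<Lambda> * \<rho>" using pos eq L by (auto simp: p_def \<rho>(2) field_simps)
  have c: "c > 0" "1 + \<Lambda> / p = c" unfolding c_def p(2) using \<rho>(1) pos by (simp_all add: add_pos_pos)
  have h1: "(real L - 2) / (2 * (real L - 1)) = 1 - h"
    using L1 by (simp add: h_def field_simps)
  have "(real L / real (L - 2)) powr ((real L - 2) / (2 * (real L - 1))) = \<rho> powr (h - 1)"
    unfolding \<rho>(3) h1 using \<rho>(1) by (simp add: powr_minus powr_divide inverse_eq_divide powr_diff)
  also have "\<dots> = \<rho> powr h * (1 / \<rho>)"
    using \<rho>(1) by (simp add: powr_diff)
  finally have pw: "(real L / real (L - 2)) powr ((real L - 2) / (2 * (real L - 1))) = \<rho> powr h * (1 / \<rho>)" .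
  have br: "(real (L - 2) / real L) powr (real L / (2 * (real L - 1)))
      + (real L / real (L - 2)) powr ((real L - 2) / (2 * (real L - 1))) = \<rho> powr h * c" (is "?B = _")
    unfolding pw c_def \<rho>_def[symmetric] h_def[symmetric] by (simp add: distrib_left)
  define B where "B = ?B"
  define x where "x = 2 * (real L - 1)"
  have "(\<rho> powr h * c) powr (2 * (real L - 1)) = \<rho> powr (h * (2 * (real L - 1))) * c powr (2 * (real L - 1))"
    using \<rho>(1) c by (simp add: powr_mult powr_powr)
  also have "h * (2 * (real L - 1)) = real L" using L1 by (simp add: h_def)
  also have "\<rho> powr real L * c powr (2 * (real L - 1)) = \<rho> ^ L * c ^ (2 * (L - 1))"
    using \<rho>(1) c(1) unfolding L1(2) by (simp only: powr_realpow)
  finally have B: "B powr x = \<rho> ^ L * c ^ (2 * (L - 1))" unfolding br B_def x_def .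
  have "\<sigma> ^ (2 * (L - 1)) = ((sqrt (s ^ L / \<Lambda>))\<^sup>2) ^ (L - 1) * c ^ (2 * (L - 1))"
    unfolding \<sigma>_def c(2)[unfolded p_def] by (simp add: power_mult_distrib flip: power_mult)
  also have "(sqrt (s ^ L / \<Lambda>))\<^sup>2 = s ^ L / \<Lambda>" using pos by simp
  also have "(s ^ L / \<Lambda>) ^ (L - 1) = p ^ L / \<Lambda> ^ (L - 1)"
    by (simp add: power_divide p_def mult.commute flip: power_mult)
  also have "\<dots> = \<Lambda> * \<rho> ^ L"
  proof -
    have "\<Lambda> ^ L = \<Lambda> * \<Lambda> ^ (L - 1)" using L by (simp flip: power_Suc)
    then show ?thesis using pos by (simp add: p(2) power_mult_distrib)
  qed
  finally have "\<sigma> ^ (2 * (L - 1)) = \<Lambda> * B powr x" unfolding B by simp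
  moreover have "B powr x * B powr (- x) = 1"
  proof -
    have "B > 0" unfolding B_def br using \<rho>(1) c(1) by simp
    then show ?thesis by (simp add: powr_minus)
  qed
  ultimately have "\<sigma> ^ (2 * (L - 1)) * B powr (- x) = \<Lambda>" by simp
  then show ?thesis unfolding B_def x_def ..
qed

text \<open>One subsequence serves all entries at once, by sequential compactness of a product of
  intervals.\<close>

lemma bounded_subsequence:
  fixes f :: "nat \<Rightarrow> nat \<Rightarrow> nat \<Rightarrow> nat \<Rightarrow> real"
  assumes "\<And>n l i j. \<bar>f n l i j\<bar> \<le> b"
  obtains g r where "strict_mono (r :: nat \<Rightarrow> nat)" "\<And>l i j. (\<lambda>n. f (r n) l i j) \<longlonglongrightarrow> g l i j"
proof -
  let ?K = "{f :: nat \<Rightarrow> nat \<Rightarrow> nat \<Rightarrow> real. \<forall>l. f l \<in> {g. \<forall>i. g i \<in> {h. \<forall>j. h j \<in> {-b..b}}}}"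
  have "compact ?K" by (intro compact_box_fun) simp
  then have "seq_compact ?K" by (rule compact_imp_seq_compact)
  moreover have "\<forall>n. f n \<in> ?K" using assms by (auto simp: abs_le_iff) (metis minus_le_iff)
  ultimately obtain g r where r: "strict_mono (r :: nat \<Rightarrow> nat)" and lim: "(f \<circ> r) \<longlonglongrightarrow> g"
    unfolding seq_compact_def by blast
  have coord: "(\<lambda>n. F n x) \<longlonglongrightarrow> G x" if "F \<longlonglongrightarrow> G" for F :: "nat \<Rightarrow> nat \<Rightarrow> 'b :: topological_space" and G x
    using continuous_on_tendsto_compose[OF continuous_on_product_coordinates that] by simp
  have "(\<lambda>n. f (r n) l i j) \<longlonglongrightarrow> g l i j" for l i j
    using coord[OF coord[OF coord[OF lim]]] by simp
  with r show thesis by (rule that)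
qed

lemma ent_tp_mult_self: "proj m * A = A \<Longrightarrow> ent (tp A * A) j j = (\<Sum>i<m. (ent A i j)\<^sup>2)"
  by (simp add: ent_times_proj_right power2_eq_square)

lemma ent_mult_tp_self: "A * proj n = A \<Longrightarrow> ent (A * tp A) i i = (\<Sum>j<n. (ent A i j)\<^sup>2)"
  by (simp add: ent_times_proj_left power2_eq_square)

lemma entry_le_double_sum:
  fixes A :: "nat \<Rightarrow> nat \<Rightarrow> real"
  assumes "i < m" "j < n"
  shows "(A i j)\<^sup>2 \<le> (\<Sum>i<m. \<Sum>j<n. (A i j)\<^sup>2)"
proof -
  have "(A i j)\<^sup>2 \<le> (\<Sum>j<n. (A i j)\<^sup>2)"
    by (rule member_le_sum[where f = "\<lambda>j. (A i j)\<^sup>2"]) (use assms in auto)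
  also have "\<dots> \<le> (\<Sum>i<m. \<Sum>j<n. (A i j)\<^sup>2)"
    by (rule member_le_sum[where f = "\<lambda>i. \<Sum>j<n. (A i j)\<^sup>2"]) (use assms in \<open>auto intro: sum_nonneg\<close>)
  finally show ?thesis .
qed

context mf_problem
begin

text \<open>Balance gives all \<lambda>_l |V_l|^2 the same value. For l = 1 it equals the inner
  product of P and Y - P, with P the full product, which is at most |Y|^2 / 4.\<close>

lemma crit_bound:
  assumes V: "V \<in> crit" and l: "1 \<le> l" "l \<le> L"
  shows "lam l * (\<Sum>i<d l. \<Sum>j<d (l - 1). (V l i j)\<^sup>2) \<le> (\<Sum>j<d 0. \<Sum>i<d L. (ent Ym i j)\<^sup>2 / 4)"
  using l
proof (induction l rule: dec_induct)
  case base
  let ?V = "layers d V"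
  let ?P = "pr ?V L 0"
  have P: "?P = pr ?V L 1 * ?V 1" using L2 by (simp add: pr_low)
  have pP: "proj (d L) * ?P = ?P" using L2 by (simp add: proj_pr)
  have "tp (?V 1) * hgrad lam Ym L ?V 1 = 0" using crit_layers[OF V, of 1] L2 by simp
  moreover have "tp ?P = tp (?V 1) * tp (pr ?V L 1)" by (simp add: P)
  ultimately have "lam 1 *\<^sub>R (tp (?V 1) * ?V 1) = tp ?P * (Ym - ?P)"
    by (simp add: hgrad_def distrib_left right_diff_distrib mult.assoc algebra_simps)
  then have base_eq: "lam 1 * ent (tp (?V 1) * ?V 1) j j = ent (tp ?P * (Ym - ?P)) j j" for j
    by (metis ent_scaleR)
  have rhs: "ent (tp ?P * (Ym - ?P)) j j = (\<Sum>i<d L. ent ?P i j * (ent Ym i j - ent ?P i j))" for j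
    by (subst ent_times_proj_right[of "d L"]) (simp_all add: pP right_diff_distrib)
  have eq: "lam 1 * (\<Sum>i<d 1. (ent (?V 1) i j)\<^sup>2) = (\<Sum>i<d L. ent ?P i j * (ent Ym i j - ent ?P i j))" for j
    using base_eq[of j] unfolding rhs ent_tp_mult_self[of "d 1" "layers d V 1" j, OF proj_layers(1)] .
  have "lam 1 * (\<Sum>i<d 1. \<Sum>j<d (1 - 1). (V 1 i j)\<^sup>2) = (\<Sum>j<d 0. lam 1 * (\<Sum>i<d 1. (ent (?V 1) i j)\<^sup>2))"
    by (subst sum.swap) (simp add: sum_distrib_left ent_layers)
  also have "\<dots> \<le> (\<Sum>j<d 0. \<Sum>i<d L. (ent Ym i j)\<^sup>2 / 4)"
    unfolding eq
  proof (intro sum_mono)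
    fix i j
    \<comment> \<open>Completing the square: p (y - p) = y^2/4 - (p - y/2)^2.\<close>
    have "0 \<le> (ent ?P i j - ent Ym i j / 2)\<^sup>2" by simp
    then show "ent ?P i j * (ent Ym i j - ent ?P i j) \<le> (ent Ym i j)\<^sup>2 / 4"
      by (simp add: power2_eq_square algebra_simps)
  qed
  finally show ?case .
next
  case (step l)
  let ?V = "layers d V"
  have "lam (Suc l) *\<^sub>R (tp (?V (Suc l)) * ?V (Suc l)) = lam l *\<^sub>R (?V l * tp (?V l))"
    using hgrad_balance[of l L ?V lam Ym] crit_layers[OF V] step by simp
  then have step_eq: "lam (Suc l) * ent (tp (?V (Suc l)) * ?V (Suc l)) j j = lam l * ent (?V l * tp (?V l)) j j" for j
    by (metis ent_scaleR)
  have eq: "lam (Suc l) * (\<Sum>i<d (Suc l). (ent (?V (Suc l)) i j)\<^sup>2) = lam l * (\<Sum>i<d (l - 1). (ent (?V l) j i)\<^sup>2)" for j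
    using step_eq[of j] unfolding ent_tp_mult_self[of "d (Suc l)" "layers d V (Suc l)" j, OF proj_layers(1)]
      ent_mult_tp_self[of "layers d V l" "d (l - 1)" j, OF proj_layers(2)] .
  have "lam (Suc l) * (\<Sum>i<d (Suc l). \<Sum>j<d (Suc l - 1). (V (Suc l) i j)\<^sup>2)
      = (\<Sum>j<d l. lam (Suc l) * (\<Sum>i<d (Suc l). (ent (?V (Suc l)) i j)\<^sup>2))"
    by (subst sum.swap) (simp add: sum_distrib_left ent_layers)
  also have "\<dots> = lam l * (\<Sum>i<d l. \<Sum>j<d (l - 1). (V l i j)\<^sup>2)"
    unfolding eq by (simp add: sum_distrib_left ent_layers)
  finally show ?case using step by simp
qed

lemma mconv_layers: "(\<And>l i j. (\<lambda>n. f n l i j) \<longlonglongrightarrow> g l i j) \<Longrightarrow> mconv (\<lambda>n. layers d (f n) l) (layers d g l)"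
  unfolding mconv_def
proof (intro allI)
  fix i j assume "\<And>l i j. (\<lambda>n. f n l i j) \<longlonglongrightarrow> g l i j"
  then show "(\<lambda>n. ent (layers d (f n) l) i j) \<longlonglongrightarrow> ent (layers d g l) i j"
    by (cases "i < d l"; cases "j < d (l - 1)") (simp_all add: ent_layers)
qed

lemma lam_lower: obtains c where "c > 0" "\<And>l. 1 \<le> l \<Longrightarrow> l \<le> L \<Longrightarrow> c \<le> lam l"
proof
  have fin: "finite (lam ` {1..L})" "lam ` {1..L} \<noteq> {}" using L2 by auto
  then have "Min (lam ` {1..L}) \<in> lam ` {1..L}" by (rule Min_in)
  then show "Min (lam ` {1..L}) > 0" using lampos by auto
  show "Min (lam ` {1..L}) \<le> lam l" if "1 \<le> l" "l \<le> L" for l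
    using fin that by (intro Min_le) auto
qed

lemma crit_compact:
  assumes V: "\<And>n. Vn n \<in> crit"
  obtains V r where "V \<in> crit" "strict_mono (r :: nat \<Rightarrow> nat)" "\<And>l i j. (\<lambda>n. Vn (r n) l i j) \<longlonglongrightarrow> V l i j"
proof -
  obtain c where c: "c > 0" "\<And>l. 1 \<le> l \<Longrightarrow> l \<le> L \<Longrightarrow> c \<le> lam l" using lam_lower by blast
  define K where "K = (\<Sum>j<d 0. \<Sum>i<d L. (ent Ym i j)\<^sup>2 / 4)"
  have K: "K \<ge> 0" unfolding K_def by (intro sum_nonneg) auto
  have bound: "\<bar>Vn n l i j\<bar> \<le> sqrt (K / c)" for n l i j
  proof (cases "1 \<le> l \<and> l \<le> L \<and> i < d l \<and> j < d (l - 1)")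
    case True
    have "c * (Vn n l i j)\<^sup>2 \<le> lam l * (\<Sum>i<d l. \<Sum>j<d (l - 1). (Vn n l i j)\<^sup>2)"
      using c True by (intro mult_mono entry_le_double_sum) (auto intro: order_trans[OF less_imp_le])
    also have "\<dots> \<le> K" using crit_bound[OF V] True by (simp add: K_def)
    finally have "(Vn n l i j)\<^sup>2 \<le> K / c" using c by (simp add: field_simps)
    then show ?thesis using real_le_rsqrt by (metis power2_abs)
  next
    case False
    then have "l < 1 \<or> l > L \<or> i \<ge> d l \<or> j \<ge> d (l - 1)" by linarith
    then have "Vn n l i j = 0" using V[of n] unfolding crit_iff wt_valid_def by blast
    then show ?thesis using K c by simp
  qed
  obtain g r where r: "strict_mono (r :: nat \<Rightarrow> nat)" and g: "\<And>l i j. (\<lambda>n. Vn (r n) l i j) \<longlonglongrightarrow> g l i j"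
    by (rule bounded_subsequence[of Vn, OF bound]) (rule that)
  interpret supported_sequence L d "\<lambda>n. layers d (Vn (r n))" "layers d g"
    by unfold_locales (auto simp: proj_layers proj_layers[unfolded One_nat_def] intro!: mconv_layers g)
  have "wt_valid d L g" unfolding wt_valid_def
  proof (intro allI impI)
    fix l i j assume "l < 1 \<or> l > L \<or> i \<ge> d l \<or> j \<ge> d (l - 1)"
    then have "(\<lambda>n. Vn (r n) l i j) = (\<lambda>n. 0)" using V unfolding crit_iff wt_valid_def by blast
    then show "g l i j = 0" using g[of l i j] by (simp add: LIMSEQ_const_iff)
  qed
  moreover have "hgrad lam Ym L (layers d g) l = 0" if l: "1 \<le> l" "l \<le> L" for l
  proof -
    have "mconv (\<lambda>n. hgrad lam Ym L (layers d (Vn (r n))) l) (hgrad lam Ym L (layers d g) l)"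
      by (rule mconv_hgrad[OF l]) simp_all
    then have "mconv (\<lambda>n. 0) (hgrad lam Ym L (layers d g) l)" using crit_layers[OF V l] by simp
    from mconv_unique[OF mconv_const this] show ?thesis by simp
  qed
  ultimately have "g \<in> crit" by (simp add: crit_iff)
  then show thesis using that r g by blast
qed

text \<open>As L >= 2, every data term of the gradient keeps a zero layer as a factor. The point
  makes the critical set nonempty, so that the infimum defining the distance is meaningful.\<close>

lemma zero_crit: "(\<lambda>l i j. 0) \<in> crit"
proof -
  have 0: "layers d (\<lambda>l i j. 0) = (\<lambda>l. 0)"
    by (rule ext, rule rmat_eqI) (simp add: ent_layers)
  have pr0: "pr (\<lambda>l. 0) n k = 0" if "k < n" for n k using that by (cases n) auto
  have "hgrad lam Ym L (\<lambda>l. 0) l = 0" if "1 \<le> l" "l \<le> L" for l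
  proof (cases "l = L")
    case True
    then have "pr (\<lambda>l. 0) (l - 1) 0 = 0" using L2 by (intro pr0) auto
    then show ?thesis by (simp add: hgrad_def)
  next
    case False
    then have "pr (\<lambda>l. 0) L l = 0" using that by (intro pr0) auto
    then show ?thesis by (simp add: hgrad_def)
  qed
  then show ?thesis by (simp add: crit_iff wt_valid_def 0)
qed

lemma wsq_nonneg: "wsq W V \<ge> 0"
  unfolding wsq_def by (intro sum_nonneg mult_nonneg_nonneg) (use lampos less_imp_le in auto)

text \<open>A minimising sequence has a subsequence that converges inside the critical set, and
  \<open>wsq\<close> is continuous.\<close>

lemma nearest_exists: obtains V where "V \<in> crit" "\<And>V'. V' \<in> crit \<Longrightarrow> wsq W V \<le> wsq W V'"
proof -
  let ?I = "INF V\<in>crit. wsq W V"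
  have bdd: "bdd_below (wsq W ` crit)" by (rule bdd_belowI[of _ 0]) (auto simp: wsq_nonneg)
  have "\<exists>V\<in>crit. wsq W V < ?I + 1 / real (Suc n)" for n
    using cINF_less_iff[of crit "wsq W" "?I + 1 / real (Suc n)"] bdd zero_crit by auto
  then obtain Vn where Vn: "\<And>n. Vn n \<in> crit" "\<And>n. wsq W (Vn n) < ?I + 1 / real (Suc n)" by metis
  obtain V r where V: "V \<in> crit" "strict_mono (r :: nat \<Rightarrow> nat)" "\<And>l i j. (\<lambda>n. Vn (r n) l i j) \<longlonglongrightarrow> V l i j"
    using crit_compact[of Vn, OF Vn(1)] by blast
  have 1: "(\<lambda>n. wsq W (Vn (r n))) \<longlonglongrightarrow> wsq W V"
    unfolding wsq_def by (intro tendsto_intros V)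
  have "(\<lambda>n. ?I + 1 / real (Suc n)) \<longlonglongrightarrow> ?I + 0"
    by (intro tendsto_intros LIMSEQ_Suc[OF lim_1_over_n])
  then have 2: "(\<lambda>n. ?I + 1 / real (Suc (r n))) \<longlonglongrightarrow> ?I"
    using LIMSEQ_subseq_LIMSEQ[OF _ V(2)] by (simp add: o_def) fastforce
  have "wsq W V \<le> ?I"
    by (rule LIMSEQ_le[OF 1 2]) (use Vn(2) less_imp_le in blast)
  then have "wsq W V \<le> wsq W V'" if "V' \<in> crit" for V'
    using cINF_lower[OF bdd that] by linarith
  with V(1) show thesis by (rule that)
qed

end

subsection \<open>The error bound\<close>

context mf_problem
begin

lemma wdist_wsq_bounds:
  obtains c C where "c > 0" "C > 0" "\<And>W V. c * wdist d L W V \<le> sqrt (wsq W V)"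
    "\<And>W V. sqrt (wsq W V) \<le> C * wdist d L W V"
proof -
  obtain c where c: "c > 0" "\<And>l. 1 \<le> l \<Longrightarrow> l \<le> L \<Longrightarrow> c \<le> lam l" using lam_lower by blast
  define C where "C = (\<Sum>l=1..L. lam l)"
  have le: "lam l \<le> C" if "1 \<le> l" "l \<le> L" for l
    unfolding C_def by (rule member_le_sum) (use that lampos less_imp_le in auto)
  have C: "C > 0" using le[of 1] lampos[of 1] L2 by linarith
  have "sqrt c * wdist d L W V \<le> sqrt (wsq W V)" for W V
    unfolding wdist_def wsq_def real_sqrt_mult[symmetric] sum_distrib_left
    by (intro real_sqrt_le_mono sum_mono) (use c in \<open>auto intro!: mult_right_mono sum_nonneg simp flip: sum_distrib_left\<close>)
  moreover have "sqrt (wsq W V) \<le> sqrt C * wdist d L W V" for W V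
    unfolding wdist_def wsq_def real_sqrt_mult[symmetric] sum_distrib_left
    by (intro real_sqrt_le_mono sum_mono) (use le in \<open>auto intro!: mult_right_mono sum_nonneg simp flip: sum_distrib_left\<close>)
  ultimately show thesis using that[of "sqrt c" "sqrt C"] c(1) C by auto
qed

lemma grad_norm_ge:
  assumes l: "1 \<le> l" "l \<le> L" "i < d l" "j < d (l - 1)"
  shows "2 * \<bar>ent (hgrad lam Ym L (layers d W) l) i j\<bar> \<le> grad_norm d L lam Y W"
proof -
  have "(gradF d L lam Y W l i j)\<^sup>2 \<le> (\<Sum>i<d l. \<Sum>j<d (l - 1). (gradF d L lam Y W l i j)\<^sup>2)"
    by (rule entry_le_double_sum) fact+
  also have "\<dots> \<le> (\<Sum>l=1..L. \<Sum>i<d l. \<Sum>j<d (l - 1). (gradF d L lam Y W l i j)\<^sup>2)"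
    by (rule member_le_sum[where f = "\<lambda>l. \<Sum>i<d l. \<Sum>j<d (l - 1). (gradF d L lam Y W l i j)\<^sup>2"])
      (use l in \<open>auto intro!: sum_nonneg\<close>)
  finally have "\<bar>gradF d L lam Y W l i j\<bar> \<le> grad_norm d L lam Y W"
    unfolding grad_norm_def by (intro real_le_rsqrt) simp
  then show ?thesis using gradF_eq[OF l, of lam Y W] by simp
qed

lemma local_error_bound:
  assumes nondeg2: "\<And>u. L = 2 \<Longrightarrow> Ym * (tp Ym * u) = lprod lam 0 L *\<^sub>R u \<Longrightarrow> u = 0"
    and nondeg3: "\<And>a (s :: real). 3 \<le> L \<Longrightarrow> is_col a \<Longrightarrow> s > 0 \<Longrightarrow>
      tp Ym * (Ym * a) = (s ^ L / lprod lam 0 L * (1 + lprod lam 0 L / s ^ (L - 1))\<^sup>2) *\<^sub>R a \<Longrightarrow>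
      lprod lam 0 L + L * s ^ (L - 1) = lprod lam 0 L * (real L - 1) \<Longrightarrow> a = 0"
  shows "\<exists>\<epsilon>1>0. \<exists>\<kappa>1>0. \<forall>W. wt_valid d L W \<longrightarrow>
           wsetdist d L W crit \<le> \<epsilon>1 \<longrightarrow> wsetdist d L W crit \<le> \<kappa>1 * grad_norm d L lam Y W"
proof (rule ccontr)
  let ?D = "\<lambda>W. wsetdist d L W crit" and ?N = "\<lambda>W. grad_norm d L lam Y W"
  assume no: "\<not> ?thesis"
  \<comment> \<open>The negated claim, applied with radius 1/(n+1) and constant n+1.\<close>
  have "\<exists>W. wt_valid d L W \<and> ?D W \<le> 1 / real (Suc n) \<and> ?D W > real (Suc n) * ?N W" for n
  proof (rule ccontr)
    assume "\<not> ?thesis"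
    then have "\<forall>W. wt_valid d L W \<longrightarrow> ?D W \<le> 1 / real (Suc n) \<longrightarrow> ?D W \<le> real (Suc n) * ?N W"
      by (meson not_less)
    moreover have "1 / real (Suc n) > 0" "real (Suc n) > 0" by auto
    ultimately show False using no by blast
  qed
  then obtain W where W: "\<And>n. wt_valid d L (W n)" "\<And>n. ?D (W n) \<le> 1 / real (Suc n)"
    "\<And>n. ?D (W n) > real (Suc n) * ?N (W n)" by metis
  have "\<forall>n. \<exists>V. V \<in> crit \<and> (\<forall>V'\<in>crit. wsq (W n) V \<le> wsq (W n) V')"
  proof
    fix n
    obtain V where "V \<in> crit" "\<And>V'. V' \<in> crit \<Longrightarrow> wsq (W n) V \<le> wsq (W n) V'"
      by (rule nearest_exists) (rule that)
    then show "\<exists>V. V \<in> crit \<and> (\<forall>V'\<in>crit. wsq (W n) V \<le> wsq (W n) V')" by blast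
  qed
  from choice[OF this] obtain Vn
    where Vn: "\<And>n. Vn n \<in> crit" "\<And>n V'. V' \<in> crit \<Longrightarrow> wsq (W n) (Vn n) \<le> wsq (W n) V'"
    by blast
  define e where "e n = sqrt (wsq (W n) (Vn n))" for n
  obtain c C where cC: "c > 0" "C > 0" "\<And>W V. c * wdist d L W V \<le> sqrt (wsq W V)"
    "\<And>W V. sqrt (wsq W V) \<le> C * wdist d L W V" using wdist_wsq_bounds by blast
  have ne: "crit \<noteq> {}" using zero_crit by blast
  \<comment> \<open>\<open>Vn n\<close> is nearest for the weighted norm, whereas
    \<open>wsetdist\<close> uses the plain one; equivalence of the norms makes \<open>e n\<close>
    and the distance comparable in both directions.\<close>
  have Dle: "c * ?D (W n) \<le> e n" for n
  proof -
    have "bdd_below (wdist d L (W n) ` crit)"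
      by (rule bdd_belowI[of _ 0]) (auto simp: wdist_def sum_nonneg)
    then have "?D (W n) \<le> wdist d L (W n) (Vn n)"
      unfolding wsetdist_def using Vn(1) by (rule cINF_lower)
    then have "c * ?D (W n) \<le> c * wdist d L (W n) (Vn n)" using cC(1) by simp
    also have "\<dots> \<le> e n" unfolding e_def by (rule cC(3))
    finally show ?thesis .
  qed
  have eD: "e n \<le> C * ?D (W n)" for n
  proof -
    have "e n / C \<le> ?D (W n)" unfolding wsetdist_def
    proof (rule cINF_greatest[OF ne])
      fix V' assume "V' \<in> crit"
      then have "e n \<le> sqrt (wsq (W n) V')" unfolding e_def using Vn(2) by simp
      also have "\<dots> \<le> C * wdist d L (W n) V'" by (rule cC(4))
      finally show "e n / C \<le> wdist d L (W n) V'" using cC(2) by (simp add: field_simps)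
    qed
    then show ?thesis using cC(2) by (simp add: field_simps)
  qed
  have Nnn: "?N W \<ge> 0" for W unfolding grad_norm_def by (intro real_sqrt_ge_zero sum_nonneg) auto
  have Dpos: "?D (W n) > 0" for n
    using W(3)[of n] Nnn[of "W n"] by (metis le_less_trans mult_nonneg_nonneg of_nat_0_le_iff)
  have epos: "e n > 0" for n
    using Dle[of n] Dpos[of n] cC(1) by (meson less_le_trans mult_pos_pos)
  have inv0: "(\<lambda>n. a * (1 / real (Suc n))) \<longlonglongrightarrow> 0" for a :: real
    using tendsto_mult_right_zero[OF LIMSEQ_Suc[OF lim_1_over_n], of a] by simp
  have e0: "e \<longlonglongrightarrow> 0"
  proof (rule tendsto_sandwich[OF _ _ tendsto_const inv0[of C]])
    show "\<forall>\<^sub>F n in sequentially. 0 \<le> e n" using epos less_imp_le by (intro always_eventually allI) blast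
    have "e n \<le> C * (1 / real (Suc n))" for n
      using eD[of n] W(2)[of n] cC(2) by (meson mult_left_mono order_trans less_imp_le)
    then show "\<forall>\<^sub>F n in sequentially. e n \<le> C * (1 / real (Suc n))" by (intro always_eventually allI)
  qed
  \<comment> \<open>The violated bound makes the gradient smaller than the distance by the factor
    n+1, hence of lower order than \<open>e n\<close>; so the limit direction solves the homogeneous
    linearised equations.\<close>
  have grad_small: "\<bar>1 / e n * ent (hgrad lam Ym L (layers d (W n)) l) i j\<bar> \<le> (1 / c) * (1 / real (Suc n))"
    if l: "1 \<le> l" "l \<le> L" for n l i j
  proof (cases "i < d l \<and> j < d (l - 1)")
    case True
    let ?h = "\<bar>ent (hgrad lam Ym L (layers d (W n)) l) i j\<bar>"
    have "?h \<le> ?N (W n)" using grad_norm_ge[OF l, of i j "W n"] True by linarith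
    then have "real (Suc n) * ?h \<le> ?D (W n)"
      using W(3)[of n] by (meson less_imp_le mult_left_mono of_nat_0_le_iff order_trans)
    then have "c * (real (Suc n) * ?h) \<le> c * ?D (W n)" using cC(1) by simp
    then have "c * (real (Suc n) * ?h) \<le> e n" using Dle[of n] by linarith
    then have le: "?h / e n \<le> 1 / (c * real (Suc n))"
      using epos[of n] cC(1) by (simp add: field_simps del: of_nat_Suc)
    have "\<bar>1 / e n * ent (hgrad lam Ym L (layers d (W n)) l) i j\<bar> = ?h / e n"
      using epos[of n] by (simp add: abs_mult)
    also note le
    finally show ?thesis by simp
  next
    case False
    then have "ent (hgrad lam Ym L (layers d (W n)) l) i j = 0"
      using proj_hgrad[OF l refl, where lam = lam and d = d and Y = Y and W = "W n"]
      unfolding proj_mult_iff mult_proj_iff by (meson not_less)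
    then show ?thesis using cC(1) by simp
  qed
  define Z where "Z n l i j = (W n l i j - Vn n l i j) / e n" for n l i j
  have Zsq: "(\<Sum>l=1..L. lam l * (\<Sum>i<d l. \<Sum>j<d (l - 1). (Z n l i j)\<^sup>2)) = 1" for n
  proof -
    have "(e n)\<^sup>2 * (\<Sum>l=1..L. lam l * (\<Sum>i<d l. \<Sum>j<d (l - 1). (Z n l i j)\<^sup>2)) = wsq (W n) (Vn n)"
      unfolding wsq_def sum_distrib_left
      using epos[of n] by (intro sum.cong refl) (simp add: Z_def power_divide)
    also have "\<dots> = (e n)\<^sup>2" by (simp add: e_def wsq_nonneg)
    finally show ?thesis using epos[of n] by simp
  qed
  obtain c' where c': "c' > 0" "\<And>l. 1 \<le> l \<Longrightarrow> l \<le> L \<Longrightarrow> c' \<le> lam l" using lam_lower by blast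
  have Zbound: "\<bar>Z n l i j\<bar> \<le> sqrt (1 / c')" for n l i j
  proof (cases "1 \<le> l \<and> l \<le> L \<and> i < d l \<and> j < d (l - 1)")
    case True
    have "c' * (Z n l i j)\<^sup>2 \<le> lam l * (\<Sum>i<d l. \<Sum>j<d (l - 1). (Z n l i j)\<^sup>2)"
      using c' True by (intro mult_mono entry_le_double_sum) (auto intro: order_trans[OF less_imp_le])
    also have "\<dots> \<le> (\<Sum>l=1..L. lam l * (\<Sum>i<d l. \<Sum>j<d (l - 1). (Z n l i j)\<^sup>2))"
      by (rule member_le_sum[where f = "\<lambda>l. lam l * (\<Sum>i<d l. \<Sum>j<d (l - 1). (Z n l i j)\<^sup>2)"])
        (use True lampos less_imp_le in \<open>auto intro!: mult_nonneg_nonneg sum_nonneg\<close>)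
    finally have "(Z n l i j)\<^sup>2 \<le> 1 / c'" using c'(1) unfolding Zsq by (simp add: field_simps)
    then show ?thesis using real_le_rsqrt by (metis power2_abs)
  next
    case False
    then have "l < 1 \<or> l > L \<or> i \<ge> d l \<or> j \<ge> d (l - 1)" by linarith
    then have "Vn n l i j = 0" "W n l i j = 0"
      using Vn(1)[of n] W(1)[of n] unfolding crit_iff wt_valid_def by blast+
    then show ?thesis using c'(1) by (simp add: Z_def)
  qed
  obtain V r1 where r1: "V \<in> crit" "strict_mono (r1 :: nat \<Rightarrow> nat)"
    "\<And>l i j. (\<lambda>n. Vn (r1 n) l i j) \<longlonglongrightarrow> V l i j"
    using crit_compact[of Vn, OF Vn(1)] by blast
  obtain X r2 where r2: "strict_mono (r2 :: nat \<Rightarrow> nat)" "\<And>l i j. (\<lambda>n. Z (r1 (r2 n)) l i j) \<longlonglongrightarrow> X l i j"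
    by (rule bounded_subsequence[of "\<lambda>n. Z (r1 n)", OF Zbound]) (rule that)
  define r where "r n = r1 (r2 n)" for n
  have r: "strict_mono r" using r1(2) r2(1) by (simp add: r_def strict_mono_def)
  have sub: "(\<lambda>n. f (r n)) \<longlonglongrightarrow> x" if "f \<longlonglongrightarrow> x" for f :: "nat \<Rightarrow> real" and x
    using LIMSEQ_subseq_LIMSEQ[OF that r] by (simp add: o_def)
  have X0: "layers d X l = 0" if l: "1 \<le> l" "l \<le> L" for l
  proof (rule limit_direction_zero[where W = "\<lambda>n. W (r n)" and Vn = "\<lambda>n. Vn (r n)" and e = "\<lambda>n. e (r n)"
        and V = "layers d V" and X = "layers d X", OF _ _ _ _ _ _ _ nondeg2 nondeg3 l])
    show "(\<lambda>n. e (r n)) \<longlonglongrightarrow> 0" by (rule sub[OF e0])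
    show "mconv (\<lambda>n. layers d (Vn (r n)) l) (layers d V l)" for l
    proof (rule mconv_layers)
      fix l i j
      show "(\<lambda>n. Vn (r n) l i j) \<longlonglongrightarrow> V l i j"
        using LIMSEQ_subseq_LIMSEQ[OF r1(3)[of l i j] r2(1)] by (simp add: o_def r_def)
    qed
    have "(1 / e (r n)) *\<^sub>R (layers d (W (r n)) l - layers d (Vn (r n)) l) = layers d (Z (r n)) l" for n l
      by (rule rmat_eqI) (simp add: ent_layers Z_def)
    then show "mconv (\<lambda>n. (1 / e (r n)) *\<^sub>R (layers d (W (r n)) l - layers d (Vn (r n)) l)) (layers d X l)" for l
      using mconv_layers[of "\<lambda>n. Z (r n)" X l] r2(2) by (simp add: r_def)
    show "mconv (\<lambda>n. (1 / e (r n)) *\<^sub>R hgrad lam Ym L (layers d (W (r n))) l) 0" if l: "1 \<le> l" "l \<le> L" for l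
      unfolding mconv_def
    proof (intro allI)
      fix i j
      have "(\<lambda>n. 1 / e n * ent (hgrad lam Ym L (layers d (W n)) l) i j) \<longlonglongrightarrow> 0"
        by (rule Lim_null_comparison[OF _ inv0[of "1 / c"]])
          (intro always_eventually allI, unfold real_norm_def, rule grad_small[OF l])
      from sub[OF this]
      show "(\<lambda>n. ent ((1 / e (r n)) *\<^sub>R hgrad lam Ym L (layers d (W (r n))) l) i j) \<longlonglongrightarrow> ent 0 i j"
        by simp
    qed
  qed (use Vn epos in auto)
  have "(\<lambda>n. \<Sum>l=1..L. lam l * (\<Sum>i<d l. \<Sum>j<d (l - 1). (Z (r n) l i j)\<^sup>2))
      \<longlonglongrightarrow> (\<Sum>l=1..L. lam l * (\<Sum>i<d l. \<Sum>j<d (l - 1). (X l i j)\<^sup>2))"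
    unfolding r_def by (intro tendsto_intros r2)
  \<comment> \<open>The weighted norm is a finite sum of entries, so the limit direction still has
    norm one.\<close>
  then have "(\<Sum>l=1..L. lam l * (\<Sum>i<d l. \<Sum>j<d (l - 1). (X l i j)\<^sup>2)) = 1"
    unfolding Zsq by (simp add: LIMSEQ_const_iff)
  moreover have "X l i j = 0" if "1 \<le> l" "l \<le> L" "i < d l" "j < d (l - 1)" for l i j
    using arg_cong[OF X0[OF that(1,2)], of "\<lambda>M. ent M i j"] that by (simp add: ent_layers)
  then have "(\<Sum>l=1..L. lam l * (\<Sum>i<d l. \<Sum>j<d (l - 1). (X l i j)\<^sup>2)) = 0"
    by (intro sum.neutral ballI) simp
  ultimately show False by simp
qed

end

theorem theorem2p2:
  fixes L :: nat and d :: "nat \<Rightarrow> nat" and lam :: "nat \<Rightarrow> real"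
    and Y :: "nat \<Rightarrow> nat \<Rightarrow> real"
  assumes L2: "L \<ge> 2"
    and dpos: "\<forall>l\<le>L. d l > 0"
    and lampos: "\<forall>l\<in>{1..L}. lam l > 0"
    and A1: "\<forall>l\<in>{1..L-1}. d l \<ge> min (d 0) (d L)"
    and A2_L2: "L = 2 \<Longrightarrow>
       \<forall>y. pos_singular_value (d L) (d 0) Y y \<longrightarrow> (\<Prod>l=1..L. lam l) \<noteq> y\<^sup>2"
    and A2_L3: "L \<ge> 3 \<Longrightarrow>
       \<forall>y. pos_singular_value (d L) (d 0) Y y \<longrightarrow>
         (\<Prod>l=1..L. lam l) \<noteq> y ^ (2 * (L - 1)) *
           ((real (L - 2) / real L) powr (real L / (2 * (real L - 1)))
            + (real L / real (L - 2)) powr ((real L - 2) / (2 * (real L - 1))))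
           powr (- (2 * (real L - 1)))"
  shows "\<exists>\<epsilon>1>0. \<exists>\<kappa>1>0. \<forall>W. wt_valid d L W \<longrightarrow>
           wsetdist d L W (crit_set d L lam Y) \<le> \<epsilon>1 \<longrightarrow>
           wsetdist d L W (crit_set d L lam Y) \<le> \<kappa>1 * grad_norm d L lam Y W"
proof -
  interpret mf_problem L d lam Y
    by unfold_locales (use L2 lampos in auto)
  let ?\<Lambda> = "lprod lam 0 L"
  have \<Lambda>: "?\<Lambda> > 0" unfolding lprod_0 by (intro prod_pos) (use lampos in auto)
  show ?thesis
  proof (rule local_error_bound)
    fix u assume L: "L = 2" and u: "Ym * (tp Ym * u) = ?\<Lambda> *\<^sub>R u"
    show "u = 0"
    proof (rule ccontr)
      assume "u \<noteq> 0"
      \<comment> \<open>Singular values are defined through Y^T Y, so the eigenvector u of Y Y^T is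
        transported to Y^T u, which is nonzero because \<Lambda> > 0.\<close>
      then have "tp Ym * u \<noteq> 0" using u \<Lambda> by auto
      moreover have "tp Ym * (Ym * (tp Ym * u)) = (sqrt ?\<Lambda>)\<^sup>2 *\<^sub>R (tp Ym * u)"
        unfolding u using \<Lambda> by simp
      ultimately have "pos_singular_value (d L) (d 0) Y (sqrt ?\<Lambda>)"
        using \<Lambda> by (intro pos_singular_valueI) auto
      then have "?\<Lambda> \<noteq> (sqrt ?\<Lambda>)\<^sup>2" using A2_L2[OF L] unfolding lprod_0 by blast
      then show False using \<Lambda> by simp
    qed
  next
    fix a and s :: real
    \<comment> \<open>The positive square root of the eigenvalue in \<open>a\<close>, that is, the
      value sigma(s).\<close>
    let ?\<sigma> = "sqrt (s ^ L / ?\<Lambda>) * (1 + ?\<Lambda> / s ^ (L - 1))"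
    assume L: "3 \<le> L" and s: "s > 0"
      and a: "tp Ym * (Ym * a) = (s ^ L / ?\<Lambda> * (1 + ?\<Lambda> / s ^ (L - 1))\<^sup>2) *\<^sub>R a"
      and eq: "?\<Lambda> + L * s ^ (L - 1) = ?\<Lambda> * (real L - 1)"
    show "a = 0"
    proof (rule ccontr)
      assume "a \<noteq> 0"
      moreover have "?\<sigma> > 0" using s \<Lambda> by (intro mult_pos_pos add_pos_pos) auto
      moreover have "tp Ym * (Ym * a) = ?\<sigma>\<^sup>2 *\<^sub>R a"
        unfolding a using s \<Lambda> by (simp add: power_mult_distrib)
      ultimately have "pos_singular_value (d L) (d 0) Y ?\<sigma>"
        by (intro pos_singular_valueI)
      then show False
        using A2_L3[OF L] threshold_eq[OF L s \<Lambda> eq] unfolding lprod_0[symmetric] by blast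
    qed
  qed
qed

end
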